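(* Consider the random wire model on $\mathcal G^{\rm b}_L$ with $\alpha=2$, $J_e\equiv J\ge0$ on all edges (including boundary edges), and $e^{-U(n)}=1/n!$. Then the limit \[\tilde m(d,J)=\lim_{L\to\infty}\mathbb E^{2,J}_{\mathcal G^{\rm b}_L}\Bigl[\frac{\tilde n_0}{n_0+1}\Bigr]\] exists, and: (a) $\tilde m(d,J)$ is nondecreasing in $d$ and in $J$; (b) $\tilde m(d,J)=0$ whenever $J<2^{-3/2}\log\bigl(1+\frac1{(2d)^2}\bigr)$, in any dimension $d$; (c) $\tilde m(d,J)=0$ for $d=1,2$ and all $J\ge0$; (d) for $d\ge3$ there is $J_{\rm c}(d)<\infty$ such that $\tilde m(d,J)>0$ for $J>J_{\rm c}(d)$ and $\tilde m(d,J)=0$ for $J<J_{\rm c}(d)$.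
   Context: Random wire model (finite graph): for $\mathcal G=(\mathcal V,\mathcal E)$ and $\boldsymbol m\in\mathbb N_0^{\mathcal E}$, $n_x(\boldsymbol m)=\frac12\sum_{e\ni x}m_e$; link configurations have $n_x\in\mathbb N_0$ at each $x$; a pairing configuration is a perfect matching at each site of the link-endpoints at that site; a wire configuration $\boldsymbol w=(\boldsymbol m,\boldsymbol\pi)$ decomposes into loops (follow links through pairings); $\lambda(\boldsymbol w)$ is the number of loops; weight $\alpha^{\lambda(\boldsymbol w)}\prod_e\frac{J_e^{m_e}}{m_e!}\exp\{-\sum_x U(n_x)\}$, normalised by the partition function. Graph with boundary: $\mathcal G^{\rm b}=(\mathcal V\cup\bar{\mathcal V},\mathcal E\cup\bar{\mathcal E})$ with $\bar{\mathcal E}\subset\mathcal V\times\bar{\mathcal V}$; links live on $\mathcal E\cup\bar{\mathcal E}$; the evenness constraint and pairings are imposed only at sites of $\mathcal V$ (none at $\bar{\mathcal V}$), and $n_x$ is defined for $x\in\mathcal V$ as half the number of link-endpoints at $x$. Besides closed loops there are open loops, which start and end with a link in $\bar{\mathcal E}$; $\lambda(\boldsymbol w)$ counts both closed and open loops, and the weight is $\alpha^{\lambda(\boldsymbol w)}\prod_{e\in\mathcal E\cup\bar{\mathcal E}}\frac{J_e^{m_e}}{m_e!}\exp\{-\sum_{x\in\mathcal V}U(n_x)\}$. Here $\Lambda_L=\{-L,\dots,L\}^d$, $\partial\Lambda_L=\{y\in\mathbb Z^d\setminus\Lambda_L:\exists x\in\Lambda_L,\|x-y\|=1\}$, $\mathcal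 G^{\rm b}_L$ has vertices $\Lambda_L$, boundary $\partial\Lambda_L$, edges all nearest-neighbour pairs within $\Lambda_L$ and between $\Lambda_L$ and $\partial\Lambda_L$. For $x\in\Lambda_L$, $\tilde n_x(\boldsymbol w)$ is half the number of link-endpoints at $x$ belonging to links of open loops, i.e. the number of pairs at $x$ belonging to open loops. *)

theory Defs
  imports "HOL-Analysis.Analysis"
begin

section \<open>Random wire model on a finite graph with boundary\<close>

text \<open>Sites are integer vectors (lists), edges are two-element sets of sites.
A graph with boundary is given by its inner vertex set V and its edge set E
(edges inside V and edges from V to the boundary). A half-link (link endpoint)
is a triple (e, i, x): the i-th link on edge e, at its endpoint x.\<close>

type_synonym site = "int list"
type_synonym edge = "site set"
type_synonym hlink = "edge \<times> nat \<times> site"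

definition other_end :: "edge \<Rightarrow> site \<Rightarrow> site" where
  "other_end e x = (THE y. e = {x, y})"

definition hsite :: "hlink \<Rightarrow> site" where
  "hsite h = snd (snd h)"

text \<open>Link endpoints of the link configuration m.\<close>
definition half_links :: "edge set \<Rightarrow> (edge \<Rightarrow> nat) \<Rightarrow> hlink set" where
  "half_links E m = {(e, i, x). e \<in> E \<and> i < m e \<and> x \<in> e}"

text \<open>The other endpoint of the same link.\<close>
definition link_partner :: "hlink \<Rightarrow> hlink" where
  "link_partner h = (case h of (e, i, x) \<Rightarrow> (e, i, other_end e x))"

text \<open>Sum of link numbers at x (twice n_x).\<close>
definition deg :: "edge set \<Rightarrow> (edge \<Rightarrow> nat) \<Rightarrow> site \<Rightarrow> nat" where
  "deg E m x = (\<Sum>e\<in>{e\<in>E. x \<in> e}. m e)"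

definition n_site :: "edge set \<Rightarrow> (edge \<Rightarrow> nat) \<Rightarrow> site \<Rightarrow> nat" where
  "n_site E m x = deg E m x div 2"

text \<open>Link configurations: supported on E, with even number of link endpoints at each inner site.\<close>
definition link_config :: "site set \<Rightarrow> edge set \<Rightarrow> (edge \<Rightarrow> nat) \<Rightarrow> bool" where
  "link_config V E m \<longleftrightarrow> (\<forall>e. e \<notin> E \<longrightarrow> m e = 0) \<and> (\<forall>x\<in>V. even (deg E m x))"

text \<open>Pairing configuration: at each inner site x, a perfect matching of the link
endpoints at x, encoded as a fixed-point-free involution sigma on these endpoints;
sigma is the identity on everything else (boundary endpoints, non-endpoints).\<close>
definition pairing_config ::
  "site set \<Rightarrow> edge set \<Rightarrow> (edge \<Rightarrow> nat) \<Rightarrow> (hlink \<Rightarrow> hlink) \<Rightarrow> bool" where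
  "pairing_config V E m \<sigma> \<longleftrightarrow>
     (\<forall>h. (h \<notin> half_links E m \<or> hsite h \<notin> V) \<longrightarrow> \<sigma> h = h) \<and>
     (\<forall>h\<in>half_links E m. hsite h \<in> V \<longrightarrow>
        \<sigma> h \<in> half_links E m \<and> \<sigma> h \<noteq> h \<and> hsite (\<sigma> h) = hsite h \<and> \<sigma> (\<sigma> h) = h)"

type_synonym wire = "(edge \<Rightarrow> nat) \<times> (hlink \<Rightarrow> hlink)"

definition wire_configs :: "site set \<Rightarrow> edge set \<Rightarrow> wire set" where
  "wire_configs V E = {(m, \<sigma>). link_config V E m \<and> pairing_config V E m \<sigma>}"

text \<open>Two link endpoints lie on the same loop iff they are connected by following
links and pairings.\<close>
definition loop_equiv :: "edge set \<Rightarrow> wire \<Rightarrow> (hlink \<times> hlink) set" where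
  "loop_equiv E w = (let H = half_links E (fst w);
      R = {(h, link_partner h) | h. h \<in> H} \<union> {(h, snd w h) | h. h \<in> H}
    in (R \<union> R\<inverse>)\<^sup>*)"

text \<open>Number of loops (closed and open).\<close>
definition num_loops :: "edge set \<Rightarrow> wire \<Rightarrow> nat" where
  "num_loops E w = card (half_links E (fst w) // loop_equiv E w)"

text \<open>A link endpoint belongs to an open loop iff its loop reaches a boundary site.\<close>
definition on_open_loop :: "site set \<Rightarrow> edge set \<Rightarrow> wire \<Rightarrow> hlink \<Rightarrow> bool" where
  "on_open_loop V E w h \<longleftrightarrow>
     (\<exists>h'. (h, h') \<in> loop_equiv E w \<and> h' \<in> half_links E (fst w) \<and> hsite h' \<notin> V)"

text \<open>n-tilde at x: number of pairs at x belonging to open loops.\<close>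
definition n_open :: "site set \<Rightarrow> edge set \<Rightarrow> wire \<Rightarrow> site \<Rightarrow> nat" where
  "n_open V E w x =
     card {h \<in> half_links E (fst w). hsite h = x \<and> on_open_loop V E w h} div 2"

definition wire_weight ::
  "site set \<Rightarrow> edge set \<Rightarrow> real \<Rightarrow> (edge \<Rightarrow> real) \<Rightarrow> (nat \<Rightarrow> real) \<Rightarrow> wire \<Rightarrow> real" where
  "wire_weight V E \<alpha> J U w =
     \<alpha> ^ num_loops E w * (\<Prod>e\<in>E. J e ^ fst w e / fact (fst w e))
       * exp (- (\<Sum>x\<in>V. U (n_site E (fst w) x)))"

definition partition_fn ::
  "site set \<Rightarrow> edge set \<Rightarrow> real \<Rightarrow> (edge \<Rightarrow> real) \<Rightarrow> (nat \<Rightarrow> real) \<Rightarrow> real" where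
  "partition_fn V E \<alpha> J U = (\<Sum>\<^sub>\<infinity>w\<in>wire_configs V E. wire_weight V E \<alpha> J U w)"

definition wire_expect ::
  "site set \<Rightarrow> edge set \<Rightarrow> real \<Rightarrow> (edge \<Rightarrow> real) \<Rightarrow> (nat \<Rightarrow> real) \<Rightarrow> (wire \<Rightarrow> real) \<Rightarrow> real" where
  "wire_expect V E \<alpha> J U f =
     (\<Sum>\<^sub>\<infinity>w\<in>wire_configs V E. f w * wire_weight V E \<alpha> J U w) / partition_fn V E \<alpha> J U"

section \<open>The box with boundary in Z^d\<close>

definition nn :: "site \<Rightarrow> site \<Rightarrow> bool" where
  "nn x y \<longleftrightarrow> length x = length y \<and> (\<Sum>i<length x. \<bar>x ! i - y ! i\<bar>) = 1"

definition box :: "nat \<Rightarrow> nat \<Rightarrow> site set" where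
  "box d L = {x. length x = d \<and> (\<forall>i<d. \<bar>x ! i\<bar> \<le> int L)}"

definition box_boundary :: "nat \<Rightarrow> nat \<Rightarrow> site set" where
  "box_boundary d L = {y. length y = d \<and> y \<notin> box d L \<and> (\<exists>x\<in>box d L. nn x y)}"

definition box_edges :: "nat \<Rightarrow> nat \<Rightarrow> edge set" where
  "box_edges d L = {{x, y} | x y. x \<in> box d L \<and> y \<in> box d L \<union> box_boundary d L \<and> nn x y}"

definition origin :: "nat \<Rightarrow> site" where
  "origin d = replicate d 0"

text \<open>E^{2,J}[ n-tilde_0 / (n_0 + 1) ] on G^b_L, with J_e = J and e^{-U(n)} = 1/n!,
i.e. U(n) = ln(n!).\<close>
definition m_L :: "nat \<Rightarrow> real \<Rightarrow> nat \<Rightarrow> real" where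
  "m_L d J L = wire_expect (box d L) (box_edges d L) 2 (\<lambda>_. J) (\<lambda>n. ln (fact n))
     (\<lambda>w. real (n_open (box d L) (box_edges d L) w (origin d))
           / (real (n_site (box_edges d L) (fst w) (origin d)) + 1))"

end

theory Submission
  imports Defs "HOL-Probability.Probability" "HOL-Library.Transitive_Closure_Table"
begin

text \<open>For \<open>\<alpha> = 2\<close> and \<open>e^{-U(n)} = 1/n!\<close> the wire model is the classical XY model with coupling \<open>2J\<close> and
boundary spins 1: expand the Gibbs weight in powers of the scalar products, choose a component (colour)
for every link, and integrate site by site. The moments of the circle count the pairings that preserve
the colours, and with boundary spins on the first axis each closed loop has two colours, while an open loop
has one colour and carries the factor 2 at its two ends. The expectation of \<open>n_open / (n_site + 1)\<close> at the origin becomes that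
of \<open>cos 2\<theta>\<close>.

Ginibre's inequality gives monotonicity in J, in d and, by conditioning on outer spins, in L. High temperature is a
percolation bound, and d = 2 a Mermin-Wagner rotation whose energy is of order \<open>1 / log L\<close>. For d = 3,
phases on the couplings can only lower the magnetization (Messager, Miracle-Sole and Pfister); averaging over the phases
on the Nishimori line turns order into the existence of an unbiased estimator of a spin from noisy
gradients with bounded variance, and averaging over random paths whose intersections have exponential
tails (Benjamini, Pemantle and Peres) provides one.\<close>

text \<open>Why cos 2\<theta>: at a site with a half-links of the first and b of the second colour,
  inserting Re (z^2) multiplies the circle moment by (a - b) / (2 (n + 1)), n = (a + b) / 2. Summed
  over colourings, a - b retains only half-links on open loops, and n + 1 is the denominator of the
  observable. The site weight 1/n! sits in the same moments; their factor 2^(-n) is compensated by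
  the doubled coupling. The obstacle in d = 3 is a lower bound uniform in L. The gradients along one
  path from the origin to the boundary multiply to the spin at the origin, but estimating it along
  one noisy path costs a variance exponential in the length. Averaging over paths turns this into an
  exponential moment of the number of common edges of two paths. A simple directed walk is too
  predictable for this: its two transverse coordinates return after time k with probability of order
  1/k, which is not summable. The walk used here superposes uniform choices on all dyadic scales and
  reaches order k^(-4/3). The sum of these bounds, at most 3000, fixes the tolerance 1/6000 per
  common edge and with it the coupling 100000.\<close>

section \<open>The uniform measure on the circle\<close>

text \<open>The measure lives on the unit sphere itself and not on the plane, so that norm 1 holds
  at every point of the space and the bounds below are pointwise.\<close>

definition circ :: "complex measure" where
  "circ = distr (uniform_measure lborel {0..<2*pi}) (restrict_space borel (sphere 0 1)) cis"

lemma space_circ [simp]: "space circ = sphere 0 1"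
  by (simp add: circ_def space_restrict_space)

lemma sets_circ [measurable_cong]: "sets circ = sets (restrict_space borel (sphere 0 1))"
  by (simp add: circ_def)

lemma measurable_cis [measurable]: "cis \<in> measurable borel (restrict_space borel (sphere 0 1))"
  by (rule measurable_restrict_space2) (auto intro!: borel_measurable_continuous_onI continuous_intros)

lemma prob_space_uniform_angle: "prob_space (uniform_measure lborel {0..<2*pi})"
  by (rule prob_space_uniform_measure) auto

lemma prob_space_circ: "prob_space circ"
  unfolding circ_def
  by (rule prob_space.prob_space_distr[OF prob_space_uniform_angle]) simp

interpretation circ: prob_space circ by (rule prob_space_circ)

lemma emeasure_circ:
  assumes "A \<in> sets circ"
  shows "emeasure circ A = emeasure lborel ({0..<2*pi} \<inter> cis -` A) / ennreal (2*pi)"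
proof -
  have A: "A \<in> sets (restrict_space borel (sphere 0 1))" using assms sets_circ by auto
  have "cis -` A \<inter> space borel \<in> sets (borel :: real measure)"
    by (rule measurable_sets[OF measurable_cis A])
  then have B: "cis -` A \<in> sets (borel :: real measure)" by simp
  show ?thesis
    unfolding circ_def using A B
    by (subst emeasure_distr) (auto simp: emeasure_uniform_measure)
qed

lemma emeasure_lborel_shift:
  assumes "A \<in> sets (borel :: real measure)"
  shows "emeasure lborel ((\<lambda>t. c + t) -` A) = emeasure lborel A"
  using arg_cong[OF lborel_distr_plus[of c], of "\<lambda>M. emeasure M A"] assms
  by (subst (asm) emeasure_distr) auto

text \<open>Translation turns the window [0, 2 pi) into [p, p + 2 pi); the part beyond 2 pi is moved
  back by periodicity of \<open>cis\<close>.\<close>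

lemma emeasure_rotate_interval:
  assumes A: "A \<in> sets (borel :: complex measure)" and p: "0 \<le> p" "p < 2*pi"
  shows "emeasure lborel ({0..<2*pi} \<inter> (\<lambda>t. cis (p + t)) -` A) = emeasure lborel ({0..<2*pi} \<inter> cis -` A)"
proof -
  have [measurable]: "A \<in> sets (borel :: complex measure)" by (fact A)
  define B where "B = cis -` A"
  have m: "cis \<in> borel_measurable borel"
    by (auto intro!: borel_measurable_continuous_onI continuous_intros)
  have "cis -` A \<inter> space borel \<in> sets (borel :: real measure)" by (rule measurable_sets[OF m A])
  then have B [measurable]: "B \<in> sets (borel :: real measure)" by (simp add: B_def)
  have per: "x + 2*pi \<in> B \<longleftrightarrow> x \<in> B" for x
    unfolding B_def by (simp add: cis_mult[symmetric])
  have "{0..<2*pi} \<inter> (\<lambda>t. cis (p + t)) -` A = (\<lambda>t. p + t) -` (B \<inter> {p..<p+2*pi})"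
    by (auto simp: B_def)
  then have "emeasure lborel ({0..<2*pi} \<inter> (\<lambda>t. cis (p + t)) -` A) = emeasure lborel (B \<inter> {p..<p+2*pi})"
    by (simp only: emeasure_lborel_shift[OF sets.Int[OF B atLeastLessThan_borel]])
  also have "B \<inter> {p..<p+2*pi} = (B \<inter> {p..<2*pi}) \<union> (B \<inter> {2*pi..<p+2*pi})"
    using p by auto
  also have "emeasure lborel \<dots> = emeasure lborel (B \<inter> {p..<2*pi}) + emeasure lborel (B \<inter> {2*pi..<p+2*pi})"
    by (rule plus_emeasure[symmetric]) auto
  also have "emeasure lborel (B \<inter> {2*pi..<p+2*pi}) =
      emeasure lborel ((\<lambda>t. 2*pi + t) -` (B \<inter> {2*pi..<p+2*pi}))"
    by (simp only: emeasure_lborel_shift[OF sets.Int[OF B atLeastLessThan_borel]])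
  also have "(\<lambda>t. 2*pi + t) -` (B \<inter> {2*pi..<p+2*pi}) = B \<inter> {0..<p}"
    using per by (auto simp: add.commute)
  also have "emeasure lborel (B \<inter> {p..<2*pi}) + emeasure lborel (B \<inter> {0..<p}) =
      emeasure lborel ((B \<inter> {p..<2*pi}) \<union> (B \<inter> {0..<p}))"
    by (rule plus_emeasure) auto
  also have "(B \<inter> {p..<2*pi}) \<union> (B \<inter> {0..<p}) = {0..<2*pi} \<inter> cis -` A"
    using p by (auto simp: B_def)
  finally show ?thesis .
qed

lemma measurable_mult_circ [measurable]:
  "(\<lambda>(u, v). u * v) \<in> measurable (circ \<Otimes>\<^sub>M circ) circ"
proof -
  have id: "(\<lambda>x. x) \<in> borel_measurable circ"
    unfolding measurable_cong_sets[OF sets_circ refl] by (rule measurable_restrict_space1) simp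
  have "(\<lambda>p. fst p * snd p) \<in> borel_measurable (circ \<Otimes>\<^sub>M circ)"
    by (intro borel_measurable_times measurable_compose[OF measurable_fst id]
        measurable_compose[OF measurable_snd id])
  then show ?thesis
    unfolding measurable_cong_sets[OF refl sets_circ] split_beta
    by (intro measurable_restrict_space2) (auto simp: space_pair_measure norm_mult)
qed

lemma measurable_circ_borel [measurable]: "(\<lambda>x. x) \<in> borel_measurable circ"
  unfolding measurable_cong_sets[OF sets_circ refl] by (rule measurable_restrict_space1) simp

lemma measurable_circI:
  assumes "f \<in> borel_measurable M" "\<And>x. x \<in> space M \<Longrightarrow> norm (f x) = 1"
  shows "f \<in> measurable M circ"
  unfolding measurable_cong_sets[OF refl sets_circ]
  by (intro measurable_restrict_space2) (use assms in auto)

lemma distr_rotate_circ: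
  assumes "norm w = 1"
  shows "distr circ circ (\<lambda>z. w * z) = circ"
proof (rule measure_eqI)
  have m [measurable]: "(\<lambda>z. w * z) \<in> measurable circ circ"
    by (rule measurable_circI) (auto simp: assms norm_mult)
  fix A assume "A \<in> sets (distr circ circ ((*) w))"
  then have A: "A \<in> sets circ" by simp
  then obtain B where B: "B \<in> sets borel" "A = sphere 0 1 \<inter> B"
    unfolding sets_circ by (auto simp: sets_restrict_space)
  define p where "p = Arg2pi w"
  have p: "0 \<le> p" "p < 2*pi" "w = cis p"
    using assms Arg2pi[of w] by (auto simp: p_def is_Arg_def cis_conv_exp)
  have s: "(*) w -` A \<inter> sphere 0 1 \<in> sets circ"
    using measurable_sets[OF m A] by simp
  have "emeasure (distr circ circ ((*) w)) A = emeasure circ ((*) w -` A \<inter> sphere 0 1)"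
    using A by (simp add: emeasure_distr)
  also have "\<dots> = emeasure lborel ({0..<2*pi} \<inter> (\<lambda>t. cis (p + t)) -` B) / ennreal (2*pi)"
    by (subst emeasure_circ[OF s], intro arg_cong2[where f="(/)"] arg_cong[where f="emeasure lborel"])
       (auto simp: B p(3) cis_mult norm_mult)
  also have "\<dots> = emeasure lborel ({0..<2*pi} \<inter> cis -` B) / ennreal (2*pi)"
    by (simp add: emeasure_rotate_interval[OF B(1) p(1,2)])
  also have "\<dots> = emeasure circ A"
    by (subst emeasure_circ[OF A], intro arg_cong2[where f="(/)"] arg_cong[where f="emeasure lborel"])
       (auto simp: B)
  finally show "emeasure (distr circ circ ((*) w)) A = emeasure circ A" .
qed simp

text \<open>Haar uniqueness, by averaging over rotations and exchanging the two integrals.\<close>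

lemma circ_unique:
  assumes N: "prob_space N" "sets N = sets circ"
    and inv: "\<And>w. norm w = 1 \<Longrightarrow> distr N circ (\<lambda>z. w * z) = N"
  shows "N = circ"
proof (rule measure_eqI)
  fix A assume "A \<in> sets N"
  then have A [measurable]: "A \<in> sets circ" using N by simp
  interpret N: prob_space N by fact
  interpret P: pair_sigma_finite N circ by standard
  have sp: "space N = sphere 0 1" using sets_eq_imp_space_eq[OF N(2)] by simp
  have id_N: "(\<lambda>z. z) \<in> measurable N circ" using N(2) by (simp add: measurable_ident_sets)
  have mN: "(\<lambda>z. w * z) \<in> measurable N circ" if "norm w = 1" for w
    unfolding measurable_cong_sets[OF N(2) refl]
    by (rule measurable_circI) (auto simp: that norm_mult)
  have mC: "(\<lambda>z. w * z) \<in> measurable circ circ" if "norm w = 1" for w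
    by (rule measurable_circI) (auto simp: that norm_mult)
  have mp: "(\<lambda>(u, v). indicator A (u * v) :: ennreal) \<in> borel_measurable (N \<Otimes>\<^sub>M circ)"
  proof -
    have "(\<lambda>p. (case p of (u, v) \<Rightarrow> u * v)) \<in> measurable (N \<Otimes>\<^sub>M circ) circ"
      using measurable_mult_circ N(2) by (simp cong: measurable_cong_sets sets_pair_measure_cong)
    from measurable_compose[OF this borel_measurable_indicator[OF A]] show ?thesis
      by (simp add: split_beta')
  qed
  have 1: "(\<integral>\<^sup>+ v. indicator A (u * v) \<partial>circ) = emeasure circ A" if "norm u = 1" for u
  proof -
    have "emeasure circ A = emeasure (distr circ circ (\<lambda>z. u * z)) A" by (simp add: distr_rotate_circ that)
    also have "\<dots> = (\<integral>\<^sup>+ v. indicator A v \<partial>distr circ circ (\<lambda>z. u * z))" by simp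
    also have "\<dots> = (\<integral>\<^sup>+ v. indicator A (u * v) \<partial>circ)"
      by (rule nn_integral_distr) (use mC[OF that] in auto)
    finally show ?thesis by simp
  qed
  have 2: "(\<integral>\<^sup>+ u. indicator A (u * v) \<partial>N) = emeasure N A" if "norm v = 1" for v
  proof -
    have "emeasure N A = emeasure (distr N circ (\<lambda>z. v * z)) A" by (simp add: inv that)
    also have "\<dots> = (\<integral>\<^sup>+ v. indicator A v \<partial>distr N circ (\<lambda>z. v * z))" by simp
    also have "\<dots> = (\<integral>\<^sup>+ u. indicator A (v * u) \<partial>N)"
      by (rule nn_integral_distr) (use mN[OF that] in auto)
    finally show ?thesis by (simp add: mult.commute)
  qed
  have "emeasure N A = (\<integral>\<^sup>+ v. (\<integral>\<^sup>+ u. indicator A (u * v) \<partial>N) \<partial>circ)"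
    by (subst nn_integral_cong[where v="\<lambda>_. emeasure N A"]) (use circ.emeasure_space_1 in \<open>auto simp: 2\<close>)
  also have "\<dots> = (\<integral>\<^sup>+ u. (\<integral>\<^sup>+ v. indicator A (u * v) \<partial>circ) \<partial>N)"
    using P.Fubini'[OF mp] by simp
  also have "\<dots> = emeasure circ A"
    by (subst nn_integral_cong[where v="\<lambda>_. emeasure circ A"]) (use N.emeasure_space_1 in \<open>auto simp: 1 sp\<close>)
  finally show "emeasure N A = emeasure circ A" .
qed (use N in auto)

text \<open>Every unit w has a square root c, so rotating z^2 by w is squaring the rotated point c
  z. The image measure is therefore rotation invariant, and uniqueness identifies it without
  computing a density.\<close>

lemma distr_square_circ: "distr circ circ (\<lambda>z. z * z) = circ"
proof (rule circ_unique)
  have m: "(\<lambda>z. z * z) \<in> measurable circ circ"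
    by (rule measurable_circI) (auto simp: norm_mult)
  show "prob_space (distr circ circ (\<lambda>z. z * z))" by (rule circ.prob_space_distr[OF m])
  fix w :: complex assume w: "norm w = 1"
  have nc: "norm (csqrt w) = 1" using w by (simp add: norm_csqrt)
  have m2: "(\<lambda>z. c * z) \<in> measurable circ circ" if "norm c = 1" for c
    by (rule measurable_circI) (auto simp: that norm_mult)
  have "distr (distr circ circ (\<lambda>z. z * z)) circ ((*) w) = distr circ circ ((*) w \<circ> (\<lambda>z. z * z))"
    by (rule distr_distr[OF m2[OF w] m])
  also have "(*) w \<circ> (\<lambda>z. z * z) = (\<lambda>z. z * z) \<circ> ((*) (csqrt w))"
  proof
    fix z
    have "w = csqrt w * csqrt w" by (metis power2_csqrt power2_eq_square)
    then show "((*) w \<circ> (\<lambda>z. z * z)) z = ((\<lambda>z. z * z) \<circ> ((*) (csqrt w))) z"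
      by (simp add: mult_ac)
  qed
  also have "distr circ circ ((\<lambda>z. z * z) \<circ> ((*) (csqrt w))) = distr (distr circ circ ((*) (csqrt w))) circ (\<lambda>z. z * z)"
    by (rule distr_distr[symmetric, OF m m2[OF nc]])
  finally show "distr (distr circ circ (\<lambda>z. z * z)) circ ((*) w) = distr circ circ (\<lambda>z. z * z)"
    by (simp only: distr_rotate_circ[OF nc])
qed simp

lemma integral_circ:
  fixes f :: "complex \<Rightarrow> real"
  assumes "continuous_on UNIV f"
  shows "integral\<^sup>L circ f = integral {0..2*pi} (\<lambda>t. f (cis t)) / (2*pi)"
proof -
  have f: "f \<in> borel_measurable borel" using assms by (rule borel_measurable_continuous_onI)
  have fc: "f \<in> borel_measurable (restrict_space borel (sphere 0 1))" by (rule measurable_restrict_space1[OF f])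
  have c: "continuous_on {0..2*pi} (\<lambda>t. f (cis t))"
    by (rule continuous_on_compose2[OF assms]) (auto intro!: continuous_intros)
  have fm: "(\<lambda>t. f (cis t)) \<in> borel_measurable lborel"
    using f by (simp add: borel_measurable_continuous_onI continuous_on_cis continuous_on_id)
  have "integral\<^sup>L circ f = (\<integral>t. f (cis t) \<partial>uniform_measure lborel {0..<2*pi})"
    unfolding circ_def by (rule integral_distr[OF _ fc]) simp
  also have "\<dots> = (\<integral>t. f (cis t) \<partial>uniform_measure lborel {0..2*pi})"
  proof -
    have "uniform_measure lborel {0..<2*pi} = uniform_measure lborel {0..2*pi}"
    proof (rule measure_eqI)
      fix A :: "real set" assume "A \<in> sets (uniform_measure lborel {0..<2*pi})"
      then have [measurable]: "A \<in> sets borel" by simp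
      have "emeasure lborel ({0..<2*pi} \<inter> A) = emeasure lborel ({0..2*pi} \<inter> A)"
        by (rule emeasure_eq_AE) (use AE_lborel_singleton[of "2*pi"] in \<open>auto elim!: eventually_mono\<close>)
      then show "emeasure (uniform_measure lborel {0..<2*pi}) A = emeasure (uniform_measure lborel {0..2*pi}) A"
        by simp
    qed simp
    then show ?thesis by simp
  qed
  also have "\<dots> = (\<integral>t. f (cis t) \<partial>density lborel (\<lambda>x. ennreal (indicator {0..2*pi} x / (2*pi))))"
    unfolding uniform_measure_def
    by (intro arg_cong2[where f="integral\<^sup>L"] density_cong AE_I2 refl)
       (auto simp: indicator_def divide_ennreal[symmetric] ennreal_1[symmetric] simp del: ennreal_1)
  also have "\<dots> = (\<integral>t. (indicator {0..2*pi} t / (2*pi)) *\<^sub>R f (cis t) \<partial>lborel)"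
    by (rule integral_density) (use fm in auto)
  also have "\<dots> = (\<integral>t. indicator {0..2*pi} t *\<^sub>R f (cis t) \<partial>lborel) / (2*pi)"
    by (simp flip: integral_divide_zero)
  also have "(\<integral>t. indicator {0..2*pi} t *\<^sub>R f (cis t) \<partial>lborel) = integral {0..2*pi} (\<lambda>t. f (cis t))"
    using set_borel_integral_eq_integral(2)[OF borel_integrable_atLeastAtMost'[OF c]]
    by (simp add: set_lebesgue_integral_def)
  finally show ?thesis .
qed

text \<open>Integration by parts on the circle: a derivative along the angle integrates to zero over
  a full period. The circle integrals that follow are evaluated by suitable choices of
  \<open>g\<close>.\<close>

lemma integral_circ_deriv:
  fixes g g' :: "complex \<Rightarrow> real"
  assumes "continuous_on UNIV g'"
    and "\<And>t. ((\<lambda>t. g (cis t)) has_real_derivative g' (cis t)) (at t)"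
  shows "integral\<^sup>L circ g' = 0"
proof -
  have "((\<lambda>t. g' (cis t)) has_integral (g (cis (2*pi)) - g (cis 0))) {0..2*pi}"
    by (rule fundamental_theorem_of_calculus)
       (use assms(2) in \<open>auto simp: has_real_derivative_iff_has_vector_derivative
          intro: has_vector_derivative_at_within\<close>)
  then show ?thesis by (simp add: integral_circ[OF assms(1)] integral_unique)
qed

section \<open>Spin configurations and positive definite kernels\<close>

lemma (in prob_space) integrable_bounded:
  fixes f :: "'a \<Rightarrow> 'b :: {banach, second_countable_topology}"
  assumes "f \<in> borel_measurable M" "\<And>x. x \<in> space M \<Longrightarrow> norm (f x) \<le> B"
  shows "integrable M f"
  by (rule integrable_const_bound[where B=B]) (use assms in auto)

lemma (in prob_space) integral_prod_bounded:
  fixes f :: "'a \<times> 'b \<Rightarrow> 'c :: {banach, second_countable_topology}"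
  assumes N: "prob_space N" and f: "f \<in> borel_measurable (M \<Otimes>\<^sub>M N)"
    and b: "\<And>x y. x \<in> space M \<Longrightarrow> y \<in> space N \<Longrightarrow> norm (f (x, y)) \<le> B"
  shows "integral\<^sup>L (M \<Otimes>\<^sub>M N) f = (\<integral>x. (\<integral>y. f (x, y) \<partial>N) \<partial>M)"
    and "integral\<^sup>L (M \<Otimes>\<^sub>M N) f = (\<integral>y. (\<integral>x. f (x, y) \<partial>M) \<partial>N)"
    and "integrable (M \<Otimes>\<^sub>M N) f"
proof -
  interpret N: prob_space N by fact
  interpret P: pair_prob_space M N ..
  show i: "integrable (M \<Otimes>\<^sub>M N) f"
    by (rule P.integrable_bounded[where B=B]) (use f b in \<open>auto simp: space_pair_measure\<close>)
  show "integral\<^sup>L (M \<Otimes>\<^sub>M N) f = (\<integral>x. (\<integral>y. f (x, y) \<partial>N) \<partial>M)"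
    using P.integral_fst'[OF i] by simp
  have i': "integrable (M \<Otimes>\<^sub>M N) (\<lambda>(x, y). f (x, y))" using i by simp
  show "integral\<^sup>L (M \<Otimes>\<^sub>M N) f = (\<integral>y. (\<integral>x. f (x, y) \<partial>M) \<partial>N)"
    using P.integral_snd[OF i'] by (simp add: case_prod_beta')
qed

text \<open>Kernels \<open>exp (\<Sum>i. g i u * g i v)\<close> are positive definite: so are the powers of the exponent,
  since each factor \<open>g i u * g i v\<close> can be absorbed into the test function.\<close>

lemma (in prob_space) kernel_power_nonneg:
  fixes F :: "'a \<Rightarrow> real" and g :: "'i \<Rightarrow> 'a \<Rightarrow> real"
  assumes I: "finite I" and g [measurable]: "\<And>i. i \<in> I \<Longrightarrow> g i \<in> borel_measurable M"
    and gb: "\<And>i x. i \<in> I \<Longrightarrow> x \<in> space M \<Longrightarrow> \<bar>g i x\<bar> \<le> C"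
    and "F \<in> borel_measurable M" "\<exists>B. \<forall>x\<in>space M. \<bar>F x\<bar> \<le> B"
  shows "0 \<le> (\<integral>p. F (fst p) * F (snd p) * (\<Sum>i\<in>I. g i (fst p) * g i (snd p)) ^ n \<partial>(M \<Otimes>\<^sub>M M))"
  using assms(4,5)
proof (induction n arbitrary: F)
  case 0
  then obtain B where B: "\<And>x. x \<in> space M \<Longrightarrow> \<bar>F x\<bar> \<le> B" by auto
  have [measurable]: "F \<in> borel_measurable M" by fact
  have "(\<integral>p. F (fst p) * F (snd p) \<partial>(M \<Otimes>\<^sub>M M)) = (\<integral>x. (\<integral>y. F x * F y \<partial>M) \<partial>M)"
    by (subst integral_prod_bounded(1)[where B="B*B", OF prob_space_axioms])
       (use B in \<open>auto simp: abs_mult intro!: mult_mono order.trans[OF abs_ge_zero B]\<close>)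
  also have "\<dots> = (\<integral>x. F x \<partial>M) * (\<integral>x. F x \<partial>M)" by simp
  finally show ?case by simp
next
  case (Suc n)
  then obtain B where B: "\<And>x. x \<in> space M \<Longrightarrow> \<bar>F x\<bar> \<le> B" by auto
  have [measurable]: "F \<in> borel_measurable M" by fact
  interpret P: pair_prob_space M M ..
  let ?S = "\<lambda>p. \<Sum>i\<in>I. g i (fst p) * g i (snd p)"
  have Sm [measurable]: "?S \<in> borel_measurable (M \<Otimes>\<^sub>M M)" by measurable
  have Sb: "\<bar>?S p\<bar> \<le> card I * (C * C)" if "p \<in> space (M \<Otimes>\<^sub>M M)" for p
  proof -
    have "\<bar>?S p\<bar> \<le> (\<Sum>i\<in>I. \<bar>g i (fst p)\<bar> * \<bar>g i (snd p)\<bar>)"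
      using sum_abs[of "\<lambda>i. g i (fst p) * g i (snd p)" I] by (simp add: abs_mult)
    also have "\<dots> \<le> (\<Sum>i\<in>I. C * C)"
      by (intro sum_mono mult_mono gb) (use that in \<open>auto simp: space_pair_measure intro: order.trans[OF abs_ge_zero gb]\<close>)
    finally show ?thesis by simp
  qed
  let ?h = "\<lambda>i p. (F (fst p) * g i (fst p)) * (F (snd p) * g i (snd p)) * ?S p ^ n"
  have int: "integrable (M \<Otimes>\<^sub>M M) (?h i)" if "i \<in> I" for i
  proof (rule P.integrable_bounded[where B="(B * C) * (B * C) * (card I * (C * C)) ^ n"])
    fix p assume p: "p \<in> space (M \<Otimes>\<^sub>M M)"
    then have "fst p \<in> space M" "snd p \<in> space M" by (auto simp: space_pair_measure)
    note q = this
    have "0 \<le> B" "0 \<le> C" using B[OF q(1)] gb[OF that q(1)] by auto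
    then show "norm (?h i p) \<le> (B * C) * (B * C) * (card I * (C * C)) ^ n"
      unfolding real_norm_def abs_mult power_abs
      by (intro mult_mono B gb q that power_mono Sb p) auto
  qed (use that in measurable)
  have "(\<integral>p. F (fst p) * F (snd p) * ?S p ^ Suc n \<partial>(M \<Otimes>\<^sub>M M)) = (\<integral>p. (\<Sum>i\<in>I. ?h i p) \<partial>(M \<Otimes>\<^sub>M M))"
    by (intro Bochner_Integration.integral_cong refl)
       (simp add: sum_distrib_left sum_distrib_right mult_ac)
  also have "\<dots> = (\<Sum>i\<in>I. \<integral>p. ?h i p \<partial>(M \<Otimes>\<^sub>M M))"
    by (rule Bochner_Integration.integral_sum) (rule int)
  also have "\<dots> \<ge> 0"
  proof (rule sum_nonneg)
    fix i assume i: "i \<in> I"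
    have "\<bar>F x * g i x\<bar> \<le> B * C" if "x \<in> space M" for x
      using B[OF that] gb[OF i that] by (auto simp: abs_mult intro!: mult_mono order.trans[OF abs_ge_zero B[OF that]])
    then show "0 \<le> (\<integral>p. ?h i p \<partial>(M \<Otimes>\<^sub>M M))"
      using i by (intro Suc.IH[of "\<lambda>x. F x * g i x"]) auto
  qed
  finally show ?case .
qed

lemma (in prob_space) kernel_exp_nonneg:
  fixes F :: "'a \<Rightarrow> real" and g :: "'i \<Rightarrow> 'a \<Rightarrow> real"
  assumes I: "finite I" and g [measurable]: "\<And>i. i \<in> I \<Longrightarrow> g i \<in> borel_measurable M"
    and gb: "\<And>i x. i \<in> I \<Longrightarrow> x \<in> space M \<Longrightarrow> \<bar>g i x\<bar> \<le> C"
    and F [measurable]: "F \<in> borel_measurable M" and B: "\<And>x. x \<in> space M \<Longrightarrow> \<bar>F x\<bar> \<le> B"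
  shows "0 \<le> (\<integral>p. F (fst p) * F (snd p) * exp (\<Sum>i\<in>I. g i (fst p) * g i (snd p)) \<partial>(M \<Otimes>\<^sub>M M))"
proof -
  interpret P: pair_prob_space M M ..
  let ?S = "\<lambda>p. \<Sum>i\<in>I. g i (fst p) * g i (snd p)"
  have Sm [measurable]: "?S \<in> borel_measurable (M \<Otimes>\<^sub>M M)" by measurable
  define A where "A = card I * (C * C)"
  have Sb: "\<bar>?S p\<bar> \<le> A" if "p \<in> space (M \<Otimes>\<^sub>M M)" for p
  proof -
    have "\<bar>?S p\<bar> \<le> (\<Sum>i\<in>I. \<bar>g i (fst p)\<bar> * \<bar>g i (snd p)\<bar>)"
      using sum_abs[of "\<lambda>i. g i (fst p) * g i (snd p)" I] by (simp add: abs_mult)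
    also have "\<dots> \<le> (\<Sum>i\<in>I. C * C)"
      by (intro sum_mono mult_mono gb) (use that in \<open>auto simp: space_pair_measure intro: order.trans[OF abs_ge_zero gb]\<close>)
    finally show ?thesis by (simp add: A_def)
  qed
  let ?e = "\<lambda>N p. \<Sum>n<N. ?S p ^ n /\<^sub>R fact n"
  let ?f = "\<lambda>N p. F (fst p) * F (snd p) * ?e N p"
  have eb: "\<bar>?e N p\<bar> \<le> exp A" if p: "p \<in> space (M \<Otimes>\<^sub>M M)" for N p
  proof -
    have "\<bar>?e N p\<bar> \<le> (\<Sum>n<N. \<bar>?S p\<bar> ^ n /\<^sub>R fact n)"
      using sum_abs[of "\<lambda>n. ?S p ^ n /\<^sub>R fact n" "{..<N}"] by (simp add: abs_mult power_abs)
    also have "\<dots> \<le> (\<Sum>n. \<bar>?S p\<bar> ^ n /\<^sub>R fact n)"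
      by (intro sum_le_suminf summable_exp_generic) auto
    also have "\<dots> = exp \<bar>?S p\<bar>" by (simp add: exp_def)
    also have "\<dots> \<le> exp A" using Sb[OF p] by simp
    finally show ?thesis .
  qed
  have fb: "norm (?f N p) \<le> B * B * exp A" if p: "p \<in> space (M \<Otimes>\<^sub>M M)" for N p
  proof -
    from p have q: "fst p \<in> space M" "snd p \<in> space M" by (auto simp: space_pair_measure)
    then have "0 \<le> B" using B[OF q(1)] by auto
    then show ?thesis
      unfolding real_norm_def abs_mult by (intro mult_mono B q eb p) auto
  qed
  have "(\<lambda>N. \<integral>p. ?f N p \<partial>(M \<Otimes>\<^sub>M M)) \<longlonglongrightarrow> (\<integral>p. F (fst p) * F (snd p) * exp (?S p) \<partial>(M \<Otimes>\<^sub>M M))"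
  proof (rule integral_dominated_convergence[where w="\<lambda>_. B * B * exp A"])
    show "AE p in M \<Otimes>\<^sub>M M. (\<lambda>N. ?f N p) \<longlonglongrightarrow> F (fst p) * F (snd p) * exp (?S p)"
      by (intro AE_I2 tendsto_mult tendsto_const exp_converges[unfolded sums_def])
    show "AE p in M \<Otimes>\<^sub>M M. norm (?f N p) \<le> B * B * exp A" for N
      by (rule AE_I2) (rule fb)
  qed auto
  moreover have "0 \<le> (\<integral>p. ?f N p \<partial>(M \<Otimes>\<^sub>M M))" for N
  proof -
    let ?t = "\<lambda>n p. F (fst p) * F (snd p) * ?S p ^ n"
    have int: "integrable (M \<Otimes>\<^sub>M M) (?t n)" for n
    proof (rule P.integrable_bounded[where B="B * B * A ^ n"])
      fix p assume p: "p \<in> space (M \<Otimes>\<^sub>M M)"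
      then have q: "fst p \<in> space M" "snd p \<in> space M" by (auto simp: space_pair_measure)
      then have "0 \<le> B" using B[OF q(1)] by auto
      then show "norm (?t n p) \<le> B * B * A ^ n"
        unfolding real_norm_def abs_mult power_abs by (intro mult_mono B q power_mono Sb p) auto
    qed measurable
    have "(\<integral>p. ?f N p \<partial>(M \<Otimes>\<^sub>M M)) = (\<integral>p. (\<Sum>n<N. ?t n p / fact n) \<partial>(M \<Otimes>\<^sub>M M))"
      by (intro Bochner_Integration.integral_cong refl)
         (simp add: sum_distrib_left divide_inverse mult_ac)
    also have "\<dots> = (\<Sum>n<N. (\<integral>p. ?t n p \<partial>(M \<Otimes>\<^sub>M M)) / fact n)"
      using int by (subst Bochner_Integration.integral_sum) auto
    also have "\<dots> \<ge> 0"
    proof (intro sum_nonneg divide_nonneg_nonneg)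
      fix n
      show "0 \<le> (\<integral>p. ?t n p \<partial>(M \<Otimes>\<^sub>M M))"
        by (rule kernel_power_nonneg[OF I g gb F]) (use B in auto)
    qed auto
    finally show ?thesis .
  qed
  ultimately show ?thesis by (intro LIMSEQ_le_const) auto
qed

section \<open>Product measures of spins and their invariances\<close>

definition spins :: "'v set \<Rightarrow> ('v \<Rightarrow> complex) measure" where
  "spins V = PiM V (\<lambda>_. circ)"

lemma prob_space_spins: "prob_space (spins V)"
  unfolding spins_def by (rule prob_space_PiM) (rule prob_space_circ)

interpretation spins: prob_space "spins V" by (rule prob_space_spins)

interpretation circs: product_sigma_finite "\<lambda>_. circ" by standard

lemma norm_spin: "z \<in> space (spins V) \<Longrightarrow> x \<in> V \<Longrightarrow> norm (z x) = 1"
  by (auto simp: spins_def space_PiM PiE_def Pi_def)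

lemma space_spins: "space (spins V) = (\<Pi>\<^sub>E x\<in>V. sphere 0 1)"
  by (simp add: spins_def space_PiM)

lemma measurable_spin_circ: "x \<in> V \<Longrightarrow> (\<lambda>z. z x) \<in> measurable (spins V) circ"
  unfolding spins_def by simp

lemma measurable_spin: "x \<in> V \<Longrightarrow> (\<lambda>z. z x) \<in> borel_measurable (spins V)"
  by (rule measurable_compose[OF measurable_spin_circ measurable_circ_borel])

lemma measurable_spinsI:
  assumes "\<And>x. x \<in> V \<Longrightarrow> (\<lambda>a. f a x) \<in> borel_measurable N"
    and "\<And>x a. x \<in> V \<Longrightarrow> a \<in> space N \<Longrightarrow> norm (f a x) = 1"
  shows "(\<lambda>a. \<lambda>x\<in>V. f a x) \<in> measurable N (spins V)"
  unfolding spins_def by (rule measurable_restrict) (rule measurable_circI, use assms in auto)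

lemma distr_spins:
  assumes V: "finite V" and T: "\<And>x. x \<in> V \<Longrightarrow> T x \<in> measurable circ circ"
    and d: "\<And>x. x \<in> V \<Longrightarrow> distr circ circ (T x) = circ"
  shows "(\<lambda>z. \<lambda>x\<in>V. T x (z x)) \<in> measurable (spins V) (spins V)" (is ?m)
    and "distr (spins V) (spins V) (\<lambda>z. \<lambda>x\<in>V. T x (z x)) = spins V"
proof -
  show m: ?m
    unfolding spins_def
    by (intro measurable_restrict measurable_compose[OF _ T] measurable_component_singleton)
  show "distr (spins V) (spins V) (\<lambda>z. \<lambda>x\<in>V. T x (z x)) = spins V"
    unfolding spins_def
  proof (rule circs.PiM_eqI[OF V])
    fix A assume A: "\<And>i. i \<in> V \<Longrightarrow> A i \<in> sets circ"
    have "emeasure (distr (PiM V (\<lambda>_. circ)) (PiM V (\<lambda>_. circ)) (\<lambda>z. \<lambda>x\<in>V. T x (z x))) (Pi\<^sub>E V A)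
      = emeasure (PiM V (\<lambda>_. circ)) (Pi\<^sub>E V (\<lambda>x. T x -` A x \<inter> space circ))"
      using m V A unfolding spins_def
      by (subst emeasure_distr)
         (auto intro!: arg_cong[where f="emeasure _"] sets_PiM_I_finite
               simp: space_PiM PiE_iff extensional_def Pi_iff)
    also have "\<dots> = (\<Prod>x\<in>V. emeasure circ (T x -` A x \<inter> space circ))"
      using A by (intro circs.emeasure_PiM V measurable_sets[OF T]) auto
    also have "\<dots> = (\<Prod>x\<in>V. emeasure (distr circ circ (T x)) (A x))"
      using A by (intro prod.cong refl emeasure_distr[symmetric] T)
    finally show "emeasure (distr (PiM V (\<lambda>_. circ)) (PiM V (\<lambda>_. circ)) (\<lambda>z. \<lambda>x\<in>V. T x (z x))) (Pi\<^sub>E V A)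
      = (\<Prod>i\<in>V. emeasure circ (A i))" using d by simp
  qed simp
qed

text \<open>Group operations of the torus of configurations; restricting to V keeps the results in
  the product space, whose elements are \<open>undefined\<close> off V.\<close>

definition mulc :: "'v set \<Rightarrow> ('v \<Rightarrow> complex) \<Rightarrow> ('v \<Rightarrow> complex) \<Rightarrow> 'v \<Rightarrow> complex" where
  "mulc V u v = (\<lambda>x\<in>V. u x * v x)"

definition conjc :: "'v set \<Rightarrow> ('v \<Rightarrow> complex) \<Rightarrow> 'v \<Rightarrow> complex" where
  "conjc V u = (\<lambda>x\<in>V. cnj (u x))"

lemma mulc_space: "u \<in> space (spins V) \<Longrightarrow> v \<in> space (spins V) \<Longrightarrow> mulc V u v \<in> space (spins V)"
  by (auto simp: space_spins mulc_def norm_mult PiE_iff)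

lemma conjc_space: "u \<in> space (spins V) \<Longrightarrow> conjc V u \<in> space (spins V)"
  by (auto simp: space_spins conjc_def PiE_iff)

lemma measurable_mulc [measurable]:
  assumes [measurable]: "f \<in> measurable N (spins V)" "g \<in> measurable N (spins V)"
  shows "(\<lambda>a. mulc V (f a) (g a)) \<in> measurable N (spins V)"
  unfolding mulc_def
proof (rule measurable_spinsI)
  fix x assume x: "x \<in> V"
  show "(\<lambda>a. f a x * g a x) \<in> borel_measurable N"
    by (intro borel_measurable_times measurable_compose[OF assms(1) measurable_spin[OF x]]
        measurable_compose[OF assms(2) measurable_spin[OF x]])
qed (auto simp: norm_mult norm_spin[OF measurable_space[OF assms(1)]] norm_spin[OF measurable_space[OF assms(2)]])

lemma measurable_conjc [measurable]:
  assumes [measurable]: "f \<in> measurable N (spins V)"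
  shows "(\<lambda>a. conjc V (f a)) \<in> measurable N (spins V)"
  unfolding conjc_def
proof (rule measurable_spinsI)
  fix x assume x: "x \<in> V"
  have "(\<lambda>a. f a x) \<in> borel_measurable N" by (rule measurable_compose[OF assms(1) measurable_spin[OF x]])
  then show "(\<lambda>a. cnj (f a x)) \<in> borel_measurable N"
    by (intro borel_measurable_continuous_on[where f=cnj] continuous_intros)
qed (auto simp: norm_spin[OF measurable_space[OF assms(1)]])

lemma integral_spins_mulc:
  fixes f :: "_ \<Rightarrow> 'b :: {banach, second_countable_topology}"
  assumes V: "finite V" and w: "\<And>x. x \<in> V \<Longrightarrow> norm (w x) = 1" and f: "f \<in> borel_measurable (spins V)"
  shows "(\<integral>z. f (mulc V w z) \<partial>spins V) = (\<integral>z. f z \<partial>spins V)"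
proof -
  have T: "(*) (w x) \<in> measurable circ circ" if "x \<in> V" for x
    by (rule measurable_circI) (auto simp: w[OF that] norm_mult)
  note D = distr_spins[OF V T distr_rotate_circ[OF w]]
  have "(\<integral>z. f z \<partial>distr (spins V) (spins V) (\<lambda>z. \<lambda>x\<in>V. w x * z x)) = (\<integral>z. f (mulc V w z) \<partial>spins V)"
    unfolding mulc_def by (rule integral_distr) (use D(1) f in auto)
  then show ?thesis using D(2) by simp
qed

lemma integral_spins_square:
  fixes f :: "_ \<Rightarrow> 'b :: {banach, second_countable_topology}"
  assumes V: "finite V" and f: "f \<in> borel_measurable (spins V)"
  shows "(\<integral>z. f (mulc V z z) \<partial>spins V) = (\<integral>z. f z \<partial>spins V)"
proof -
  have T: "(\<lambda>z. z * z) \<in> measurable circ circ"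
    by (rule measurable_circI) (auto simp: norm_mult)
  note D = distr_spins[of V "\<lambda>_ z. z * z", OF V T distr_square_circ]
  have "(\<integral>z. f z \<partial>distr (spins V) (spins V) (\<lambda>z. \<lambda>x\<in>V. z x * z x)) = (\<integral>z. f (mulc V z z) \<partial>spins V)"
    unfolding mulc_def by (rule integral_distr) (use D(1) f in auto)
  then show ?thesis using D(2) by simp
qed

text \<open>In angles this is the substitution \<open>(\<theta>, \<theta>') = (\<alpha> - \<beta>, \<alpha> + \<beta>)\<close>, which preserves the uniform
  distribution on pairs although it is two-to-one.\<close>

lemma integral_spins_duplicate:
  fixes f :: "_ \<Rightarrow> 'b :: {banach, second_countable_topology}"
  assumes V: "finite V" and f [measurable]: "f \<in> borel_measurable (spins V \<Otimes>\<^sub>M spins V)"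
    and b: "\<And>u v. u \<in> space (spins V) \<Longrightarrow> v \<in> space (spins V) \<Longrightarrow> norm (f (u, v)) \<le> B"
  shows "(\<integral>p. f (mulc V (fst p) (conjc V (snd p)), mulc V (fst p) (snd p)) \<partial>(spins V \<Otimes>\<^sub>M spins V))
    = (\<integral>p. f p \<partial>(spins V \<Otimes>\<^sub>M spins V))"
proof -
  let ?M = "spins V"
  note P = spins.integral_prod_bounded[OF prob_space_spins]
  have "(\<integral>p. f (mulc V (fst p) (conjc V (snd p)), mulc V (fst p) (snd p)) \<partial>(?M \<Otimes>\<^sub>M ?M))
    = (\<integral>v. (\<integral>u. f (mulc V u (conjc V v), mulc V u v) \<partial>?M) \<partial>?M)"
    by (subst P(2)[where B=B]) (use b in \<open>auto simp: mulc_space conjc_space\<close>)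
  also have "\<dots> = (\<integral>v. (\<integral>u. f (u, mulc V u (mulc V v v)) \<partial>?M) \<partial>?M)"
  proof (rule Bochner_Integration.integral_cong[OF refl])
    fix v assume v: "v \<in> space ?M"
    \<comment> \<open>For fixed v, translating u by v cancels \<open>conjc V v\<close> in the first
      argument and leaves v^2 in the second.\<close>
    have "(\<integral>u. f (mulc V u (conjc V v), mulc V u v) \<partial>?M)
      = (\<integral>u. f (mulc V (mulc V v u) (conjc V v), mulc V (mulc V v u) v) \<partial>?M)"
      by (rule integral_spins_mulc[symmetric, OF V]) (use v norm_spin in auto)
    also have "\<dots> = (\<integral>u. f (u, mulc V u (mulc V v v)) \<partial>?M)"
    proof (intro Bochner_Integration.integral_cong refl arg_cong[where f=f])
      fix u assume u: "u \<in> space ?M"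
      have e: "v x * cnj (v x) = 1" if "x \<in> V" for x
        using norm_spin[OF v that] by (simp add: complex_norm_square[symmetric])
      have e': "v x * u x * cnj (v x) = u x" if "x \<in> V" for x
        using arg_cong[OF e[OF that], of "\<lambda>a. u x * a"] by (simp only: mult_ac mult_1_left mult_1_right)
      have "mulc V (mulc V v u) (conjc V v) = u"
      proof
        fix x show "mulc V (mulc V v u) (conjc V v) x = u x"
          using PiE_arb[OF u[unfolded space_spins], of x] by (cases "x \<in> V") (simp_all add: mulc_def conjc_def e')
      qed
      then show "(mulc V (mulc V v u) (conjc V v), mulc V (mulc V v u) v) = (u, mulc V u (mulc V v v))"
        by (simp add: mulc_def fun_eq_iff mult_ac)
    qed
    finally show "(\<integral>u. f (mulc V u (conjc V v), mulc V u v) \<partial>?M) = (\<integral>u. f (u, mulc V u (mulc V v v)) \<partial>?M)" .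
  qed
  also have "\<dots> = (\<integral>p. f (fst p, mulc V (fst p) (mulc V (snd p) (snd p))) \<partial>(?M \<Otimes>\<^sub>M ?M))"
    by (subst P(2)[where B=B]) (use b in \<open>auto simp: mulc_space conjc_space\<close>)
  also have "\<dots> = (\<integral>u. (\<integral>v. f (u, mulc V u (mulc V v v)) \<partial>?M) \<partial>?M)"
    by (subst P(1)[where B=B]) (use b in \<open>auto simp: mulc_space conjc_space\<close>)
  also have "\<dots> = (\<integral>u. (\<integral>v. f (u, v) \<partial>?M) \<partial>?M)"
  proof (rule Bochner_Integration.integral_cong[OF refl])
    fix u assume u: "u \<in> space ?M"
    \<comment> \<open>Now u is frozen: v^2 is again uniform, and translation by u removes the
      remaining factor.\<close>
    have "(\<integral>v. f (u, mulc V u (mulc V v v)) \<partial>?M) = (\<integral>v. f (u, mulc V u v) \<partial>?M)"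
      using u by (intro integral_spins_square[OF V, of "\<lambda>v. f (u, mulc V u v)"]) auto
    also have "\<dots> = (\<integral>v. f (u, v) \<partial>?M)"
      by (rule integral_spins_mulc[OF V]) (use u norm_spin in auto)
    finally show "(\<integral>v. f (u, mulc V u (mulc V v v)) \<partial>?M) = (\<integral>v. f (u, v) \<partial>?M)" .
  qed
  also have "\<dots> = (\<integral>p. f p \<partial>(?M \<Otimes>\<^sub>M ?M))"
    by (subst P(1)[where B=B]) (use b in auto)
  finally show ?thesis .
qed

section \<open>Characters of the torus and Ginibre's inequality with phases\<close>

definition character :: "'v set \<Rightarrow> (('v \<Rightarrow> complex) \<Rightarrow> complex) \<Rightarrow> bool" where
  "character V \<xi> \<longleftrightarrow> \<xi> \<in> borel_measurable (spins V) \<and> (\<forall>z\<in>space (spins V). norm (\<xi> z) = 1) \<and>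
    (\<forall>u\<in>space (spins V). \<forall>v\<in>space (spins V). \<xi> (mulc V u v) = \<xi> u * \<xi> v) \<and>
    (\<forall>u\<in>space (spins V). \<xi> (conjc V u) = cnj (\<xi> u))"

lemma characterD:
  assumes "character V \<xi>"
  shows "\<xi> \<in> borel_measurable (spins V)"
    and "z \<in> space (spins V) \<Longrightarrow> norm (\<xi> z) = 1"
    and "u \<in> space (spins V) \<Longrightarrow> v \<in> space (spins V) \<Longrightarrow> \<xi> (mulc V u v) = \<xi> u * \<xi> v"
    and "u \<in> space (spins V) \<Longrightarrow> \<xi> (conjc V u) = cnj (\<xi> u)"
  using assms by (auto simp: character_def)

lemma exp_energy_bounds:
  assumes "\<And>e. e \<in> E \<Longrightarrow> \<bar>x e\<bar> \<le> (1::real)" "\<And>e. e \<in> E \<Longrightarrow> 0 \<le> K e"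
  shows "exp (\<Sum>e\<in>E. K e * x e) \<le> exp (\<Sum>e\<in>E. K e)" "exp (- (\<Sum>e\<in>E. K e)) \<le> exp (\<Sum>e\<in>E. K e * x e)"
proof -
  show "exp (\<Sum>e\<in>E. K e * x e) \<le> exp (\<Sum>e\<in>E. K e)"
    using assms by (auto intro!: sum_mono mult_left_le simp: abs_le_iff)
  have "- K e \<le> K e * x e" if "e \<in> E" for e
    using mult_left_mono[of "-1" "x e" "K e"] assms[OF that] by (auto simp: abs_le_iff)
  then show "exp (- (\<Sum>e\<in>E. K e)) \<le> exp (\<Sum>e\<in>E. K e * x e)"
    by (auto simp: sum_negf[symmetric] intro!: sum_mono)
qed

lemma mult_Re_identities:
  fixes p q :: complex
  shows "Re (p * cnj q) + Re (p * q) = 2 * Re p * Re q" "Re (p * cnj q) - Re (p * q) = 2 * Im p * Im q"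
    "Re (p * cnj q) = Re p * Re q + Im p * Im q"
  by (auto simp: algebra_simps)

declare times_complex.sel [simp del]

text \<open>In the duplicated variables both the exponent and the difference of the two observables become sums of
  products \<open>g u * g v\<close>, so the kernel is positive definite. This extension of Ginibre's inequality to
  couplings with phases is due to Messager, Miracle-Sole and Pfister.\<close>

theorem ginibre_phases:
  assumes V: "finite V" and E: "finite E"
    and ch: "\<And>e. e \<in> E \<Longrightarrow> character V (\<xi> e)" and ch0: "character V \<xi>0"
    and K: "\<And>e. e \<in> E \<Longrightarrow> 0 \<le> K e \<and> K e \<le> K' e"
    and w: "\<And>e. e \<in> E \<Longrightarrow> norm (w e) = 1"
  shows "norm (\<integral>z. \<xi>0 z * of_real (exp (\<Sum>e\<in>E. K e * Re (w e * \<xi> e z))) \<partial>spins V)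
      * (\<integral>z. exp (\<Sum>e\<in>E. K' e * Re (\<xi> e z)) \<partial>spins V)
    \<le> (\<integral>z. exp (\<Sum>e\<in>E. K e * Re (w e * \<xi> e z)) \<partial>spins V)
      * (\<integral>z. Re (\<xi>0 z) * exp (\<Sum>e\<in>E. K' e * Re (\<xi> e z)) \<partial>spins V)"
proof -
  let ?M = "spins V"
  interpret P: pair_prob_space ?M ?M ..
  note [measurable] = characterD(1)[OF ch] characterD(1)[OF ch0]
  have n [simp]: "norm (\<xi> e z) = 1" if "e \<in> E" "z \<in> space ?M" for e z
    using characterD(2)[OF ch] that by auto
  have n0 [simp]: "norm (\<xi>0 z) = 1" if "z \<in> space ?M" for z
    using characterD(2)[OF ch0] that by auto
  have [simp]: "norm (w e) = 1" if "e \<in> E" for e by (rule w[OF that])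
  define H1 where "H1 z = (\<Sum>e\<in>E. K e * Re (w e * \<xi> e z))" for z
  define H2 where "H2 z = (\<Sum>e\<in>E. K' e * Re (\<xi> e z))" for z
  have [measurable]: "H1 \<in> borel_measurable ?M" "H2 \<in> borel_measurable ?M"
    unfolding H1_def H2_def by measurable
  have re: "\<bar>Re a\<bar> \<le> 1" if "norm a = 1" for a using abs_Re_le_cmod[of a] that by simp
  define B where "B = exp (sum K' E)"
  have K'0: "0 \<le> K' e" if "e \<in> E" for e using K[OF that] by auto
  have b1: "exp (H1 z) \<le> B" if "z \<in> space ?M" for z
  proof -
    have "exp (H1 z) \<le> exp (sum K E)" unfolding H1_def
      by (rule exp_energy_bounds) (use K that in \<open>auto intro!: re simp: norm_mult\<close>)
    also have "\<dots> \<le> B" using K by (auto simp: B_def intro!: sum_mono)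
    finally show ?thesis .
  qed
  have b2: "exp (H2 z) \<le> B" if "z \<in> space ?M" for z
    unfolding H2_def B_def
    by (rule exp_energy_bounds) (use K'0 that in \<open>auto intro!: re simp: norm_mult\<close>)
  have B0: "0 \<le> B" by (simp add: B_def)
  define I where "I = (\<integral>z. \<xi>0 z * of_real (exp (H1 z)) \<partial>?M)"
  \<comment> \<open>Multiplying by the phase \<open>\<eta>\<close> turns the norm of the complex
    integral into a real integral, so that two real observables can be compared.\<close>
  obtain \<eta> where \<eta>: "norm \<eta> = 1" "complex_of_real (norm I) = \<eta> * I"
  proof (cases "I = 0")
    case True then show ?thesis using that[of 1] by simp
  next
    case False
    let ?n = "complex_of_real (norm I)"
    have "I * cnj I = ?n * ?n"
      by (simp only: complex_norm_square[symmetric] power2_eq_square of_real_mult)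
    then have "cnj I / ?n * I = ?n * ?n / ?n" by (simp add: mult.commute)
    also have "\<dots> = ?n" using False by simp
    finally have "?n = cnj I / ?n * I" by (rule sym)
    moreover have "norm (cnj I / ?n) = 1" using False by (simp add: norm_divide)
    ultimately show ?thesis by (intro that)
  qed
  have iI: "integrable ?M (\<lambda>z. \<xi>0 z * of_real (exp (H1 z)))"
    by (rule spins.integrable_bounded[where B=B])
       (measurable, use b1 in \<open>simp add: norm_mult\<close>)
  have "complex_of_real (norm I) = (\<integral>z. \<eta> * (\<xi>0 z * of_real (exp (H1 z))) \<partial>?M)"
    using \<eta>(2) by (simp add: I_def)
  then have "norm I = Re (\<integral>z. \<eta> * (\<xi>0 z * of_real (exp (H1 z))) \<partial>?M)" by (metis Re_complex_of_real)
  also have "\<dots> = (\<integral>z. Re (\<eta> * (\<xi>0 z * of_real (exp (H1 z)))) \<partial>?M)"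
    using iI by (subst integral_Re) auto
  also have "\<dots> = (\<integral>z. Re (\<eta> * \<xi>0 z) * exp (H1 z) \<partial>?M)"
    by (intro Bochner_Integration.integral_cong refl) (simp add: mult.assoc[symmetric] times_complex.sel(1)[of _ "complex_of_real _"])
  finally have nI: "norm I = (\<integral>z. Re (\<eta> * \<xi>0 z) * exp (H1 z) \<partial>?M)" .
  \<comment> \<open>A square root splits each phase evenly: in the product of the two rotated
    characters the full phase reappears, and in the product with a conjugate it cancels.\<close>
  define c0 where "c0 = csqrt \<eta>"
  have c0: "c0 * c0 = \<eta>" "norm c0 = 1" using \<eta>(1)
    unfolding c0_def by (metis power2_csqrt power2_eq_square, simp add: norm_csqrt)
  define c where "c e = csqrt (w e)" for e
  have c: "c e * c e = w e" "e \<in> E \<Longrightarrow> norm (c e) = 1" for e using w[of e]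
    unfolding c_def by (metis power2_csqrt power2_eq_square, simp add: norm_csqrt)
  have unit: "x * cnj x = 1" if "norm x = 1" for x :: complex
    using that by (simp add: complex_norm_square[symmetric])
  let ?f = "\<lambda>p. (Re (\<xi>0 (fst p)) - Re (\<eta> * \<xi>0 (snd p))) * exp (H2 (fst p) + H1 (snd p))"
  \<comment> \<open>Three functions per edge. The common part K gives, by
    \<open>mult_Re_identities\<close>, 2 K times a product of real parts; the excess K' - K >= 0,
    which comes only with the unrotated character, gives a product of real parts plus a product of
    imaginary parts.\<close>
  define g where "g = (\<lambda>(e, i::nat) z. if i = 0 then sqrt (2 * K e) * Re (c e * \<xi> e z)
      else if i = 1 then sqrt (K' e - K e) * Re (\<xi> e z) else sqrt (K' e - K e) * Im (\<xi> e z))"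
  have key: "?f (mulc V u (conjc V v), mulc V u v) =
      2 * (Im (c0 * \<xi>0 u) * Im (c0 * \<xi>0 v) * exp (\<Sum>i\<in>E\<times>{0,1,2}. g i u * g i v))"
    if uv: "u \<in> space ?M" "v \<in> space ?M" for u v
  proof -
    have a: "Re (\<xi>0 (mulc V u (conjc V v))) - Re (\<eta> * \<xi>0 (mulc V u v)) = 2 * (Im (c0 * \<xi>0 u) * Im (c0 * \<xi>0 v))"
    proof -
      have "\<xi>0 (mulc V u (conjc V v)) = (c0 * cnj c0) * (\<xi>0 u * cnj (\<xi>0 v))"
        using uv by (simp add: characterD[OF ch0] conjc_space unit[OF c0(2)])
      moreover have "\<eta> * \<xi>0 (mulc V u v) = (c0 * \<xi>0 u) * (c0 * \<xi>0 v)"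
        using uv by (simp add: characterD[OF ch0] c0(1)[symmetric] mult_ac)
      ultimately show ?thesis
        using mult_Re_identities(2)[of "c0 * \<xi>0 u" "c0 * \<xi>0 v"] by (simp add: mult_ac)
    qed
    have b: "K' e * Re (\<xi> e (mulc V u (conjc V v))) + K e * Re (w e * \<xi> e (mulc V u v)) =
       g (e,0) u * g (e,0) v + g (e,1) u * g (e,1) v + g (e,2) u * g (e,2) v" if e: "e \<in> E" for e
    proof -
      have s: "sqrt (2 * K e) * sqrt (2 * K e) = 2 * K e" "sqrt (K' e - K e) * sqrt (K' e - K e) = K' e - K e"
        using K[OF e] by auto
      have 1: "\<xi> e (mulc V u (conjc V v)) = \<xi> e u * cnj (\<xi> e v)"
        using uv by (simp add: characterD[OF ch[OF e]] conjc_space)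
      have 2: "\<xi> e u * cnj (\<xi> e v) = (c e * \<xi> e u) * cnj (c e * \<xi> e v)"
        using unit[OF c(2)[OF e]] by (simp add: mult_ac)
      have 3: "w e * \<xi> e (mulc V u v) = (c e * \<xi> e u) * (c e * \<xi> e v)"
        using uv by (simp add: characterD[OF ch[OF e]] c(1)[symmetric] mult_ac)
      have "K' e * Re (\<xi> e (mulc V u (conjc V v))) + K e * Re (w e * \<xi> e (mulc V u v)) =
        K e * (Re ((c e * \<xi> e u) * cnj (c e * \<xi> e v)) + Re ((c e * \<xi> e u) * (c e * \<xi> e v)))
        + (K' e - K e) * Re (\<xi> e u * cnj (\<xi> e v))"
        unfolding 1 3 2[symmetric] by (simp add: algebra_simps)
      also have "\<dots> = (sqrt (2 * K e) * sqrt (2 * K e)) * (Re (c e * \<xi> e u) * Re (c e * \<xi> e v))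
         + (sqrt (K' e - K e) * sqrt (K' e - K e)) * (Re (\<xi> e u) * Re (\<xi> e v) + Im (\<xi> e u) * Im (\<xi> e v))"
        unfolding mult_Re_identities(1) mult_Re_identities(3)[of "\<xi> e u"] s by simp
      finally show ?thesis by (simp add: g_def algebra_simps)
    qed
    have "H2 (mulc V u (conjc V v)) + H1 (mulc V u v) =
      (\<Sum>e\<in>E. g (e,0) u * g (e,0) v + g (e,1) u * g (e,1) v + g (e,2) u * g (e,2) v)"
      unfolding H1_def H2_def sum.distrib[symmetric] by (intro sum.cong refl b)
    also have "\<dots> = (\<Sum>i\<in>E\<times>{0,1,2}. g i u * g i v)"
      by (subst sum.cartesian_product') (simp add: add.assoc)
    finally show ?thesis using a by simp
  qed
  have fb: "norm (?f (u, v)) \<le> 2 * (B * B)" if "u \<in> space ?M" "v \<in> space ?M" for u v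
  proof -
    have "\<bar>Re (\<xi>0 u)\<bar> \<le> 1" "\<bar>Re (\<eta> * \<xi>0 v)\<bar> \<le> 1"
      using that \<eta> by (auto intro!: re simp: norm_mult)
    then have "\<bar>Re (\<xi>0 u) - Re (\<eta> * \<xi>0 v)\<bar> \<le> 2" by linarith
    then show ?thesis
      using b1[OF that(2)] b2[OF that(1)] B0
      by (auto simp: abs_mult exp_add intro!: mult_mono)
  qed
  have "0 \<le> (\<integral>p. Im (c0 * \<xi>0 (fst p)) * Im (c0 * \<xi>0 (snd p))
      * exp (\<Sum>i\<in>E\<times>{0,1,2}. g i (fst p) * g i (snd p)) \<partial>(?M \<Otimes>\<^sub>M ?M))"
  proof (rule spins.kernel_exp_nonneg[where B=1 and C="\<Sum>e\<in>E. sqrt (2 * K e) + sqrt (K' e - K e)"])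
    fix i x assume i: "i \<in> E \<times> {0,1,2::nat}" and x: "x \<in> space ?M"
    obtain e j where ij: "i = (e, j)" "e \<in> E" using i by auto
    have n1: "norm (c e * \<xi> e x) = 1" "norm (\<xi> e x) = 1" using ij c w x ch
      by (auto simp: norm_mult)
    have "\<bar>g i x\<bar> \<le> sqrt (2 * K e) + sqrt (K' e - K e)"
      using K[OF ij(2)] re[OF n1(1)] re[OF n1(2)] abs_Im_le_cmod[of "\<xi> e x"] n1(2)
      by (auto simp: g_def ij abs_mult mult_le_cancel_left1 add_increasing add_increasing2 mult_left_le
          intro: order.trans[OF mult_left_le])
    also have "\<dots> \<le> (\<Sum>e\<in>E. sqrt (2 * K e) + sqrt (K' e - K e))"
      by (rule member_le_sum) (use ij E K in \<open>auto intro: add_nonneg_nonneg\<close>)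
    finally show "\<bar>g i x\<bar> \<le> (\<Sum>e\<in>E. sqrt (2 * K e) + sqrt (K' e - K e))" .
  next
    fix i assume "i \<in> E \<times> {0,1,2::nat}"
    then show "g i \<in> borel_measurable ?M"
      by (cases i) (auto simp: g_def)
  next
    fix x assume "x \<in> space ?M"
    then show "\<bar>Im (c0 * \<xi>0 x)\<bar> \<le> 1"
      using abs_Im_le_cmod[of "c0 * \<xi>0 x"] c0 ch0 by (auto simp: norm_mult)
  qed (use E in auto)
  \<comment> \<open>Undoing the duplication, the nonnegative integral becomes the difference of the
    two sides, written over two independent copies.\<close>
  also have "2 * \<dots> = (\<integral>p. ?f (mulc V (fst p) (conjc V (snd p)), mulc V (fst p) (snd p)) \<partial>(?M \<Otimes>\<^sub>M ?M))"
    unfolding integral_mult_right_zero[symmetric]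
    by (intro Bochner_Integration.integral_cong refl key[symmetric]) (auto simp: space_pair_measure)
  also have "\<dots> = (\<integral>p. ?f p \<partial>(?M \<Otimes>\<^sub>M ?M))"
    by (rule integral_spins_duplicate[where f="?f", OF V _ fb]) auto
  also have "\<dots> = (\<integral>u. (\<integral>v. ?f (u, v) \<partial>?M) \<partial>?M)"
    by (rule spins.integral_prod_bounded(1)[where f="?f", OF prob_space_spins _ fb]) auto
  also have "\<dots> = (\<integral>u. Re (\<xi>0 u) * exp (H2 u) * (\<integral>v. exp (H1 v) \<partial>?M)
      - exp (H2 u) * (\<integral>v. Re (\<eta> * \<xi>0 v) * exp (H1 v) \<partial>?M) \<partial>?M)"
  proof (rule Bochner_Integration.integral_cong[OF refl])
    fix u
    have i1: "integrable ?M (\<lambda>v. exp (H1 v))"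
      by (rule spins.integrable_bounded[where B=B]) (use b1 in auto)
    have i2: "integrable ?M (\<lambda>v. Re (\<eta> * \<xi>0 v) * exp (H1 v))"
    proof (rule spins.integrable_bounded[where B="1 * B"])
      fix v assume v: "v \<in> space ?M"
      show "norm (Re (\<eta> * \<xi>0 v) * exp (H1 v)) \<le> 1 * B"
        unfolding real_norm_def abs_mult using b1[OF v] v \<eta> ch0
        by (intro mult_mono re) (auto simp: norm_mult)
    qed measurable
    have "(\<integral>v. ?f (u, v) \<partial>?M) = (\<integral>v. Re (\<xi>0 u) * exp (H2 u) * exp (H1 v)
        - exp (H2 u) * (Re (\<eta> * \<xi>0 v) * exp (H1 v)) \<partial>?M)"
      by (intro Bochner_Integration.integral_cong refl) (simp add: exp_add algebra_simps)
    also have "\<dots> = Re (\<xi>0 u) * exp (H2 u) * (\<integral>v. exp (H1 v) \<partial>?M)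
      - exp (H2 u) * (\<integral>v. Re (\<eta> * \<xi>0 v) * exp (H1 v) \<partial>?M)"
      using i1 i2 by (subst Bochner_Integration.integral_diff) auto
    finally show "(\<integral>v. ?f (u, v) \<partial>?M) = \<dots>" .
  qed
  also have "\<dots> = (\<integral>u. Re (\<xi>0 u) * exp (H2 u) \<partial>?M) * (\<integral>v. exp (H1 v) \<partial>?M)
      - (\<integral>u. exp (H2 u) \<partial>?M) * norm I"
  proof -
    have i1: "integrable ?M (\<lambda>v. exp (H2 v))"
      by (rule spins.integrable_bounded[where B=B]) (use b2 in auto)
    have i2: "integrable ?M (\<lambda>v. Re (\<xi>0 v) * exp (H2 v))"
    proof (rule spins.integrable_bounded[where B="1 * B"])
      fix v assume v: "v \<in> space ?M"
      show "norm (Re (\<xi>0 v) * exp (H2 v)) \<le> 1 * B"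
        unfolding real_norm_def abs_mult using b2[OF v] v ch0
        by (intro mult_mono re) (auto simp: norm_mult)
    qed measurable
    show ?thesis unfolding nI using i1 i2 by (subst Bochner_Integration.integral_diff) auto
  qed
  finally show ?thesis
    unfolding I_def H1_def H2_def by (simp add: mult.commute)
qed

section \<open>The XY model with unit boundary spins\<close>

text \<open>The value 1 off V is the boundary condition; with it, edges to the boundary are treated
  like inner ones.\<close>

definition spin :: "site set \<Rightarrow> (site \<Rightarrow> complex) \<Rightarrow> site \<Rightarrow> complex" where
  "spin V z x = (if x \<in> V then z x else 1)"

text \<open>With this orientation every step of a lattice path with increasing coordinates is traversed forwards.\<close>

definition src :: "edge \<Rightarrow> site" where
  "src e = (THE x. x \<in> e \<and> (\<forall>y\<in>e. sum_list x \<le> sum_list y))"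

definition tgt :: "edge \<Rightarrow> site" where
  "tgt e = other_end e (src e)"

definition edge_char :: "site set \<Rightarrow> edge \<Rightarrow> (site \<Rightarrow> complex) \<Rightarrow> complex" where
  "edge_char V e z = spin V z (src e) * cnj (spin V z (tgt e))"

definition xy_weight :: "site set \<Rightarrow> edge set \<Rightarrow> (edge \<Rightarrow> real) \<Rightarrow> (site \<Rightarrow> complex) \<Rightarrow> real" where
  "xy_weight V E K z = exp (\<Sum>e\<in>E. K e * Re (edge_char V e z))"

definition xy_Z :: "site set \<Rightarrow> edge set \<Rightarrow> (edge \<Rightarrow> real) \<Rightarrow> real" where
  "xy_Z V E K = (\<integral>z. xy_weight V E K z \<partial>spins V)"

definition xy_N :: "site set \<Rightarrow> edge set \<Rightarrow> (edge \<Rightarrow> real) \<Rightarrow> site \<Rightarrow> real" where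
  "xy_N V E K a = (\<integral>z. Re ((spin V z a)\<^sup>2) * xy_weight V E K z \<partial>spins V)"

definition xy_mag :: "site set \<Rightarrow> edge set \<Rightarrow> (edge \<Rightarrow> real) \<Rightarrow> site \<Rightarrow> real" where
  "xy_mag V E K a = xy_N V E K a / xy_Z V E K"

lemma norm_spin_ext [simp]: "z \<in> space (spins V) \<Longrightarrow> norm (spin V z x) = 1"
  by (simp add: spin_def norm_spin)

lemma norm_edge_char [simp]: "z \<in> space (spins V) \<Longrightarrow> norm (edge_char V e z) = 1"
  by (simp add: edge_char_def norm_mult)

lemma measurable_spin_ext [measurable]: "(\<lambda>z. spin V z x) \<in> borel_measurable (spins V)"
  unfolding spin_def by (cases "x \<in> V") (simp_all add: measurable_spin)

lemma borel_measurable_cnj: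
  assumes "f \<in> borel_measurable M"
  shows "(\<lambda>x. cnj (f x)) \<in> borel_measurable M"
  by (intro borel_measurable_continuous_on[where f=cnj] continuous_intros assms)

lemma measurable_edge_char [measurable]: "edge_char V e \<in> borel_measurable (spins V)"
  unfolding edge_char_def
  by (intro borel_measurable_times borel_measurable_cnj measurable_spin_ext)

lemma spin_mulc: "spin V (mulc V u v) x = spin V u x * spin V v x"
  by (simp add: spin_def mulc_def)

lemma spin_conjc: "spin V (conjc V u) x = cnj (spin V u x)"
  by (simp add: spin_def conjc_def)

lemma character_edge_char: "character V (edge_char V e)"
  unfolding character_def using measurable_edge_char
  by (auto simp: edge_char_def[of V e] spin_mulc spin_conjc norm_mult)

lemma character_spin_square: "character V (\<lambda>z. (spin V z a)\<^sup>2)"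
  unfolding character_def
  by (auto simp: spin_mulc spin_conjc norm_power power_mult_distrib)

lemma abs_Re_unit: "norm a = 1 \<Longrightarrow> \<bar>Re a\<bar> \<le> 1"
  using abs_Re_le_cmod[of a] by simp

lemma measurable_xy_weight [measurable]: "xy_weight V E K \<in> borel_measurable (spins V)"
  unfolding xy_weight_def by measurable

lemma xy_weight_pos: "0 < xy_weight V E K z"
  by (simp add: xy_weight_def)

lemma xy_weight_bounds:
  assumes "\<And>e. e \<in> E \<Longrightarrow> 0 \<le> K e" "z \<in> space (spins V)"
  shows "xy_weight V E K z \<le> exp (sum K E)" "exp (- sum K E) \<le> xy_weight V E K z"
  unfolding xy_weight_def by (rule exp_energy_bounds; use assms in \<open>auto intro: abs_Re_unit\<close>)+

lemma integrable_xy_weight: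
  assumes "\<And>e. e \<in> E \<Longrightarrow> 0 \<le> K e" and [measurable]: "f \<in> borel_measurable (spins V)"
    and b: "\<And>z. z \<in> space (spins V) \<Longrightarrow> \<bar>f z\<bar> \<le> B"
  shows "integrable (spins V) (\<lambda>z. f z * xy_weight V E K z)"
proof (rule spins.integrable_bounded[where B="B * exp (sum K E)"])
  fix z assume z: "z \<in> space (spins V)"
  have "0 \<le> B" using b[OF z] by auto
  then show "norm (f z * xy_weight V E K z) \<le> B * exp (sum K E)"
    using b[OF z] xy_weight_bounds(1)[OF assms(1) z] xy_weight_pos[of V E K z]
    by (auto simp: abs_mult intro!: mult_mono)
qed measurable

lemma integrable_xy_weight1:
  assumes "\<And>e. e \<in> E \<Longrightarrow> 0 \<le> K e"
  shows "integrable (spins V) (xy_weight V E K)"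
  using integrable_xy_weight[of E K "\<lambda>_. 1" V 1] assms by simp

lemma integrable_xy_N:
  assumes "\<And>e. e \<in> E \<Longrightarrow> 0 \<le> K e"
  shows "integrable (spins V) (\<lambda>z. Re ((spin V z a)\<^sup>2) * xy_weight V E K z)"
  by (rule integrable_xy_weight[where B=1]) (use assms in \<open>auto intro!: abs_Re_unit simp: norm_power\<close>)

lemma xy_Z_pos:
  assumes "\<And>e. e \<in> E \<Longrightarrow> 0 \<le> K e"
  shows "0 < xy_Z V E K"
proof -
  have "(\<integral>z. exp (- sum K E) \<partial>spins V) \<le> xy_Z V E K"
    unfolding xy_Z_def
    by (rule Bochner_Integration.integral_mono)
       (use xy_weight_bounds(2) integrable_xy_weight1 assms in auto)
  then show ?thesis by (simp add: spins.prob_space) (meson exp_gt_zero less_le_trans)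
qed

lemma xy_ginibre:
  assumes "finite V" "finite E" "\<And>e. e \<in> E \<Longrightarrow> 0 \<le> K e \<and> K e \<le> K' e"
    and "\<And>e. e \<in> E \<Longrightarrow> norm (w e) = 1"
  shows "norm (\<integral>z. (spin V z a)\<^sup>2 * of_real (exp (\<Sum>e\<in>E. K e * Re (w e * edge_char V e z))) \<partial>spins V)
      * xy_Z V E K' \<le> (\<integral>z. exp (\<Sum>e\<in>E. K e * Re (w e * edge_char V e z)) \<partial>spins V) * xy_N V E K' a"
  unfolding xy_Z_def xy_N_def xy_weight_def
  by (rule ginibre_phases) (use assms character_edge_char character_spin_square in auto)

text \<open>With equal couplings and all phases 1, Ginibre's inequality bounds a norm times Z by Z
  times the numerator, which is therefore nonnegative.\<close>

lemma xy_mag_nonneg: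
  assumes "finite V" "finite E" "\<And>e. e \<in> E \<Longrightarrow> 0 \<le> K e"
  shows "0 \<le> xy_mag V E K a"
proof -
  have "0 \<le> (\<integral>z. xy_weight V E K z \<partial>spins V) * xy_N V E K a"
    using order.trans[OF mult_nonneg_nonneg[OF norm_ge_zero] xy_ginibre[of V E K K "\<lambda>_. 1"]]
      xy_Z_pos[of E K V] assms by (simp add: xy_weight_def less_imp_le)
  then show ?thesis
    using xy_Z_pos[of E K V] assms by (simp add: xy_mag_def xy_Z_def zero_le_mult_iff)
qed

lemma abs_Re_integral_le:
  assumes [measurable]: "f \<in> borel_measurable (spins V)" "g \<in> borel_measurable (spins V)"
    and "\<And>z. z \<in> space (spins V) \<Longrightarrow> norm (f z) = 1"
    and "\<And>z. z \<in> space (spins V) \<Longrightarrow> \<bar>g z\<bar> \<le> B"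
  shows "\<bar>\<integral>z. Re (f z) * g z \<partial>spins V\<bar> \<le> norm (\<integral>z. f z * of_real (g z) \<partial>spins V)"
proof -
  have i: "integrable (spins V) (\<lambda>z. f z * of_real (g z))"
    by (rule spins.integrable_bounded[where B=B]) (measurable, use assms in \<open>simp add: norm_mult\<close>)
  have "(\<integral>z. Re (f z) * g z \<partial>spins V) = (\<integral>z. Re (f z * of_real (g z)) \<partial>spins V)"
    by (simp add: times_complex.sel(1))
  also have "\<dots> = Re (\<integral>z. f z * of_real (g z) \<partial>spins V)"
    using i by (subst integral_Re) auto
  finally show ?thesis using abs_Re_le_cmod by simp
qed

text \<open>The numerator for K is at most the modulus of the complex integral, to which Ginibre's
  inequality with phases 1 applies.\<close>

lemma xy_mag_mono_K:
  assumes "finite V" "finite E" "\<And>e. e \<in> E \<Longrightarrow> 0 \<le> K e \<and> K e \<le> K' e"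
  shows "xy_mag V E K a \<le> xy_mag V E K' a"
proof -
  have K: "\<And>e. e \<in> E \<Longrightarrow> 0 \<le> K e" "\<And>e. e \<in> E \<Longrightarrow> 0 \<le> K' e" using assms(3) by force+
  note Z = xy_Z_pos[of E K V, OF K(1)] xy_Z_pos[of E K' V, OF K(2)]
  have "xy_N V E K a \<le> norm (\<integral>z. (spin V z a)\<^sup>2 * of_real (xy_weight V E K z) \<partial>spins V)"
    unfolding xy_N_def
    by (rule order.trans[OF abs_ge_self abs_Re_integral_le[where B="exp (sum K E)"]])
       (use xy_weight_bounds(1)[of E K] K xy_weight_pos[of V E K] in \<open>auto simp: norm_power less_imp_le\<close>)
  then have "xy_N V E K a * xy_Z V E K' \<le> norm (\<integral>z. (spin V z a)\<^sup>2 * of_real (xy_weight V E K z) \<partial>spins V) * xy_Z V E K'"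
    using Z by (simp add: mult_right_mono)
  also have "\<dots> \<le> xy_Z V E K * xy_N V E K' a"
    using xy_ginibre[of V E K K' "\<lambda>_. 1" a] assms by (simp add: xy_weight_def xy_Z_def)
  finally show ?thesis using Z by (simp add: xy_mag_def field_simps)
qed

text \<open>Given the spins outside V, the model in V has unit boundary spins up to phases on the
  couplings, so that the bound with phases applies to the conditional expectation.\<close>

lemma xy_mag_antimono_volume:
  assumes V': "finite V'" and E': "finite E'" and sub: "V \<subseteq> V'" "E \<subseteq> E'" and a: "a \<in> V"
    and K: "\<And>e. e \<in> E' \<Longrightarrow> 0 \<le> K e"
    and out: "\<And>e. e \<in> E' - E \<Longrightarrow> src e \<notin> V \<and> tgt e \<notin> V"
  shows "xy_mag V' E' K a \<le> xy_mag V E K a"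
proof -
  define W where "W = V' - V"
  have W: "W \<inter> V = {}" "finite W" "finite V" "W \<union> V = V'" "finite E"
    using V' sub E' by (auto simp: W_def intro: finite_subset)
  define C where "C x = exp (\<Sum>e\<in>E'-E. K e * Re (edge_char W e x))" for x
  define H where "H x y = exp (\<Sum>e\<in>E. K e * Re (edge_char W e x * edge_char V e y))" for x y
  have KE: "\<And>e. e \<in> E \<Longrightarrow> 0 \<le> K e" using K sub by auto
  \<comment> \<open>A spin is the product of its outer and inner versions, since each version is 1
    where the other lives. Hence the outer configuration enters an edge of \<open>E\<close> only as
    a unit factor, the phase of that coupling.\<close>
  have sp: "spin V' (merge W V (x, y)) s = spin W x s * spin V y s" for x y s
    using W by (auto simp: spin_def merge_def)
  have ec: "edge_char V' e (merge W V (x, y)) = edge_char W e x * edge_char V e y" for e x y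
    by (simp add: edge_char_def sp mult_ac)
  have we: "xy_weight V' E' K (merge W V (x, y)) = C x * H x y" for x y
  proof -
    have "(\<Sum>e\<in>E'. K e * Re (edge_char V' e (merge W V (x, y)))) =
      (\<Sum>e\<in>E'-E. K e * Re (edge_char W e x * edge_char V e y)) + (\<Sum>e\<in>E. K e * Re (edge_char W e x * edge_char V e y))"
      unfolding ec by (rule sum.subset_diff[OF sub(2) E'])
    also have "(\<Sum>e\<in>E'-E. K e * Re (edge_char W e x * edge_char V e y)) = (\<Sum>e\<in>E'-E. K e * Re (edge_char W e x))"
      by (intro sum.cong refl) (use out in \<open>simp add: edge_char_def spin_def\<close>)
    finally show ?thesis by (simp add: xy_weight_def C_def H_def exp_add)
  qed
  have fold: "(\<integral>z. f z \<partial>spins V') = (\<integral>x. (\<integral>y. f (merge W V (x, y)) \<partial>spins V) \<partial>spins W)"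
    if "integrable (spins V') f" for f :: "_ \<Rightarrow> real"
    using circs.product_integral_fold[OF W(1-3), of f] that W(4) by (simp add: spins_def)
  define A where "A x = (\<integral>y. Re ((spin V y a)\<^sup>2) * H x y \<partial>spins V)" for x
  define B where "B x = (\<integral>y. H x y \<partial>spins V)" for x
  have Hm [measurable]: "case_prod H \<in> borel_measurable (spins W \<Otimes>\<^sub>M spins V)"
    unfolding H_def case_prod_beta by measurable
  have Hmx: "H x \<in> borel_measurable (spins V)" for x
    unfolding H_def by measurable
  have Am: "A \<in> borel_measurable (spins W)" "B \<in> borel_measurable (spins W)" "C \<in> borel_measurable (spins W)"
    unfolding A_def B_def C_def by measurable
  have Hb: "0 < H x y" "H x y \<le> exp (sum K E)" if "x \<in> space (spins W)" "y \<in> space (spins V)" for x y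
    unfolding H_def
     apply simp
    by (rule exp_energy_bounds) (use that KE in \<open>auto intro!: abs_Re_unit simp: norm_mult\<close>)
  have iH: "integrable (spins V) (\<lambda>y. f y * H x y)"
    if "x \<in> space (spins W)" "f \<in> borel_measurable (spins V)" "\<And>y. y \<in> space (spins V) \<Longrightarrow> \<bar>f y\<bar> \<le> 1" for x f
  proof (rule spins.integrable_bounded[where B="1 * exp (sum K E)"])
    show "(\<lambda>y. f y * H x y) \<in> borel_measurable (spins V)" using that(2) Hmx by measurable
    fix y assume y: "y \<in> space (spins V)"
    show "norm (f y * H x y) \<le> 1 * exp (sum K E)"
      using Hb[OF that(1) y] that(3)[OF y] unfolding real_norm_def abs_mult by (intro mult_mono) auto
  qed
  have ABb: "\<bar>A x\<bar> \<le> exp (sum K E)" "\<bar>B x\<bar> \<le> exp (sum K E)" if x: "x \<in> space (spins W)" for x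
  proof -
    have *: "\<bar>\<integral>y. f y * H x y \<partial>spins V\<bar> \<le> exp (sum K E)"
      if "f \<in> borel_measurable (spins V)" "\<And>y. y \<in> space (spins V) \<Longrightarrow> \<bar>f y\<bar> \<le> 1" for f
    proof -
      have "\<bar>\<integral>y. f y * H x y \<partial>spins V\<bar> \<le> (\<integral>y. \<bar>f y * H x y\<bar> \<partial>spins V)"
        by (rule integral_abs_bound)
      also have "\<dots> \<le> (\<integral>y. exp (sum K E) \<partial>spins V)"
      proof (rule Bochner_Integration.integral_mono)
        fix y assume y: "y \<in> space (spins V)"
        show "\<bar>f y * H x y\<bar> \<le> exp (sum K E)"
          using Hb[OF x y] that(2)[OF y] mult_mono[of "\<bar>f y\<bar>" 1 "H x y" "exp (sum K E)"] by (simp add: abs_mult)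
      qed (use iH[OF x that] in auto)
      finally show ?thesis by (simp add: spins.prob_space)
    qed
    show "\<bar>A x\<bar> \<le> exp (sum K E)" unfolding A_def
      by (rule *) (auto intro!: abs_Re_unit simp: norm_power)
    show "\<bar>B x\<bar> \<le> exp (sum K E)" using *[of "\<lambda>_. 1"] by (simp add: B_def)
  qed
  have Cb: "0 < C x" "C x \<le> exp (sum K (E'-E))" if "x \<in> space (spins W)" for x
    unfolding C_def
     apply simp
    by (rule exp_energy_bounds) (use that K in \<open>auto intro!: abs_Re_unit\<close>)
  have iC: "integrable (spins W) (\<lambda>x. C x * f x)"
    if [measurable]: "f \<in> borel_measurable (spins W)" and b: "\<And>x. x \<in> space (spins W) \<Longrightarrow> \<bar>f x\<bar> \<le> exp (sum K E)" for f
  proof (rule spins.integrable_bounded[where B="exp (sum K (E'-E)) * exp (sum K E)"])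
    show "(\<lambda>x. C x * f x) \<in> borel_measurable (spins W)" using Am by measurable
    fix y assume y: "y \<in> space (spins W)"
    show "norm (C y * f y) \<le> exp (sum K (E'-E)) * exp (sum K E)"
      using Cb[OF y] b[OF y] unfolding real_norm_def abs_mult by (intro mult_mono) auto
  qed
  have N: "xy_N V' E' K a = (\<integral>x. C x * A x \<partial>spins W)"
  proof -
    have "xy_N V' E' K a = (\<integral>x. (\<integral>y. Re ((spin V' (merge W V (x, y)) a)\<^sup>2) * xy_weight V' E' K (merge W V (x, y)) \<partial>spins V) \<partial>spins W)"
      unfolding xy_N_def by (rule fold) (use K integrable_xy_N in auto)
    also have "\<dots> = (\<integral>x. (\<integral>y. C x * (Re ((spin V y a)\<^sup>2) * H x y) \<partial>spins V) \<partial>spins W)"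
    proof -
      have "a \<notin> W" using a W by auto
      then show ?thesis by (simp add: we sp spin_def[of W] mult_ac)
    qed
    finally show ?thesis by (simp add: A_def)
  qed
  have Z: "xy_Z V' E' K = (\<integral>x. C x * B x \<partial>spins W)"
  proof -
    have "xy_Z V' E' K = (\<integral>x. (\<integral>y. xy_weight V' E' K (merge W V (x, y)) \<partial>spins V) \<partial>spins W)"
      unfolding xy_Z_def by (rule fold) (use K integrable_xy_weight1 in auto)
    then show ?thesis by (simp add: we B_def)
  qed
  \<comment> \<open>The inequality conditional on the outer spins x; multiplied by
    \<open>C x > 0\<close> it can be integrated.\<close>
  have AB: "A x * xy_Z V E K \<le> B x * xy_N V E K a" if x: "x \<in> space (spins W)" for x
  proof -
    have "A x \<le> norm (\<integral>y. (spin V y a)\<^sup>2 * of_real (H x y) \<partial>spins V)"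
      unfolding A_def
      by (rule order.trans[OF abs_ge_self abs_Re_integral_le[where B="exp (sum K E)"]])
         (use Hb[OF x] Hmx in \<open>auto simp: norm_power less_imp_le\<close>)
    then have "A x * xy_Z V E K \<le> norm (\<integral>y. (spin V y a)\<^sup>2 * of_real (H x y) \<partial>spins V) * xy_Z V E K"
      using xy_Z_pos[of E K V] KE by (simp add: mult_right_mono)
    also have "\<dots> \<le> B x * xy_N V E K a"
      unfolding B_def H_def by (rule xy_ginibre) (use W KE x in auto)
    finally show ?thesis .
  qed
  have "xy_N V' E' K a * xy_Z V E K = (\<integral>x. C x * (A x * xy_Z V E K) \<partial>spins W)"
    unfolding N by (simp flip: integral_mult_left_zero add: mult.assoc)
  also have "\<dots> \<le> (\<integral>x. C x * (B x * xy_N V E K a) \<partial>spins W)"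
  proof (rule Bochner_Integration.integral_mono)
    show "integrable (spins W) (\<lambda>x. C x * (A x * xy_Z V E K))"
      using iC[OF Am(1) ABb(1)] by (simp add: mult.assoc[symmetric])
    show "integrable (spins W) (\<lambda>x. C x * (B x * xy_N V E K a))"
      using iC[OF Am(2) ABb(2)] by (simp add: mult.assoc[symmetric])
    show "C x * (A x * xy_Z V E K) \<le> C x * (B x * xy_N V E K a)" if "x \<in> space (spins W)" for x
      using AB[OF that] Cb[OF that] by (simp add: mult_left_mono)
  qed
  also have "\<dots> = xy_Z V' E' K * xy_N V E K a"
    unfolding Z by (simp flip: integral_mult_left_zero add: mult.assoc)
  finally show ?thesis
    using xy_Z_pos[of E K V] xy_Z_pos[of E' K V'] K KE by (simp add: xy_mag_def field_simps)
qed

text \<open>The smaller model is the larger one with the couplings outside the image of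
  \<open>g\<close> set to zero: the spins off the image of V then decouple and integrate out.
  Raising these couplings to K can only increase the magnetization.\<close>

lemma xy_mag_embed:
  assumes V: "finite V" "finite V'" and E: "finite E" "finite E'" and K: "0 \<le> K"
    and inj: "inj_on f V" and fV: "\<And>x. x \<in> V \<Longrightarrow> f x \<in> V'" and a: "a \<in> V"
    and fE: "\<And>e. e \<in> E \<Longrightarrow> g e \<in> E'" "inj_on g E"
    and st: "\<And>e. e \<in> E \<Longrightarrow> src (g e) = f (src e) \<and> tgt (g e) = f (tgt e)"
    and bd: "\<And>e. e \<in> E \<Longrightarrow> (src e \<notin> V \<longrightarrow> f (src e) \<notin> V') \<and> (tgt e \<notin> V \<longrightarrow> f (tgt e) \<notin> V')"
  shows "xy_mag V E (\<lambda>_. K) a \<le> xy_mag V' E' (\<lambda>_. K) (f a)"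
proof -
  define K1 where "K1 e = (if e \<in> g ` E then K else 0)" for e
  define R where "R z = (\<lambda>x\<in>V. z (f x))" for z :: "site \<Rightarrow> complex"
  have d: "distr (spins V') (spins V) R = spins V"
    unfolding spins_def R_def
    by (rule distr_PiM_reindex) (use inj fV prob_space_circ in auto)
  have Rm: "R \<in> measurable (spins V') (spins V)"
    unfolding R_def spins_def by (intro measurable_restrict measurable_component_singleton fV)
  have red: "(\<integral>z. h (R z) \<partial>spins V') = (\<integral>z. h z \<partial>spins V)" if "h \<in> borel_measurable (spins V)" for h :: "_ \<Rightarrow> real"
    by (subst d[symmetric], subst integral_distr[OF Rm]) (use that in auto)
  have w: "xy_weight V' E' K1 z = xy_weight V E (\<lambda>_. K) (R z)" for z
  proof -
    have "(\<Sum>e\<in>E'. K1 e * Re (edge_char V' e z)) = (\<Sum>e\<in>g ` E. K * Re (edge_char V' e z))"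
      by (rule sum.mono_neutral_cong_right) (use E fE in \<open>auto simp: K1_def\<close>)
    also have "\<dots> = (\<Sum>e\<in>E. K * Re (edge_char V' (g e) z))"
      by (simp add: sum.reindex[OF fE(2)])
    also have "\<dots> = (\<Sum>e\<in>E. K * Re (edge_char V e (R z)))"
    proof (intro sum.cong refl)
      fix e assume e: "e \<in> E"
      have "spin V' z (f (src e)) = spin V (R z) (src e)" "spin V' z (f (tgt e)) = spin V (R z) (tgt e)"
        using bd[OF e] fV by (auto simp: spin_def R_def)
      then show "K * Re (edge_char V' (g e) z) = K * Re (edge_char V e (R z))"
        using st[OF e] by (simp add: edge_char_def)
    qed
    finally show ?thesis by (simp add: xy_weight_def)
  qed
  have "xy_Z V' E' K1 = xy_Z V E (\<lambda>_. K)"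
    unfolding xy_Z_def w by (rule red) measurable
  moreover have "xy_N V' E' K1 (f a) = xy_N V E (\<lambda>_. K) a"
  proof -
    have "spin V' z (f a) = spin V (R z) a" for z using a fV by (simp add: spin_def R_def)
    then show ?thesis
      unfolding xy_N_def w by (simp add: red[of "\<lambda>z. Re ((spin V z a)\<^sup>2) * xy_weight V E (\<lambda>_. K) z"])
  qed
  ultimately have "xy_mag V E (\<lambda>_. K) a = xy_mag V' E' K1 (f a)" by (simp add: xy_mag_def)
  also have "\<dots> \<le> xy_mag V' E' (\<lambda>_. K) (f a)"
    by (rule xy_mag_mono_K) (use V E K in \<open>auto simp: K1_def\<close>)
  finally show ?thesis .
qed

lemma cos_ge_quadratic: "1 - d\<^sup>2 / 2 \<le> cos (d::real)"
proof -
  have "cos d = 1 - 2 * (sin (d/2))\<^sup>2" using cos_double_sin[of "d/2"] by simp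
  moreover have "\<bar>sin (d/2)\<bar> \<le> \<bar>d/2\<bar>" by (rule abs_sin_x_le_abs_x)
  then have "(sin (d/2))\<^sup>2 \<le> (d/2)\<^sup>2" by (simp only: abs_le_square_iff)
  ultimately show ?thesis by (simp add: power_divide)
qed

text \<open>Mermin-Wagner bound: rotate by a field \<open>\<phi>\<close> and by \<open>-\<phi>\<close>; both rotations exchange
  \<open>1 + cos 2\<theta>\<close> and \<open>1 - cos 2\<theta>\<close> at \<open>a\<close>, and the geometric mean of the two rotated weights loses
  only the Dirichlet energy of \<open>\<phi>\<close>.\<close>

lemma xy_mag_rotation_bound:
  assumes V: "finite V" and E: "finite E" and K: "\<And>e. e \<in> E \<Longrightarrow> 0 \<le> K e"
    and \<phi>: "\<And>x. x \<notin> V \<Longrightarrow> \<phi> x = 0" "\<phi> a = pi / 2"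
  shows "xy_mag V E K a \<le> (\<Sum>e\<in>E. K e * (\<phi> (src e) - \<phi> (tgt e))\<^sup>2) / 2"
proof -
  define D where "D = (\<Sum>e\<in>E. K e * (\<phi> (src e) - \<phi> (tgt e))\<^sup>2) / 2"
  define rot where "rot s z = mulc V (\<lambda>x. cis (s * \<phi> x)) z" for s z
  have sp: "spin V (rot s z) x = cis (s * \<phi> x) * spin V z x" for s z x
    by (auto simp: spin_def rot_def mulc_def \<phi>)
  define f where "f s z = (1 + s * Re ((spin V z a)\<^sup>2))" for s z
  have f0: "0 \<le> f s z" "\<bar>f s z\<bar> \<le> 2" if "z \<in> space (spins V)" "\<bar>s\<bar> \<le> 1" for s z
  proof -
    have "\<bar>Re ((spin V z a)\<^sup>2)\<bar> \<le> 1" by (rule abs_Re_unit) (use that in \<open>simp add: norm_power\<close>)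
    with that(2) have "\<bar>s * Re ((spin V z a)\<^sup>2)\<bar> \<le> 1" by (simp add: abs_mult mult_le_one)
    then show "0 \<le> f s z" "\<bar>f s z\<bar> \<le> 2" by (auto simp: f_def)
  qed
  have fm [measurable]: "f s \<in> borel_measurable (spins V)" for s unfolding f_def by measurable
  have frot: "f (-1) (rot s z) = f 1 z" if "s \<in> {-1, 1}" for s z
  proof -
    have "(cis (s * (pi/2)))\<^sup>2 = -1" using that by (auto simp: power2_eq_square cis_mult complex_eq_iff)
    then show ?thesis by (simp add: f_def sp \<phi> power_mult_distrib)
  qed
  have g: "exp (- D) * xy_weight V E K z \<le> (xy_weight V E K (rot 1 z) + xy_weight V E K (rot (-1) z)) / 2"
    if z: "z \<in> space (spins V)" for z
  proof -
    define h where "h s = (\<Sum>e\<in>E. K e * Re (edge_char V e (rot s z)))" for s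
    \<comment> \<open>On each edge, averaging the rotations by d and -d multiplies the cosine by cos
      d, which costs at most d^2 / 2.\<close>
    have "(\<Sum>e\<in>E. K e * Re (edge_char V e z)) - D \<le> (h 1 + h (-1)) / 2"
    proof -
      have "K e * Re (edge_char V e z) - K e * (\<phi> (src e) - \<phi> (tgt e))\<^sup>2 / 2 \<le>
        (K e * Re (edge_char V e (rot 1 z)) + K e * Re (edge_char V e (rot (-1) z))) / 2" if e: "e \<in> E" for e
      proof -
        let ?d = "\<phi> (src e) - \<phi> (tgt e)" and ?r = "Re (edge_char V e z)"
        have ec: "edge_char V e (rot s z) = cis (s * ?d) * edge_char V e z" for s
        proof -
          have "cis (s * \<phi> (src e)) * cnj (cis (s * \<phi> (tgt e))) = cis (s * ?d)"
            by (simp add: cis_cnj cis_mult right_diff_distrib)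
          then show ?thesis by (simp add: edge_char_def sp mult_ac)
        qed
        have "Re (edge_char V e (rot 1 z)) + Re (edge_char V e (rot (-1) z)) = 2 * cos ?d * ?r"
        proof -
          have "Re (cis (1 * d) * c) + Re (cis (-1 * d) * c) = 2 * cos d * Re c" for d c
            by (simp add: times_complex.sel)
          then show ?thesis unfolding ec .
        qed
        then have *: "(K e * Re (edge_char V e (rot 1 z)) + K e * Re (edge_char V e (rot (-1) z))) / 2 = K e * (cos ?d * ?r)"
          by (simp add: distrib_left[symmetric])
        have "1 - ?d\<^sup>2 / 2 \<le> cos ?d" by (rule cos_ge_quadratic)
        then have c: "1 - cos ?d \<le> ?d\<^sup>2 / 2" by simp
        have r: "\<bar>?r\<bar> \<le> 1" by (rule abs_Re_unit) (use z in simp)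
        have "(1 - cos ?d) * ?r \<le> (1 - cos ?d) * 1"
          using r by (intro mult_left_mono) auto
        then have "?r - ?d\<^sup>2 / 2 \<le> cos ?d * ?r" using c by (simp add: algebra_simps)
        from mult_left_mono[OF this K[OF e]] show ?thesis
          unfolding * by (simp add: right_diff_distrib)
      qed
      then have "(\<Sum>e\<in>E. K e * Re (edge_char V e z) - K e * (\<phi> (src e) - \<phi> (tgt e))\<^sup>2 / 2) \<le>
        (\<Sum>e\<in>E. (K e * Re (edge_char V e (rot 1 z)) + K e * Re (edge_char V e (rot (-1) z))) / 2)"
        by (rule sum_mono)
      then show ?thesis
        by (simp add: h_def D_def sum_subtractf sum_divide_distrib[symmetric] sum.distrib)
    qed
    then have "exp (- D) * xy_weight V E K z \<le> exp ((h 1 + h (-1)) / 2)"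
      by (simp add: xy_weight_def exp_add[symmetric])
    \<comment> \<open>Geometric mean at most arithmetic mean; the two rotated weights can then be
      integrated separately.\<close>
    also have "\<dots> \<le> (exp (h 1) + exp (h (-1))) / 2"
    proof -
      have "0 \<le> (exp (h 1 / 2) - exp (h (-1) / 2))\<^sup>2" by simp
      also have "\<dots> = exp (h 1) + exp (h (-1)) - 2 * exp ((h 1 + h (-1)) / 2)"
        by (simp add: power2_diff exp_add[symmetric] add_divide_distrib flip: exp_of_nat_mult)
      finally show ?thesis by simp
    qed
    finally show ?thesis by (simp add: xy_weight_def h_def)
  qed
  have int: "integrable (spins V) (\<lambda>z. f s z * xy_weight V E K z)" if "\<bar>s\<bar> \<le> 1" for s
    by (rule integrable_xy_weight[where B=2]) (use K f0 that in auto)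
  have rotm: "rot s \<in> measurable (spins V) (spins V)" for s
  proof -
    have c: "(\<lambda>x\<in>V. cis (s * \<phi> x)) \<in> space (spins V)" by (simp add: space_spins)
    have "rot s = (\<lambda>z. mulc V (\<lambda>x\<in>V. cis (s * \<phi> x)) z)"
      by (auto simp: rot_def mulc_def fun_eq_iff)
    moreover have "\<dots> \<in> measurable (spins V) (spins V)" using c by measurable
    ultimately show ?thesis by simp
  qed
  have rint: "(\<integral>z. f 1 z * xy_weight V E K (rot s z) \<partial>spins V) = (\<integral>z. f (-1) z * xy_weight V E K z \<partial>spins V)"
    and ri: "integrable (spins V) (\<lambda>z. f 1 z * xy_weight V E K (rot s z))" if s: "s \<in> {-1,1}" for s
  proof -
    have "(\<integral>z. f (-1) (rot s z) * xy_weight V E K (rot s z) \<partial>spins V) = (\<integral>z. f (-1) z * xy_weight V E K z \<partial>spins V)"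
      unfolding rot_def by (rule integral_spins_mulc[OF V, of _ "\<lambda>z. f (-1) z * xy_weight V E K z"]) auto
    then show "(\<integral>z. f 1 z * xy_weight V E K (rot s z) \<partial>spins V) = (\<integral>z. f (-1) z * xy_weight V E K z \<partial>spins V)"
      by (simp add: frot[OF s])
    show "integrable (spins V) (\<lambda>z. f 1 z * xy_weight V E K (rot s z))"
    proof (rule spins.integrable_bounded[where B="2 * exp (sum K E)"])
      show "(\<lambda>z. f 1 z * xy_weight V E K (rot s z)) \<in> borel_measurable (spins V)"
        by (intro borel_measurable_times fm measurable_compose[OF rotm measurable_xy_weight])
      fix z assume z: "z \<in> space (spins V)"
      show "norm (f 1 z * xy_weight V E K (rot s z)) \<le> 2 * exp (sum K E)"
        unfolding real_norm_def abs_mult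
        using f0(2)[OF z, of 1] xy_weight_bounds(1)[OF K measurable_space[OF rotm[of s] z]] xy_weight_pos[of V E K "rot s z"]
        by (intro mult_mono) auto
    qed
  qed
  have "exp (- D) * (\<integral>z. f 1 z * xy_weight V E K z \<partial>spins V)
      = (\<integral>z. f 1 z * (exp (- D) * xy_weight V E K z) \<partial>spins V)"
    by (simp flip: integral_mult_right_zero add: mult_ac)
  also have "\<dots> \<le> (\<integral>z. (f 1 z * xy_weight V E K (rot 1 z) + f 1 z * xy_weight V E K (rot (-1) z)) / 2 \<partial>spins V)"
  proof (rule Bochner_Integration.integral_mono)
    show "integrable (spins V) (\<lambda>z. f 1 z * (exp (- D) * xy_weight V E K z))"
      using integrable_mult_right[OF int[of 1], of "exp (-D)"] by (simp add: mult_ac)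
    show "integrable (spins V) (\<lambda>z. (f 1 z * xy_weight V E K (rot 1 z) + f 1 z * xy_weight V E K (rot (-1) z)) / 2)"
      using ri by (intro integrable_divide_zero Bochner_Integration.integrable_add) auto
    fix z assume z: "z \<in> space (spins V)"
    from mult_left_mono[OF g[OF z] f0(1)[OF z, of 1]]
    show "f 1 z * (exp (- D) * xy_weight V E K z) \<le> (f 1 z * xy_weight V E K (rot 1 z) + f 1 z * xy_weight V E K (rot (-1) z)) / 2"
      by (simp add: distrib_left)
  qed
  also have "\<dots> = (\<integral>z. f (-1) z * xy_weight V E K z \<partial>spins V)"
    using ri rint by simp
  finally have *: "exp (- D) * (\<integral>z. f 1 z * xy_weight V E K z \<partial>spins V) \<le> (\<integral>z. f (-1) z * xy_weight V E K z \<partial>spins V)" .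
  have fZ: "(\<integral>z. f s z * xy_weight V E K z \<partial>spins V) = xy_Z V E K + s * xy_N V E K a" for s
  proof -
    have "(\<integral>z. f s z * xy_weight V E K z \<partial>spins V) = (\<integral>z. xy_weight V E K z + s * (Re ((spin V z a)\<^sup>2) * xy_weight V E K z) \<partial>spins V)"
      by (simp add: f_def distrib_right mult.assoc)
    then show ?thesis
      using integrable_xy_weight1[of E K V] integrable_xy_N[of E K V a] K by (simp add: xy_Z_def xy_N_def)
  qed
  define m where "m = xy_mag V E K a"
  have Z: "0 < xy_Z V E K" using xy_Z_pos K by blast
  have N: "xy_N V E K a = m * xy_Z V E K" using Z by (simp add: m_def xy_mag_def)
  have "(exp (- D) * (1 + m)) * xy_Z V E K \<le> (1 - m) * xy_Z V E K"
    using * unfolding fZ N by (simp add: algebra_simps)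
  \<comment> \<open>Dropping m >= 0 on the left leaves m <= 1 - exp (- D) <= D.\<close>
  then have 1: "exp (- D) * (1 + m) \<le> 1 - m" using Z by simp
  have m0: "0 \<le> m" unfolding m_def by (rule xy_mag_nonneg) (use V E K in auto)
  have "exp (- D) \<le> exp (- D) * (1 + m)" using m0 by simp
  then have "m \<le> 1 - exp (- D)" using 1 by linarith
  also have "\<dots> \<le> D" using exp_ge_add_one_self[of "-D"] by simp
  finally show ?thesis by (simp add: m_def D_def)
qed

section \<open>Orbits of two involutions\<close>

text \<open>H stands for the half-links, p for passing to the other end of the link, s for the
  pairing. Boundary half-links are the fixed points of s, so closed and open loops are the orbits
  without and with fixed points.\<close>

locale two_involutions =
  fixes H :: "'h set" and p s :: "'h \<Rightarrow> 'h"
  assumes fin: "finite H"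
    and pH: "h \<in> H \<Longrightarrow> p h \<in> H" and pp: "h \<in> H \<Longrightarrow> p (p h) = h" and pn: "h \<in> H \<Longrightarrow> p h \<noteq> h"
    and sH: "h \<in> H \<Longrightarrow> s h \<in> H" and ss: "h \<in> H \<Longrightarrow> s (s h) = h"
begin

definition step :: "('h \<times> 'h) set" where
  "step = {(h, p h) | h. h \<in> H} \<union> {(h, s h) | h. h \<in> H}"

definition loops :: "('h \<times> 'h) set" where
  "loops = (step \<union> step\<inverse>)\<^sup>*"

definition fixpts :: "'h set" where
  "fixpts = {h\<in>H. s h = h}"

lemma loops_sym: "(a, b) \<in> loops \<Longrightarrow> (b, a) \<in> loops"
proof -
  have "sym loops" unfolding loops_def by (intro sym_rtrancl sym_Un_converse)
  then show "(a, b) \<in> loops \<Longrightarrow> (b, a) \<in> loops" by (rule symD)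
qed

lemma loops_trans: "(a, b) \<in> loops \<Longrightarrow> (b, c) \<in> loops \<Longrightarrow> (a, c) \<in> loops"
  unfolding loops_def by (rule rtrancl_trans)

lemma loops_refl [simp]: "(a, a) \<in> loops"
  by (simp add: loops_def)

lemma loops_p: "h \<in> H \<Longrightarrow> (h, p h) \<in> loops" and loops_s: "h \<in> H \<Longrightarrow> (h, s h) \<in> loops"
  unfolding loops_def step_def by (auto intro!: r_into_rtrancl)

text \<open>An invariant set cannot be left backwards either, because p and s are their own
  inverses.\<close>

lemma loops_closed:
  assumes "(a, b) \<in> loops" "a \<in> S" "S \<subseteq> H" "\<And>h. h \<in> S \<Longrightarrow> p h \<in> S" "\<And>h. h \<in> S \<Longrightarrow> s h \<in> S"
  shows "b \<in> S"
  using assms(1) unfolding loops_def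
proof (induction rule: rtrancl_induct)
  case (step b c)
  from step(2) consider "(b, c) \<in> local.step" | "(c, b) \<in> local.step" by auto
  then show ?case
  proof cases
    case 1 then show ?thesis using assms step(3) by (auto simp: local.step_def)
  next
    case 2
    then have "c \<in> H" "b = p c \<or> b = s c" by (auto simp: local.step_def)
    then have "c = p b \<or> c = s b" using pp ss by auto
    then show ?thesis using assms step(3) by auto
  qed
qed (use assms in auto)

lemma loops_H: "(a, b) \<in> loops \<Longrightarrow> a \<in> H \<Longrightarrow> b \<in> H"
  by (rule loops_closed) (auto simp: pH sH)

text \<open>Starting from a fixed point of s, the alternating walk \<open>b i = (s \<circ> p)^i h\<close> is periodic with
  some period n, and \<open>p (b i) = b (n - 1 - i)\<close>, \<open>s (b i) = b (n - i)\<close>; hence n is even and the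
  only fixed points of s on it are \<open>b 0\<close> and \<open>b (n/2)\<close>.\<close>

lemma card_fixpts_loop:
  assumes h: "h \<in> fixpts"
  shows "card {k \<in> fixpts. (h, k) \<in> loops} = 2"
proof -
  define t where "t = (\<lambda>k. s (p k))"
  define b where "b i = (t ^^ i) h" for i :: nat
  have hH: "h \<in> H" "s h = h" using h by (auto simp: fixpts_def)
  have b0: "b 0 = h" and bS: "b (Suc i) = s (p (b i))" for i by (auto simp: b_def t_def)
  have bH: "b i \<in> H" for i by (induction i) (auto simp: b0 bS hH pH sH)
  have tinj: "x = y" if "x \<in> H" "y \<in> H" "s (p x) = s (p y)" for x y
    using that by (metis pp ss pH)
  have "\<exists>i j. i < j \<and> b i = b j"
  proof (rule ccontr)
    assume "\<not> ?thesis"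
    then have "inj b" by (metis injI linorder_neqE_nat)
    moreover have "range b \<subseteq> H" using bH by auto
    ultimately show False using fin finite_imageD finite_subset infinite_UNIV_nat by blast
  qed
  then obtain i j where ij: "i < j" "b i = b j" by blast
  \<comment> \<open>The step \<open>t\<close> is injective on H, so a repetition can be shifted back
    until it involves the starting point.\<close>
  have bk: "b (j - k) = b (i - k)" if "k \<le> i" for k using that
  proof (induction k)
    case (Suc k)
    then have "b (j - k) = b (i - k)" by simp
    moreover have "i - k = Suc (i - Suc k)" "j - k = Suc (j - Suc k)" using Suc ij by auto
    ultimately show ?case using tinj[OF bH bH] by (metis bS)
  qed (use ij in simp)
  have "\<exists>n>0. b n = h" using bk[of i] ij b0 by (intro exI[of _ "j - i"]) auto
  define n where "n = (LEAST n. 0 < n \<and> b n = h)"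
  have n: "0 < n" "b n = h"
    using LeastI_ex[OF \<open>\<exists>n>0. b n = h\<close>] unfolding n_def by auto
  have minim: "\<not> (0 < m \<and> b m = h)" if "m < n" for m
    using not_less_Least[of m "\<lambda>n. 0 < n \<and> b n = h"] that unfolding n_def by auto
  have inj: "i = j" if "i < n" "j < n" "b i = b j" for i j
  proof -
    have *: False if "i < j" "j < n" "b i = b j" for i j
    proof -
      have "b (j - k) = b (i - k)" if "k \<le> i" for k using that
      proof (induction k)
        case (Suc k)
        then have "b (j - k) = b (i - k)" by simp
        moreover have "i - k = Suc (i - Suc k)" "j - k = Suc (j - Suc k)" using Suc \<open>i < j\<close> by auto
        ultimately show ?case using tinj[OF bH bH] by (metis bS)
      qed (use \<open>b i = b j\<close> in simp)
      from this[of i] have "b (j - i) = h" by (simp add: b0)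
      moreover have "j - i < n" "0 < j - i" using that by linarith+
      ultimately show False using minim[of "j - i"] by simp
    qed
    show ?thesis using * that by (metis linorder_neqE_nat)
  qed
  have pb: "p (b i) = b (n - 1 - i)" if "i < n" for i using that
  proof (induction i)
    case 0
    have "s (p (b (n - 1))) = h" using n bS[of "n - 1"] by simp
    then have "p (b (n - 1)) = h" using ss[of "p (b (n-1))"] pH bH hH by metis
    then show ?case using pp bH b0 by (metis diff_zero)
  next
    case (Suc i)
    let ?m = "n - 2 - i"
    have e: "n - 1 - i = Suc ?m" "n - 1 - Suc i = ?m" using Suc by auto
    have "p (b (Suc i)) = p (s (b (Suc ?m)))" using Suc e by (simp add: bS)
    also have "\<dots> = p (p (b ?m))" by (simp add: bS ss pH bH)
    finally show ?case using e by (simp add: pp bH)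
  qed
  have sb: "s (b i) = b (n - i)" if "i < n" for i
  proof -
    have "s (b i) = s (p (b (n - 1 - i)))" using pb[OF that] pp[OF bH[of i]] by simp
    also have "\<dots> = b (Suc (n - 1 - i))" by (simp add: bS)
    finally show ?thesis using that by (simp add: Suc_diff_Suc)
  qed
  \<comment> \<open>For odd n the middle point of the walk would be fixed by p.\<close>
  have ev: "even n"
  proof (rule ccontr)
    assume "odd n"
    then obtain k where "n = 2 * k + 1" by (auto elim: oddE)
    then have "p (b k) = b k" using pb[of k] by simp
    then show False using pn bH by auto
  qed
  then obtain q where q: "n = 2 * q" by auto
  have q0: "0 < q" "q < n" using q n by auto
  have "{k. (h, k) \<in> loops} = b ` {..<n}"
  proof (intro set_eqI iffI)
    fix k assume "k \<in> {k. (h, k) \<in> loops}"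
    then have "(h, k) \<in> loops" by simp
    then show "k \<in> b ` {..<n}"
    proof (rule loops_closed)
      show "h \<in> b ` {..<n}" using n b0 by (metis imageI lessThan_iff)
      show "p k \<in> b ` {..<n}" if "k \<in> b ` {..<n}" for k using that pb by auto
      show "s k \<in> b ` {..<n}" if k: "k \<in> b ` {..<n}" for k
      proof -
        obtain i where i: "i < n" "k = b i" using k by auto
        show ?thesis
        proof (cases "i = 0")
          case True then show ?thesis using i hH b0 by auto
        next
          case False then show ?thesis using i sb[OF i(1)] by auto
        qed
      qed
    qed (use bH in auto)
  next
    fix k assume "k \<in> b ` {..<n}"
    then obtain i where "k = b i" by auto
    moreover have "(h, b i) \<in> loops" for i
    proof (induction i)
      case (Suc i)
      from loops_trans[OF loops_trans[OF Suc loops_p[OF bH]] loops_s[OF pH[OF bH]]]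
      show ?case by (simp add: bS)
    qed (simp add: b0)
    ultimately show "k \<in> {k. (h, k) \<in> loops}" by simp
  qed
  then have "{k \<in> fixpts. (h, k) \<in> loops} = {k \<in> b ` {..<n}. s k = k}"
    using bH by (auto simp: fixpts_def)
  also have "\<dots> = {b 0, b q}"
  proof (intro set_eqI iffI)
    fix k assume "k \<in> {k \<in> b ` {..<n}. s k = k}"
    then obtain i where i: "i < n" "k = b i" "s (b i) = b i" by auto
    show "k \<in> {b 0, b q}"
    proof (cases "i = 0")
      case False
      then have "n - i = i" using i sb[OF i(1)] inj[of "n - i" i] by auto
      then have "i = q" using q i(1) by linarith
      then show ?thesis using i by auto
    qed (use i in simp)
  next
    fix k assume "k \<in> {b 0, b q}"
    then show "k \<in> {k \<in> b ` {..<n}. s k = k}"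
      using sb[OF q0(2)] q q0 hH b0 n by auto
  qed
  also have "card \<dots> = 2" using inj[of 0 q] q0 n(1) by (auto simp: card_insert_if)
  finally show ?thesis .
qed

section \<open>Loop classes and their two-colourings\<close>

definition Cl :: "'h set set" where "Cl = H // loops"

definition Op :: "'h set set" where "Op = {C \<in> Cl. C \<inter> fixpts \<noteq> {}}"

lemma finite_Cl: "finite Cl"
proof -
  have "Cl \<subseteq> Pow H" unfolding Cl_def by (auto elim!: quotientE dest: loops_H)
  then show ?thesis using fin by (meson finite_Pow_iff finite_subset)
qed

lemma Cl_class: "C \<in> Cl \<Longrightarrow> h \<in> C \<Longrightarrow> C = loops `` {h}"
  unfolding Cl_def by (elim quotientE) (auto intro: loops_trans loops_sym)

lemma Cl_subset: "C \<in> Cl \<Longrightarrow> C \<subseteq> H"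
  unfolding Cl_def by (auto elim!: quotientE dest: loops_H)

lemma Cl_nonempty: "C \<in> Cl \<Longrightarrow> C \<noteq> {}"
  unfolding Cl_def by (elim quotientE) (use loops_refl in blast)

lemma class_in_Cl: "h \<in> H \<Longrightarrow> loops `` {h} \<in> Cl"
  unfolding Cl_def by (rule quotientI)

lemma Cl_disjoint: "C \<in> Cl \<Longrightarrow> D \<in> Cl \<Longrightarrow> h \<in> C \<Longrightarrow> h \<in> D \<Longrightarrow> C = D"
  using Cl_class by metis

text \<open>Loops partition the fixed points, and a loop that has any has two. So a factor
  \<open>sqrt 2\<close> at each boundary half-link amounts to a factor 2 per open loop.\<close>

lemma card_fixpts: "card fixpts = 2 * card Op"
proof -
  have "fixpts = (\<Union>C\<in>Op. C \<inter> fixpts)"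
  proof (intro equalityI subsetI)
    fix h assume h: "h \<in> fixpts"
    then have "loops `` {h} \<in> Cl" "h \<in> loops `` {h}" by (auto simp: fixpts_def class_in_Cl)
    then show "h \<in> (\<Union>C\<in>Op. C \<inter> fixpts)" using h unfolding Op_def by blast
  qed auto
  moreover have "card (\<Union>C\<in>Op. C \<inter> fixpts) = (\<Sum>C\<in>Op. card (C \<inter> fixpts))"
  proof (rule card_UN_disjoint)
    show "finite Op" using finite_Cl by (simp add: Op_def)
    show "\<forall>C\<in>Op. finite (C \<inter> fixpts)" using fin by (auto simp: fixpts_def)
    show "\<forall>C\<in>Op. \<forall>D\<in>Op. C \<noteq> D \<longrightarrow> (C \<inter> fixpts) \<inter> (D \<inter> fixpts) = {}"
      using Cl_disjoint by (auto simp: Op_def)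
  qed
  moreover have "(\<Sum>C\<in>Op. card (C \<inter> fixpts)) = (\<Sum>C\<in>Op. 2)"
  proof (rule sum.cong[OF refl])
    fix C assume C: "C \<in> Op"
    then obtain h where h: "h \<in> C" "h \<in> fixpts" by (auto simp: Op_def)
    have "C = loops `` {h}" using C h Cl_class by (auto simp: Op_def)
    then have "C \<inter> fixpts = {k \<in> fixpts. (h, k) \<in> loops}" by auto
    then show "card (C \<inter> fixpts) = 2" using card_fixpts_loop[OF h(2)] by simp
  qed
  ultimately show ?thesis by simp
qed

text \<open>A colouring is given by the set X of half-links of the second colour.\<close>

definition colourings :: "'h set set" where
  "colourings = {X. X \<subseteq> H \<and> (\<forall>h\<in>X. p h \<in> X \<and> s h \<in> X) \<and> X \<inter> fixpts = {}}"

text \<open>A colouring is constant on loops, and a loop with a fixed point is forced to have the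
  first colour; what remains is a free choice for every closed loop.\<close>

lemma colourings_eq: "colourings = Union ` Pow (Cl - Op)"
proof (intro set_eqI iffI)
  fix X assume X: "X \<in> colourings"
  define \<C> where "\<C> = (\<lambda>h. loops `` {h}) ` X"
  have sub: "loops `` {h} \<subseteq> X" if "h \<in> X" for h
    using X that loops_closed[of h _ X] by (auto simp: colourings_def)
  have "X = \<Union>\<C>" using sub by (auto simp: \<C>_def)
  moreover have "\<C> \<in> Pow (Cl - Op)"
    using sub X class_in_Cl by (fastforce simp: \<C>_def Op_def colourings_def)
  ultimately show "X \<in> Union ` Pow (Cl - Op)" by blast
next
  fix X assume "X \<in> Union ` Pow (Cl - Op)"
  then obtain \<C> where C: "\<C> \<subseteq> Cl - Op" "X = \<Union>\<C>" by auto
  have "p h \<in> X \<and> s h \<in> X" if h: "h \<in> X" for h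
  proof -
    obtain D where D: "D \<in> \<C>" "h \<in> D" using h C by auto
    then have "D \<in> Cl" using C by auto
    then have "D = loops `` {h}" "h \<in> H" using D Cl_class Cl_subset by auto
    then have "p h \<in> D" "s h \<in> D" using loops_p loops_s by auto
    then show ?thesis using C D by auto
  qed
  moreover have "X \<subseteq> H" using C Cl_subset by auto
  moreover have "X \<inter> fixpts = {}" using C by (auto simp: Op_def)
  ultimately show "X \<in> colourings" by (auto simp: colourings_def)
qed

lemma inj_on_Union_Cl: "inj_on Union (Pow Cl)"
proof (rule inj_onI)
  have *: "A \<subseteq> B" if AB: "A \<in> Pow Cl" "B \<in> Pow Cl" "\<Union>A = \<Union>B" for A B
  proof
    fix C assume C: "C \<in> A"
    then obtain h where h: "h \<in> C" using Cl_nonempty AB by blast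
    then obtain D where D: "D \<in> B" "h \<in> D" using AB C by blast
    then show "C \<in> B" using Cl_disjoint[of C D h] C h AB by auto
  qed
  fix A B assume "A \<in> Pow Cl" "B \<in> Pow Cl" "\<Union>A = \<Union>B"
  then show "A = B" using * by (intro equalityI) auto
qed

lemma finite_colourings: "finite colourings"
  unfolding colourings_eq using finite_Cl by auto

lemma card_colourings: "card colourings = 2 ^ card (Cl - Op)"
  unfolding colourings_eq
  by (subst card_image) (auto intro!: inj_on_subset[OF inj_on_Union_Cl] simp: card_Pow finite_Cl)

lemma sum_colourings:
  "(\<Sum>X\<in>colourings. sqrt 2 ^ card fixpts) = 2 ^ card Cl"
proof -
  have "card Cl = card Op + card (Cl - Op)"
    using card_Diff_subset[of Op Cl] card_mono[of Cl Op] finite_Cl by (auto simp: Op_def)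
  then show ?thesis
    by (simp add: card_colourings card_fixpts power_mult power_add mult.commute)
qed

text \<open>Recolouring the closed loop through h pairs colourings of opposite sign, whereas on an
  open loop h always has the first colour. This is how the sum over colours detects open
  loops.\<close>

lemma sum_colourings_sign:
  assumes h: "h \<in> H"
  shows "(\<Sum>X\<in>colourings. if h \<in> X then - 1 else 1 :: real) =
    (if loops `` {h} \<in> Op then card colourings else 0)"
proof (cases "loops `` {h} \<in> Op")
  case True
  have "h \<notin> X" if "X \<in> colourings" for X
  proof
    assume hX: "h \<in> X"
    obtain k where k: "(h, k) \<in> loops" "k \<in> fixpts" using True by (auto simp: Op_def)
    have "k \<in> X" by (rule loops_closed[OF k(1) hX]) (use that in \<open>auto simp: colourings_def\<close>)
    then show False using that k by (auto simp: colourings_def)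
  qed
  then show ?thesis using True by simp
next
  case False
  let ?C = "loops `` {h}"
  have C: "?C \<in> Cl - Op" using False class_in_Cl[OF h] by simp
  have sub: "X \<in> colourings \<Longrightarrow> h \<in> X \<Longrightarrow> ?C \<subseteq> X" for X
    using loops_closed[of h _ X] by (auto simp: colourings_def)
  have cl: "p k \<in> ?C" "s k \<in> ?C" "k \<in> H" if "k \<in> ?C" for k
    using that h by (auto intro: loops_trans loops_p loops_s loops_H)
  have inv: "p k \<in> ?C \<Longrightarrow> k \<in> ?C" "s k \<in> ?C \<Longrightarrow> k \<in> ?C" if "k \<in> H" for k
    using cl(1)[of "p k"] cl(2)[of "s k"] pp[OF that] ss[OF that] by simp_all
  have "bij_betw (\<lambda>X. X - ?C) {X\<in>colourings. h \<in> X} {X\<in>colourings. h \<notin> X}"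
  proof (rule bij_betwI[where g="\<lambda>X. X \<union> ?C"])
    show "(\<lambda>X. X - ?C) \<in> {X\<in>colourings. h \<in> X} \<rightarrow> {X\<in>colourings. h \<notin> X}"
    proof
      fix X assume X: "X \<in> {X\<in>colourings. h \<in> X}"
      then have "p k \<in> X - ?C \<and> s k \<in> X - ?C" if "k \<in> X - ?C" for k
        using that inv[of k] unfolding colourings_def by blast
      then show "X - ?C \<in> {X\<in>colourings. h \<notin> X}" using X by (auto simp: colourings_def)
    qed
    show "(\<lambda>X. X \<union> ?C) \<in> {X\<in>colourings. h \<notin> X} \<rightarrow> {X\<in>colourings. h \<in> X}"
    proof
      fix X assume X: "X \<in> {X\<in>colourings. h \<notin> X}"
      have "p k \<in> X \<union> ?C \<and> s k \<in> X \<union> ?C" if "k \<in> X \<union> ?C" for k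
        using that cl[of k] X unfolding colourings_def by blast
      moreover have "?C \<inter> fixpts = {}" using C by (auto simp: Op_def)
      ultimately show "X \<union> ?C \<in> {X\<in>colourings. h \<in> X}" using X cl(3) unfolding colourings_def by auto
    qed
    show "(X - ?C) \<union> ?C = X" if "X \<in> {X\<in>colourings. h \<in> X}" for X
      using that sub by auto
    show "(X \<union> ?C) - ?C = X" if X: "X \<in> {X\<in>colourings. h \<notin> X}" for X
    proof -
      have "h \<in> X" if "k \<in> X" "k \<in> ?C" for k
        by (rule loops_closed[of k h X]) (use X that in \<open>auto simp: colourings_def intro: loops_sym\<close>)
      then show ?thesis using X by auto
    qed
  qed
  then have "card {X\<in>colourings. h \<in> X} = card {X\<in>colourings. h \<notin> X}"
    by (rule bij_betw_same_card)
  moreover have "(\<Sum>X\<in>colourings. if h \<in> X then - 1 else 1 :: real) =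
    - real (card {X\<in>colourings. h \<in> X}) + real (card {X\<in>colourings. h \<notin> X})"
    using finite_colourings by (simp add: sum.If_cases Int_def Collect_neg_eq[symmetric])
  ultimately show ?thesis using False by simp
qed

end

section \<open>Counting matchings\<close>

text \<open>The double factorial (n - 1)!! for even n and 0 for odd n: the number of perfect
  matchings of n points.\<close>

fun odd_fact :: "nat \<Rightarrow> nat" where
  "odd_fact 0 = 1"
| "odd_fact (Suc 0) = 0"
| "odd_fact (Suc (Suc n)) = Suc n * odd_fact n"

text \<open>Perfect matchings within the classes of a labelling; the label will be a site together
  with a colour. The identity off S makes the encoding unique, as in
  \<open>pairing_config\<close>.\<close>

definition matchings :: "'h set \<Rightarrow> ('h \<Rightarrow> 'l) \<Rightarrow> ('h \<Rightarrow> 'h) set" where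
  "matchings S l = {\<sigma>. (\<forall>h. h \<notin> S \<longrightarrow> \<sigma> h = h) \<and>
     (\<forall>h\<in>S. \<sigma> h \<in> S \<and> \<sigma> h \<noteq> h \<and> \<sigma> (\<sigma> h) = h \<and> l (\<sigma> h) = l h)}"

lemma finite_matchings: "finite S \<Longrightarrow> finite (matchings S l)"
proof (rule finite_subset)
  assume S: "finite S"
  show "matchings S l \<subseteq> (\<lambda>f h. if h \<in> S then f h else h) ` (\<Pi>\<^sub>E h\<in>S. S)"
  proof
    fix \<sigma> assume "\<sigma> \<in> matchings S l"
    then have "\<sigma> = (\<lambda>h. if h \<in> S then restrict \<sigma> S h else h)" "restrict \<sigma> S \<in> (\<Pi>\<^sub>E h\<in>S. S)"
      by (auto simp: matchings_def fun_eq_iff)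
    then show "\<sigma> \<in> (\<lambda>f h. if h \<in> S then f h else h) ` (\<Pi>\<^sub>E h\<in>S. S)" by blast
  qed
  show "finite ((\<lambda>f h. if h \<in> S then f h else h) ` (\<Pi>\<^sub>E h\<in>S. S))"
    using S by (intro finite_imageI finite_PiE) auto
qed

lemma card_matchings_pair:
  assumes "a \<in> S" "b \<in> S" "a \<noteq> b" "l a = l b"
  shows "card {\<sigma> \<in> matchings S l. \<sigma> a = b} = card (matchings (S - {a, b}) l)"
proof (rule bij_betw_same_card)
  show "bij_betw (\<lambda>\<sigma>. \<sigma>(a := a, b := b)) {\<sigma> \<in> matchings S l. \<sigma> a = b} (matchings (S - {a, b}) l)"
  proof (rule bij_betwI[where g="\<lambda>\<sigma>. \<sigma>(a := b, b := a)"])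
    show "(\<lambda>\<sigma>. \<sigma>(a := a, b := b)) \<in> {\<sigma> \<in> matchings S l. \<sigma> a = b} \<rightarrow> matchings (S - {a, b}) l"
    proof
      fix \<sigma> assume s: "\<sigma> \<in> {\<sigma> \<in> matchings S l. \<sigma> a = b}"
      have ba: "\<sigma> b = a" using s assms by (auto simp: matchings_def)
      have sa: "\<sigma> a = b" using s by simp
      have sS: "\<sigma> h \<in> S" "\<sigma> h \<noteq> h" "\<sigma> (\<sigma> h) = h" "l (\<sigma> h) = l h" if "h \<in> S" for h
        using s that by (simp_all add: matchings_def)
      have sn: "\<sigma> h \<noteq> a" "\<sigma> h \<noteq> b" if "h \<in> S" "h \<noteq> a" "h \<noteq> b" for h
        using sS(3)[OF that(1)] sa ba that(2,3) by auto
      show "\<sigma>(a := a, b := b) \<in> matchings (S - {a, b}) l"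
        unfolding matchings_def using s by (simp add: sS sn) (simp add: matchings_def)
    qed
    show "(\<lambda>\<sigma>. \<sigma>(a := b, b := a)) \<in> matchings (S - {a, b}) l \<rightarrow> {\<sigma> \<in> matchings S l. \<sigma> a = b}"
    proof
      fix \<sigma> assume s: "\<sigma> \<in> matchings (S - {a, b}) l"
      have sS: "\<sigma> h \<in> S" "\<sigma> h \<noteq> a" "\<sigma> h \<noteq> b" "\<sigma> h \<noteq> h" "\<sigma> (\<sigma> h) = h" "l (\<sigma> h) = l h"
        if "h \<in> S" "h \<noteq> a" "h \<noteq> b" for h
        using s that by (auto simp: matchings_def)
      have so: "\<sigma> h = h" if "h \<notin> S" for h using s that by (simp add: matchings_def)
      show "\<sigma>(a := b, b := a) \<in> {\<sigma> \<in> matchings S l. \<sigma> a = b}"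
        using assms unfolding matchings_def by (auto simp: sS so)
    qed
    show "(\<sigma>(a := a, b := b))(a := b, b := a) = \<sigma>" if "\<sigma> \<in> {\<sigma> \<in> matchings S l. \<sigma> a = b}" for \<sigma>
    proof -
      have "\<sigma> b = a" "\<sigma> a = b" using that assms by (auto simp: matchings_def)
      then show ?thesis by (auto simp: fun_eq_iff)
    qed
    show "(\<sigma>(a := b, b := a))(a := a, b := b) = \<sigma>" if "\<sigma> \<in> matchings (S - {a, b}) l" for \<sigma>
    proof -
      have "\<sigma> b = b" "\<sigma> a = a" using that by (auto simp: matchings_def)
      then show ?thesis by (auto simp: fun_eq_iff)
    qed
  qed
qed

text \<open>A chosen point has \<open>card T - 1\<close> partners in its class T, and removing the
  pair leaves the same problem with two points less. This is the recursion of
  \<open>odd_fact\<close>.\<close>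

lemma card_matchings:
  assumes "finite S" "finite L" "l ` S \<subseteq> L"
  shows "card (matchings S l) = (\<Prod>k\<in>L. odd_fact (card {h\<in>S. l h = k}))"
  using assms(1,3)
proof (induction "card S" arbitrary: S rule: less_induct)
  case less
  show ?case
  proof (cases "S = {}")
    case True
    then have "matchings S l = {id}" by (auto simp: matchings_def fun_eq_iff)
    then show ?thesis using True by simp
  next
    case False
    then obtain a where a: "a \<in> S" by auto
    define T where "T = {h\<in>S. l h = l a}"
    have fT: "finite T" "a \<in> T" using less a by (auto simp: T_def)
    let ?r = "\<Prod>k\<in>L - {l a}. odd_fact (card {h\<in>S. l h = k})"
    have "matchings S l = (\<Union>b\<in>T - {a}. {\<sigma> \<in> matchings S l. \<sigma> a = b})"
      using a by (auto simp: matchings_def T_def)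
    also have "card \<dots> = (\<Sum>b\<in>T - {a}. card {\<sigma> \<in> matchings S l. \<sigma> a = b})"
      by (rule card_UN_disjoint) (use fT less finite_matchings[of S l] in auto)
    also have "\<dots> = (\<Sum>b\<in>T - {a}. odd_fact (card T - 2) * ?r)"
    proof (rule sum.cong[OF refl])
      fix b assume b: "b \<in> T - {a}"
      have "card {\<sigma> \<in> matchings S l. \<sigma> a = b} = card (matchings (S - {a, b}) l)"
        by (rule card_matchings_pair) (use a b in \<open>auto simp: T_def\<close>)
      also have "\<dots> = (\<Prod>k\<in>L. odd_fact (card {h\<in>S - {a, b}. l h = k}))"
      proof (rule less.hyps)
        show "card (S - {a, b}) < card S" using a less by (intro psubset_card_mono) auto
      qed (use less in auto)
      also have "\<dots> = odd_fact (card {h\<in>S - {a, b}. l h = l a}) * (\<Prod>k\<in>L - {l a}. odd_fact (card {h\<in>S - {a, b}. l h = k}))"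
        using less a assms by (subst prod.remove[of _ "l a"]) auto
      also have "{h\<in>S - {a, b}. l h = l a} = T - {a, b}" by (auto simp: T_def)
      also have "card \<dots> = card T - 2"
        using b fT by (subst card_Diff_subset) auto
      also have "(\<Prod>k\<in>L - {l a}. odd_fact (card {h\<in>S - {a, b}. l h = k})) = ?r"
      proof (rule prod.cong[OF refl])
        fix k assume "k \<in> L - {l a}"
        then have "{h\<in>S - {a, b}. l h = k} = {h\<in>S. l h = k}" using b by (auto simp: T_def)
        then show "odd_fact (card {h\<in>S - {a, b}. l h = k}) = odd_fact (card {h\<in>S. l h = k})" by simp
      qed
      finally show "card {\<sigma> \<in> matchings S l. \<sigma> a = b} = odd_fact (card T - 2) * ?r" .
    qed
    also have "\<dots> = (card T - 1) * odd_fact (card T - 2) * ?r" using fT by simp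
    also have "(card T - 1) * odd_fact (card T - 2) = odd_fact (card T)"
    proof -
      have "card T \<noteq> 0" using fT by auto
      then consider "card T = 1" | n where "card T = Suc (Suc n)" by (metis One_nat_def not0_implies_Suc)
      then show ?thesis by cases auto
    qed
    also have "odd_fact (card T) * ?r = (\<Prod>k\<in>L. odd_fact (card {h\<in>S. l h = k}))"
      using less a assms unfolding T_def by (subst (2) prod.remove[of _ "l a"]) auto
    finally show ?thesis .
  qed
qed

section \<open>Moments of the circle\<close>

definition moment :: "nat \<Rightarrow> nat \<Rightarrow> real" where
  "moment a b = (\<integral>z. Re z ^ a * Im z ^ b \<partial>circ)"

lemma integrable_circ:
  fixes f :: "complex \<Rightarrow> real"
  assumes "continuous_on UNIV f"
  shows "integrable circ f"
proof -
  have "compact (sphere (0::complex) 1)" by simp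
  then have "bounded (f ` sphere 0 1)"
    using assms by (intro compact_imp_bounded compact_continuous_image) (auto intro: continuous_on_subset)
  then obtain B where "\<forall>z\<in>sphere 0 1. norm (f z) \<le> B" unfolding bounded_iff by blast
  moreover have "f \<in> borel_measurable circ"
    using measurable_compose[OF measurable_circ_borel borel_measurable_continuous_onI[OF assms]] .
  ultimately show ?thesis by (intro circ.integrable_bounded[where B=B]) auto
qed

lemma moment_add: "moment (a + 2) b + moment a (b + 2) = moment a b"
proof -
  have "moment (a + 2) b + moment a (b + 2) = (\<integral>z. Re z ^ (a+2) * Im z ^ b + Re z ^ a * Im z ^ (b+2) \<partial>circ)"
    unfolding moment_def
    by (rule Bochner_Integration.integral_add[symmetric]; rule integrable_circ) (intro continuous_intros)+
  also have "\<dots> = moment a b" unfolding moment_def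
  proof (rule Bochner_Integration.integral_cong[OF refl])
    fix z assume "z \<in> space circ"
    then have "(Re z)\<^sup>2 + (Im z)\<^sup>2 = 1" using cmod_power2[of z] by simp
    moreover have "Re z ^ (a+2) * Im z ^ b + Re z ^ a * Im z ^ (b+2) = Re z ^ a * Im z ^ b * ((Re z)\<^sup>2 + (Im z)\<^sup>2)"
      by (simp add: power_add power2_eq_square algebra_simps)
    ultimately show "Re z ^ (a+2) * Im z ^ b + Re z ^ a * Im z ^ (b+2) = Re z ^ a * Im z ^ b" by simp
  qed
  finally show ?thesis .
qed

lemma moment_ibp: "real (b + 1) * moment (a + 2) b = real (a + 1) * moment a (b + 2)"
proof -
  let ?g = "\<lambda>z::complex. Re z ^ (a+1) * Im z ^ (b+1)"
  let ?g' = "\<lambda>z. real (b+1) * (Re z ^ (a+2) * Im z ^ b) - real (a+1) * (Re z ^ a * Im z ^ (b+2))"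
  have "integral\<^sup>L circ ?g' = 0"
  proof (rule integral_circ_deriv[where g="?g"])
    fix t
    show "((\<lambda>t. ?g (cis t)) has_real_derivative ?g' (cis t)) (at t)"
      using DERIV_mult[OF DERIV_power_Suc[OF DERIV_cos, of a t] DERIV_power_Suc[OF DERIV_sin, of b t]]
      by (simp add: algebra_simps power2_eq_square)
  qed (intro continuous_intros)
  also have "integral\<^sup>L circ ?g' = real (b + 1) * moment (a + 2) b - real (a + 1) * moment a (b + 2)"
    unfolding moment_def
    by (subst Bochner_Integration.integral_diff)
       (auto intro!: integrable_mult_right integrable_circ continuous_intros)
  finally show ?thesis by simp
qed

text \<open>\<open>moment_add\<close> and \<open>moment_ibp\<close> are two linear equations for
  these two moments of degree a + b + 2.\<close>

lemma moment_Suc2: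
  "moment (Suc (Suc a)) b = real (a + 1) / real (a + b + 2) * moment a b"
  "moment a (Suc (Suc b)) = real (b + 1) / real (a + b + 2) * moment a b"
proof -
  define x y where "x = moment (a + 2) b" and "y = moment a (b + 2)"
  have 1: "moment a b = x + y" using moment_add[of a b] by (simp add: x_def y_def)
  have 2: "real (b + 1) * x = real (a + 1) * y" using moment_ibp[of b a] by (simp add: x_def y_def)
  have "real (a + b + 2) * x = real (a + 1) * (x + y)" using 2 by (simp add: algebra_simps)
  then show "moment (Suc (Suc a)) b = real (a + 1) / real (a + b + 2) * moment a b"
    unfolding 1 by (simp add: x_def field_simps)
  have "real (a + b + 2) * y = real (b + 1) * (x + y)" using 2 by (simp add: algebra_simps)
  then show "moment a (Suc (Suc b)) = real (b + 1) / real (a + b + 2) * moment a b"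
    unfolding 1 by (simp add: y_def field_simps)
qed

lemma moment_deriv_zero:
  "moment 1 0 = 0" "moment 0 1 = 0" "moment 1 1 = 0"
proof -
  have "integral\<^sup>L circ (\<lambda>z. Re z) = 0"
    by (rule integral_circ_deriv[where g=Im]) (auto intro!: continuous_intros derivative_eq_intros)
  then show "moment 1 0 = 0" by (simp add: moment_def)
  have "integral\<^sup>L circ (\<lambda>z. Im z) = 0"
    by (rule integral_circ_deriv[where g="\<lambda>z. - Re z"]) (auto intro!: continuous_intros derivative_eq_intros)
  then show "moment 0 1 = 0" by (simp add: moment_def)
  have "integral\<^sup>L circ (\<lambda>z. Re z * Im z) = 0"
    by (rule integral_circ_deriv[where g="\<lambda>z. (Im z)\<^sup>2 / 2"])
       (auto intro!: continuous_intros derivative_eq_intros simp: algebra_simps)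
  then show "moment 1 1 = 0" by (simp add: moment_def)
qed

lemma odd_fact_odd: "odd n \<Longrightarrow> odd_fact n = 0"
  by (induction n rule: odd_fact.induct) auto

lemma even_half: "even n \<Longrightarrow> real (n + 2) = 2 * real (Suc (n div 2))"
  by (elim evenE) simp

text \<open>One step of the moment recursion. The alternative X = 0 covers odd total degree, where
  \<open>div 2\<close> loses a half but the matching numbers vanish.\<close>

lemma fact_step:
  fixes X c :: real
  assumes "real (n + 2) = 2 * real (Suc k) \<or> X = 0"
  shows "c / real (n + 2) * (X / (2 ^ k * fact k)) = c * X / (2 ^ Suc k * fact (Suc k))"
proof (cases "X = 0")
  case False
  then have "real (n + 2) = 2 * real (Suc k)" using assms by simp
  then show ?thesis
    by (simp only: times_divide_times_eq power_Suc fact_Suc) (simp only: mult_ac)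
qed simp

text \<open>The moment recursion is that of \<open>odd_fact\<close> up to the factor a + b + 2. Thus
  a moment is the number of colour-preserving pairings at one site divided by 2^n n!, and the 1/n!
  is the required site weight.\<close>

lemma moment_eq:
  "moment a b = real (odd_fact a * odd_fact b) / (2 ^ ((a + b) div 2) * fact ((a + b) div 2))"
proof (induction a arbitrary: b rule: odd_fact.induct)
  case 1
  show ?case
  proof (induction b rule: odd_fact.induct)
    case 1 then show ?case by (simp add: moment_def circ.prob_space[simplified])
  next
    case (3 b)
    have "real (b + 2) = 2 * real (Suc (b div 2)) \<or> real (odd_fact b) = 0"
      using even_half[of b] odd_fact_odd[of b] by (cases "even b") auto
    note fs = fact_step[OF this, of "real (b + 1)"]
    have "moment 0 (Suc (Suc b)) = real (b + 1) / real (b + 2) * (real (odd_fact b) / (2 ^ (b div 2) * fact (b div 2)))"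
      using 3 moment_Suc2(2)[of 0 b] by simp
    also note fs
    finally show ?case by (simp add: algebra_simps del: fact_Suc power_Suc)
  qed (use moment_deriv_zero in auto)
next
  case 2
  show ?case
  proof (induction b rule: odd_fact.induct)
    case (3 b)
    then show ?case using moment_Suc2(2)[of "Suc 0" b] by simp
  qed (use moment_deriv_zero in auto)
next
  case (3 a)
  have "real (a + b + 2) = 2 * real (Suc ((a + b) div 2)) \<or> real (odd_fact a * odd_fact b) = 0"
    using even_half[of "a + b"] odd_fact_odd[of a] odd_fact_odd[of b] by (cases "even (a + b)") auto
  note fs = fact_step[OF this, of "real (a + 1)"]
  have "moment (Suc (Suc a)) b = real (a + 1) / real (a + b + 2) *
      (real (odd_fact a * odd_fact b) / (2 ^ ((a + b) div 2) * fact ((a + b) div 2)))"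
    using 3[of b] moment_Suc2(1)[of a b] by simp
  also note fs
  finally show ?case by (simp add: algebra_simps del: fact_Suc power_Suc)
qed

text \<open>Re (z^2) is the difference of the squared coordinates, and \<open>moment_Suc2\<close>
  evaluates both terms. Its denominator a + b + 2 is the origin of n + 1 in the observable.\<close>

lemma moment_square:
  "(\<integral>z. Re (z\<^sup>2) * (Re z ^ a * Im z ^ b) \<partial>circ) =
    (real a - real b) / (2 * (real ((a + b) div 2) + 1)) * moment a b"
proof -
  have "(\<integral>z. Re (z\<^sup>2) * (Re z ^ a * Im z ^ b) \<partial>circ) = (\<integral>z. Re z ^ (a+2) * Im z ^ b - Re z ^ a * Im z ^ (b+2) \<partial>circ)"
    by (intro Bochner_Integration.integral_cong refl)
       (simp add: power2_eq_square times_complex.sel power_add algebra_simps)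
  also have "\<dots> = moment (a+2) b - moment a (b+2)"
    unfolding moment_def
    by (subst Bochner_Integration.integral_diff) (auto intro!: integrable_circ continuous_intros)
  also have "\<dots> = (real a - real b) / real (a + b + 2) * moment a b"
    using moment_Suc2[of a b] by (simp add: diff_divide_distrib algebra_simps add_divide_distrib)
  also have "\<dots> = (real a - real b) / (2 * (real ((a + b) div 2) + 1)) * moment a b"
  proof (cases "even (a + b)")
    case True
    then have "real (a + b + 2) = 2 * (real ((a + b) div 2) + 1)" using even_half[of "a + b"] by simp
    then show ?thesis by (simp only:)
  next
    case False
    then have "moment a b = 0" using odd_fact_odd[of a] odd_fact_odd[of b] by (auto simp: moment_eq)
    then show ?thesis by simp
  qed
  finally show ?thesis .
qed

section \<open>From wires to spins\<close>

lemma infsum_exhaust: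
  fixes f :: "'a \<Rightarrow> real"
  assumes nn: "\<And>x. x \<in> (\<Union>N. A N) \<Longrightarrow> 0 \<le> f x" and fin: "\<And>N. finite (A N)" and inc: "incseq A"
    and lim: "(\<lambda>N. sum f (A N)) \<longlonglongrightarrow> S"
  shows "infsum f (\<Union>N. A N) = S"
proof -
  let ?U = "\<Union>N. A N"
  have mono: "incseq (\<lambda>N. sum f (A N))"
    by (intro incseq_SucI sum_mono2 fin) (use inc nn in \<open>auto simp: incseq_Suc_iff\<close>)
  have ub: "sum f F \<le> S" if F: "finite F" "F \<subseteq> ?U" for F
  proof -
    have "\<exists>N. F \<subseteq> A N" using F
    proof (induction F rule: finite_induct)
      case (insert x F)
      then obtain N M where "F \<subseteq> A N" "x \<in> A M" by auto
      then have "insert x F \<subseteq> A (max N M)"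
        using incseqD[OF inc, of N "max N M"] incseqD[OF inc, of M "max N M"] by auto
      then show ?case by blast
    qed auto
    then obtain N where N: "F \<subseteq> A N" by blast
    have "sum f F \<le> sum f (A N)" by (rule sum_mono2[OF fin N]) (use nn in auto)
    also have "\<dots> \<le> S" by (rule incseq_le[OF mono lim])
    finally show ?thesis .
  qed
  have sm: "f summable_on ?U"
    by (rule nonneg_bdd_above_summable_on) (use nn ub in \<open>auto intro!: bdd_aboveI[of _ S]\<close>)
  have "infsum f ?U \<le> S" by (rule infsum_le_finite_sums[OF sm]) (use ub in auto)
  moreover have "sum f (A N) \<le> infsum f ?U" for N
    by (rule finite_sum_le_infsum[OF sm fin]) (use nn in auto)
  then have "S \<le> infsum f ?U" using LIMSEQ_le_const2[OF lim] by blast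
  ultimately show ?thesis by simp
qed

lemma other_end_eq: "x \<noteq> y \<Longrightarrow> other_end {x, y} x = y"
  unfolding other_end_def by (rule the_equality) (auto simp: doubleton_eq_iff)

text \<open>The involution is a perfect matching of S, but the number of matchings vanishes for odd
  cardinality.\<close>

lemma even_card_involution:
  assumes "finite S" "\<And>h. h \<in> S \<Longrightarrow> f h \<in> S \<and> f h \<noteq> h \<and> f (f h) = h"
  shows "even (card S)"
proof (rule ccontr)
  assume "\<not> ?thesis"
  then have o: "odd (card S)" by simp
  have "card (matchings S (\<lambda>_. ())) = (\<Prod>k\<in>{()}. odd_fact (card {h\<in>S. () = k}))"
    by (rule card_matchings) (use assms(1) in auto)
  also have "\<dots> = 0" using odd_fact_odd[OF o] by simp
  finally have "matchings S (\<lambda>_. ()) = {}" using finite_matchings[OF assms(1), of "\<lambda>_. ()"] by simp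
  moreover have "(\<lambda>h. if h \<in> S then f h else h) \<in> matchings S (\<lambda>_. ())"
    unfolding matchings_def by (simp add: assms(2))
  ultimately show False by blast
qed

locale wire_graph =
  fixes V :: "site set" and E :: "edge set" and a :: site
  assumes finV: "finite V" and finE: "finite E" and aV: "a \<in> V"
    and edge: "e \<in> E \<Longrightarrow> e = {src e, tgt e} \<and> src e \<noteq> tgt e"
begin

lemma other_end_src: "e \<in> E \<Longrightarrow> other_end e (src e) = tgt e"
  and other_end_tgt: "e \<in> E \<Longrightarrow> other_end e (tgt e) = src e"
  using edge[of e] other_end_eq[of "src e" "tgt e"] other_end_eq[of "tgt e" "src e"]
  by (metis, metis insert_commute)

lemma edge_cases: "e \<in> E \<Longrightarrow> x \<in> e \<Longrightarrow> x = src e \<or> x = tgt e"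
  using edge[of e] by blast

lemma src_tgt_in: "e \<in> E \<Longrightarrow> src e \<in> e" "e \<in> E \<Longrightarrow> tgt e \<in> e"
  using edge[of e] by blast+

definition links :: "(edge \<Rightarrow> nat) \<Rightarrow> (edge \<times> nat) set" where
  "links m = Sigma E (\<lambda>e. {..<m e})"

definition ends :: "(edge \<times> nat) set \<Rightarrow> hlink set" where
  "ends Y = {(e, i, x). (e, i) \<in> Y \<and> x \<in> e}"

definition pairings :: "(edge \<Rightarrow> nat) \<Rightarrow> (hlink \<Rightarrow> hlink) set" where
  "pairings m = {\<sigma>. pairing_config V E m \<sigma>}"

definition inner :: "(edge \<Rightarrow> nat) \<Rightarrow> hlink set" where
  "inner m = {h \<in> half_links E m. hsite h \<in> V}"

definition bdry :: "(edge \<Rightarrow> nat) \<Rightarrow> hlink set" where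
  "bdry m = {h \<in> half_links E m. hsite h \<notin> V}"

lemma finite_links: "finite (links m)"
  using finE by (auto simp: links_def)

lemma half_links_ends: "half_links E m = ends (links m)"
  by (auto simp: half_links_def ends_def links_def)

lemma ends_eq: "Y \<subseteq> links m \<Longrightarrow> ends Y = (\<Union>l\<in>Y. {(fst l, snd l, src (fst l)), (fst l, snd l, tgt (fst l))})"
proof -
  assume Y: "Y \<subseteq> links m"
  have "ends Y = (\<Union>l\<in>Y. (\<lambda>x. (fst l, snd l, x)) ` fst l)" by (force simp: ends_def)
  also have "\<dots> = (\<Union>l\<in>Y. {(fst l, snd l, src (fst l)), (fst l, snd l, tgt (fst l))})"
  proof (rule SUP_cong[OF refl])
    fix l assume "l \<in> Y"
    then have "fst l \<in> E" using Y by (auto simp: links_def)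
    then have "fst l = {src (fst l), tgt (fst l)}" using edge by blast
    from arg_cong[OF this, of "image (\<lambda>x. (fst l, snd l, x))"]
    show "(\<lambda>x. (fst l, snd l, x)) ` fst l = {(fst l, snd l, src (fst l)), (fst l, snd l, tgt (fst l))}"
      by simp
  qed
  finally show ?thesis .
qed

lemma finite_ends: "Y \<subseteq> links m \<Longrightarrow> finite (ends Y)"
  using finite_subset[OF _ finite_links] by (auto simp: ends_eq)

lemma finite_half_links: "finite (half_links E m)"
  unfolding half_links_ends by (rule finite_ends[OF subset_refl])

lemma prod_ends:
  assumes Y: "Y \<subseteq> links m"
  shows "(\<Prod>h\<in>ends Y. f (hsite h)) = (\<Prod>l\<in>Y. f (src (fst l)) * f (tgt (fst l)))"
proof -
  have "(\<Prod>h\<in>ends Y. f (hsite h)) = (\<Prod>l\<in>Y. \<Prod>h\<in>{(fst l, snd l, src (fst l)), (fst l, snd l, tgt (fst l))}. f (hsite h))"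
    unfolding ends_eq[OF Y]
    by (rule prod.UNION_disjoint) (use finite_subset[OF Y finite_links] in \<open>auto simp: prod_eq_iff\<close>)
  also have "\<dots> = (\<Prod>l\<in>Y. f (src (fst l)) * f (tgt (fst l)))"
    by (rule prod.cong[OF refl]) (use Y edge in \<open>auto simp: links_def hsite_def\<close>)
  finally show ?thesis .
qed

lemma card_half_links: "card (half_links E m) = 2 * sum m E"
proof -
  have "card (half_links E m) = (\<Sum>l\<in>links m. card {(fst l, snd l, src (fst l)), (fst l, snd l, tgt (fst l))})"
    unfolding half_links_ends ends_eq[OF subset_refl]
    by (rule card_UN_disjoint) (use finite_links in \<open>auto simp: prod_eq_iff\<close>)
  also have "\<dots> = (\<Sum>l\<in>links m. 2)"
    by (rule sum.cong[OF refl]) (use edge in \<open>auto simp: links_def\<close>)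
  also have "\<dots> = 2 * sum m E" using finE by (simp add: links_def)
  finally show ?thesis .
qed

lemma card_half_links_site: "card {h \<in> half_links E m. hsite h = x} = deg E m x"
proof -
  have "bij_betw (\<lambda>(e, i). (e, i, x)) (Sigma {e\<in>E. x \<in> e} (\<lambda>e. {..<m e})) {h \<in> half_links E m. hsite h = x}"
    by (rule bij_betwI[where g="\<lambda>(e, i, y). (e, i)"]) (auto simp: half_links_def hsite_def)
  then have "card {h \<in> half_links E m. hsite h = x} = card (Sigma {e\<in>E. x \<in> e} (\<lambda>e. {..<m e}))"
    using bij_betw_same_card by fastforce
  also have "\<dots> = deg E m x" using finE by (simp add: deg_def)
  finally show ?thesis .
qed

lemma link_partner_props:
  assumes "h \<in> half_links E m"
  shows "link_partner h \<in> half_links E m" "link_partner (link_partner h) = h" "link_partner h \<noteq> h"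
    and "fst (link_partner h) = fst h" "fst (snd (link_partner h)) = fst (snd h)"
proof -
  obtain e i x where h: "h = (e, i, x)" by (cases h)
  then have e: "e \<in> E" "i < m e" "x \<in> e" using assms by (auto simp: half_links_def)
  from edge_cases[OF e(1,3)] edge[OF e(1)] src_tgt_in[OF e(1)] other_end_src[OF e(1)] other_end_tgt[OF e(1)]
  show "link_partner h \<in> half_links E m" "link_partner (link_partner h) = h" "link_partner h \<noteq> h"
    "fst (link_partner h) = fst h" "fst (snd (link_partner h)) = fst (snd h)"
    using e unfolding h by (auto simp: link_partner_def half_links_def)
qed

lemma pairing_props:
  assumes "\<sigma> \<in> pairings m"
  shows "h \<in> inner m \<Longrightarrow> \<sigma> h \<in> inner m" "h \<in> inner m \<Longrightarrow> \<sigma> h \<noteq> h"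
    "h \<in> inner m \<Longrightarrow> hsite (\<sigma> h) = hsite h" "h \<in> inner m \<Longrightarrow> \<sigma> (\<sigma> h) = h"
    "h \<notin> inner m \<Longrightarrow> \<sigma> h = h"
proof -
  have AB: "(\<forall>h. (h \<notin> half_links E m \<or> hsite h \<notin> V) \<longrightarrow> \<sigma> h = h) \<and>
     (\<forall>h\<in>half_links E m. hsite h \<in> V \<longrightarrow>
        \<sigma> h \<in> half_links E m \<and> \<sigma> h \<noteq> h \<and> hsite (\<sigma> h) = hsite h \<and> \<sigma> (\<sigma> h) = h)"
    using assms unfolding pairings_def pairing_config_def mem_Collect_eq .
  have out: "h \<notin> half_links E m \<or> hsite h \<notin> V \<Longrightarrow> \<sigma> h = h" for h
    by (rule conjunct1[OF AB, rule_format])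
  have inn: "\<sigma> h \<in> half_links E m \<and> \<sigma> h \<noteq> h \<and> hsite (\<sigma> h) = hsite h \<and> \<sigma> (\<sigma> h) = h"
    if "h \<in> half_links E m" "hsite h \<in> V" for h
    by (rule conjunct2[OF AB, rule_format, OF that])
  show "h \<notin> inner m \<Longrightarrow> \<sigma> h = h" using out[of h] by (auto simp only: inner_def mem_Collect_eq)
  assume "h \<in> inner m"
  then have h: "h \<in> half_links E m" "hsite h \<in> V" by (simp_all add: inner_def)
  from inn[OF h] h(2) show "\<sigma> h \<in> inner m" "\<sigma> h \<noteq> h" "hsite (\<sigma> h) = hsite h" "\<sigma> (\<sigma> h) = h"
    by (simp_all add: inner_def)
qed

lemma half_links_cases: "h \<in> half_links E m \<Longrightarrow> h \<in> inner m \<or> h \<in> bdry m \<and> h \<notin> inner m"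
  by (auto simp: inner_def bdry_def)

lemma two_involutions:
  assumes "\<sigma> \<in> pairings m"
  shows "two_involutions (half_links E m) link_partner \<sigma>"
proof
  fix h assume h: "h \<in> half_links E m"
  show "\<sigma> h \<in> half_links E m" "\<sigma> (\<sigma> h) = h"
    using half_links_cases[OF h] pairing_props[OF assms, of h] h by (auto simp: inner_def)
  show "link_partner h \<in> half_links E m" "link_partner (link_partner h) = h" "link_partner h \<noteq> h"
    by (rule link_partner_props[OF h])+
qed (rule finite_half_links)

lemma fixpts_eq:
  assumes "\<sigma> \<in> pairings m"
  shows "two_involutions.fixpts (half_links E m) \<sigma> = bdry m"
proof -
  interpret two_involutions "half_links E m" link_partner \<sigma> by (rule two_involutions[OF assms])
  show ?thesis using pairing_props[OF assms] by (auto simp: fixpts_def bdry_def inner_def)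
qed

lemma loop_equiv_eq:
  assumes "\<sigma> \<in> pairings m"
  shows "loop_equiv E (m, \<sigma>) = two_involutions.loops (half_links E m) link_partner \<sigma>"
proof -
  interpret two_involutions "half_links E m" link_partner \<sigma> by (rule two_involutions[OF assms])
  show ?thesis by (simp add: loop_equiv_def loops_def step_def Let_def)
qed

lemma num_loops_eq:
  assumes "\<sigma> \<in> pairings m"
  shows "num_loops E (m, \<sigma>) = card (two_involutions.Cl (half_links E m) link_partner \<sigma>)"
proof -
  interpret two_involutions "half_links E m" link_partner \<sigma> by (rule two_involutions[OF assms])
  show ?thesis by (simp add: num_loops_def Cl_def loop_equiv_eq[OF assms])
qed

definition open_at :: "(edge \<Rightarrow> nat) \<Rightarrow> (hlink \<Rightarrow> hlink) \<Rightarrow> hlink set" where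
  "open_at m \<sigma> = {h \<in> half_links E m. hsite h = a \<and> on_open_loop V E (m, \<sigma>) h}"

lemma on_open_loop_iff:
  assumes s: "\<sigma> \<in> pairings m" and h: "h \<in> half_links E m"
  shows "on_open_loop V E (m, \<sigma>) h \<longleftrightarrow>
    two_involutions.loops (half_links E m) link_partner \<sigma> `` {h} \<in> two_involutions.Op (half_links E m) link_partner \<sigma>"
proof -
  interpret two_involutions "half_links E m" link_partner \<sigma> by (rule two_involutions[OF s])
  show ?thesis
    using class_in_Cl[OF h] fixpts_eq[OF s]
    by (auto simp: on_open_loop_def loop_equiv_eq[OF s] Op_def bdry_def)
qed

lemma card_open_at:
  assumes s: "\<sigma> \<in> pairings m"
  shows "card (open_at m \<sigma>) = 2 * n_open V E (m, \<sigma>) a"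
proof -
  interpret two_involutions "half_links E m" link_partner \<sigma> by (rule two_involutions[OF s])
  have "even (card (open_at m \<sigma>))"
  proof (rule even_card_involution[where f=\<sigma>])
    show "finite (open_at m \<sigma>)" using finite_half_links by (auto simp: open_at_def)
    fix h assume h: "h \<in> open_at m \<sigma>"
    then have hi: "h \<in> inner m" "h \<in> half_links E m" using aV by (auto simp: open_at_def inner_def)
    have "\<sigma> h \<in> half_links E m" using sH hi by blast
    moreover have "on_open_loop V E (m, \<sigma>) (\<sigma> h)"
    proof -
      obtain k where "(h, k) \<in> loops" "k \<in> half_links E m" "hsite k \<notin> V"
        using h unfolding open_at_def on_open_loop_def loop_equiv_eq[OF s] by auto
      then show ?thesis
        using loops_trans[OF loops_sym[OF loops_s[OF hi(2)]]]
        unfolding on_open_loop_def loop_equiv_eq[OF s] fst_conv by blast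
    qed
    ultimately show "\<sigma> h \<in> open_at m \<sigma> \<and> \<sigma> h \<noteq> h \<and> \<sigma> (\<sigma> h) = h"
      using h hi pairing_props[OF s, of h] by (auto simp: open_at_def)
  qed
  then show ?thesis by (simp add: n_open_def open_at_def)
qed

text \<open>Candidates for the second colour before a pairing is chosen, which allows the sums over
  colours and over pairings to be exchanged.\<close>

definition saturated :: "(edge \<Rightarrow> nat) \<Rightarrow> hlink set set" where
  "saturated m = {X. X \<subseteq> half_links E m \<and> (\<forall>h\<in>X. link_partner h \<in> X) \<and> X \<inter> bdry m = {}}"

abbreviation cols :: "(edge \<Rightarrow> nat) \<Rightarrow> (hlink \<Rightarrow> hlink) \<Rightarrow> hlink set set" where
  "cols m \<sigma> \<equiv> two_involutions.colourings (half_links E m) link_partner \<sigma>"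

lemma cols_eq:
  assumes s: "\<sigma> \<in> pairings m"
  shows "cols m \<sigma> = {X \<in> saturated m. \<forall>h\<in>X. \<sigma> h \<in> X}"
proof -
  interpret two_involutions "half_links E m" link_partner \<sigma> by (rule two_involutions[OF s])
  show ?thesis unfolding colourings_def saturated_def fixpts_eq[OF s] by auto
qed

lemma finite_saturated: "finite (saturated m)"
  using finite_half_links by (auto simp: saturated_def intro: finite_subset[where B="Pow (half_links E m)"])

text \<open>Compatibility with X only asks the pairing to respect the classes given by site and
  colour, so that \<open>card_matchings\<close> counts the compatible pairings.\<close>

lemma pairings_matchings:
  assumes X: "X \<in> saturated m"
  shows "{\<sigma> \<in> pairings m. X \<in> cols m \<sigma>} = matchings (inner m) (\<lambda>h. (hsite h, h \<in> X))"
proof (intro set_eqI iffI)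
  fix \<sigma> assume "\<sigma> \<in> {\<sigma> \<in> pairings m. X \<in> cols m \<sigma>}"
  then have s: "\<sigma> \<in> pairings m" and "X \<in> cols m \<sigma>" by auto
  then have c: "\<forall>h\<in>X. \<sigma> h \<in> X" by (simp add: cols_eq)
  show "\<sigma> \<in> matchings (inner m) (\<lambda>h. (hsite h, h \<in> X))"
    unfolding matchings_def
  proof (intro CollectI conjI allI impI ballI)
    fix h assume h: "h \<in> inner m"
    note p = pairing_props[OF s, of h]
    show "\<sigma> h \<in> inner m" "\<sigma> h \<noteq> h" "\<sigma> (\<sigma> h) = h" using p h by auto
    have "\<sigma> h \<in> X \<longleftrightarrow> h \<in> X" using c p(4)[OF h] by metis
    then show "(hsite (\<sigma> h), \<sigma> h \<in> X) = (hsite h, h \<in> X)" using p(3)[OF h] by simp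
  qed (use pairing_props(5)[OF s] in auto)
next
  fix \<sigma> assume m: "\<sigma> \<in> matchings (inner m) (\<lambda>h. (hsite h, h \<in> X))"
  have s: "\<sigma> \<in> pairings m"
    using m unfolding pairings_def pairing_config_def matchings_def inner_def by auto
  have "\<sigma> h \<in> X" if "h \<in> X" for h
  proof -
    have "h \<in> inner m" using X that by (auto simp: saturated_def inner_def bdry_def)
    then show ?thesis using m that by (auto simp: matchings_def)
  qed
  then have "X \<in> cols m \<sigma>" using cols_eq[OF s] X by simp
  then show "\<sigma> \<in> {\<sigma> \<in> pairings m. X \<in> cols m \<sigma>}" using s by simp
qed

definition n1 :: "(edge \<Rightarrow> nat) \<Rightarrow> hlink set \<Rightarrow> site \<Rightarrow> nat" where
  "n1 m X x = card {h \<in> half_links E m - X. hsite h = x}"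

definition n2 :: "hlink set \<Rightarrow> site \<Rightarrow> nat" where
  "n2 X x = card {h \<in> X. hsite h = x}"

lemma n1_n2: "X \<subseteq> half_links E m \<Longrightarrow> n1 m X x + n2 X x = deg E m x"
  unfolding n1_def n2_def card_half_links_site[symmetric]
  by (subst card_Un_disjoint[symmetric])
     (auto intro!: arg_cong[where f=card] intro: finite_subset[OF _ finite_half_links])

lemma card_pairings_col:
  assumes X: "X \<in> saturated m"
  shows "card {\<sigma> \<in> pairings m. X \<in> cols m \<sigma>} = (\<Prod>x\<in>V. odd_fact (n1 m X x) * odd_fact (n2 X x))"
proof -
  have sub: "X \<subseteq> half_links E m" "X \<inter> bdry m = {}" using X by (auto simp: saturated_def)
  have "card {\<sigma> \<in> pairings m. X \<in> cols m \<sigma>} =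
    (\<Prod>k\<in>V \<times> {False, True}. odd_fact (card {h\<in>inner m. (hsite h, h \<in> X) = k}))"
    unfolding pairings_matchings[OF X]
    by (rule card_matchings) (use finite_half_links finV in \<open>auto simp: inner_def\<close>)
  also have "\<dots> = (\<Prod>x\<in>V. odd_fact (card {h\<in>inner m. (hsite h, h \<in> X) = (x, False)})
      * odd_fact (card {h\<in>inner m. (hsite h, h \<in> X) = (x, True)}))"
    by (subst prod.cartesian_product') simp
  also have "\<dots> = (\<Prod>x\<in>V. odd_fact (n1 m X x) * odd_fact (n2 X x))"
  proof (rule prod.cong[OF refl])
    fix x assume x: "x \<in> V"
    have "{h\<in>inner m. (hsite h, h \<in> X) = (x, False)} = {h \<in> half_links E m - X. hsite h = x}"
      "{h\<in>inner m. (hsite h, h \<in> X) = (x, True)} = {h \<in> X. hsite h = x}"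
      using x sub by (auto simp: inner_def)
    then show "odd_fact (card {h\<in>inner m. (hsite h, h \<in> X) = (x, False)})
      * odd_fact (card {h\<in>inner m. (hsite h, h \<in> X) = (x, True)}) = odd_fact (n1 m X x) * odd_fact (n2 X x)"
      by (simp only: n1_def n2_def)
  qed
  finally show ?thesis .
qed

lemma ends_bij: "bij_betw ends (Pow (links m)) {X. X \<subseteq> half_links E m \<and> (\<forall>h\<in>X. link_partner h \<in> X)}"
proof (rule bij_betwI[where g="\<lambda>X. {(e, i). \<exists>x. (e, i, x) \<in> X}"])
  show "ends \<in> Pow (links m) \<rightarrow> {X. X \<subseteq> half_links E m \<and> (\<forall>h\<in>X. link_partner h \<in> X)}"
  proof
    fix Y assume Y: "Y \<in> Pow (links m)"
    then have sub: "ends Y \<subseteq> half_links E m" by (auto simp: half_links_ends ends_def)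
    have "link_partner h \<in> ends Y" if h: "h \<in> ends Y" for h
    proof -
      note p = link_partner_props[OF subsetD[OF sub h]]
      obtain e i x where h': "h = (e, i, x)" by (cases h)
      obtain y where "link_partner h = (e, i, y)" using p(4,5) h' by (cases "link_partner h") auto
      then show ?thesis using h h' p(1) by (auto simp: ends_def half_links_def)
    qed
    then show "ends Y \<in> {X. X \<subseteq> half_links E m \<and> (\<forall>h\<in>X. link_partner h \<in> X)}" using sub by simp
  qed
  show "(\<lambda>X. {(e, i). \<exists>x. (e, i, x) \<in> X}) \<in> {X. X \<subseteq> half_links E m \<and> (\<forall>h\<in>X. link_partner h \<in> X)} \<rightarrow> Pow (links m)"
    by (auto simp: half_links_def links_def)
  show "{(e, i). \<exists>x. (e, i, x) \<in> ends Y} = Y" if "Y \<in> Pow (links m)" for Y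
  proof -
    have "\<exists>x. x \<in> e" if "(e, i) \<in> Y" for e i
      using src_tgt_in[of e] that \<open>Y \<in> Pow (links m)\<close> by (auto simp: links_def)
    then show ?thesis by (auto simp: ends_def)
  qed
  show "ends {(e, i). \<exists>x. (e, i, x) \<in> X} = X"
    if X: "X \<in> {X. X \<subseteq> half_links E m \<and> (\<forall>h\<in>X. link_partner h \<in> X)}" for X
  proof (intro set_eqI iffI)
    fix h assume "h \<in> ends {(e, i). \<exists>x. (e, i, x) \<in> X}"
    then obtain e i x y where h: "h = (e, i, y)" "(e, i, x) \<in> X" "y \<in> e" by (auto simp: ends_def)
    then have e: "e \<in> E" "x \<in> e" using X by (auto simp: half_links_def)
    have "link_partner (e, i, x) \<in> X" using X h by blast
    then have "(e, i, other_end e x) \<in> X" by (simp add: link_partner_def)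
    moreover have "y = x \<or> y = other_end e x"
      using edge_cases[OF e] edge_cases[OF e(1) h(3)] other_end_src[OF e(1)] other_end_tgt[OF e(1)] by auto
    ultimately show "h \<in> X" using h by auto
  qed (use X in \<open>auto simp: ends_def half_links_def\<close>)
qed

lemma prod_by_site:
  fixes f :: "site \<Rightarrow> real"
  assumes "finite X" "\<And>h. h \<in> X \<Longrightarrow> hsite h \<notin> V \<Longrightarrow> f (hsite h) = 1"
  shows "(\<Prod>h\<in>X. f (hsite h)) = (\<Prod>x\<in>V. f x ^ card {h\<in>X. hsite h = x})"
proof -
  let ?X = "{h\<in>X. hsite h \<in> V}"
  have "(\<Prod>h\<in>X. f (hsite h)) = (\<Prod>h\<in>?X. f (hsite h))"
    by (rule prod.mono_neutral_right) (use assms in auto)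
  also have "\<dots> = (\<Prod>x\<in>V. \<Prod>h\<in>{h\<in>?X. hsite h = x}. f (hsite h))"
    by (rule prod.group[symmetric]) (use assms finV in auto)
  also have "\<dots> = (\<Prod>x\<in>V. f x ^ card {h\<in>X. hsite h = x})"
  proof (rule prod.cong[OF refl])
    fix x assume "x \<in> V"
    then have "{h\<in>?X. hsite h = x} = {h\<in>X. hsite h = x}" by auto
    then show "(\<Prod>h\<in>{h\<in>?X. hsite h = x}. f (hsite h)) = f x ^ card {h\<in>X. hsite h = x}" by simp
  qed
  finally show ?thesis .
qed

text \<open>The cosine on a link is a sum of two products, one per colour; the links chosen for the
  second colour are recorded by the set X of their ends. Boundary spins have imaginary part 0, which
  removes every X that touches the boundary.\<close>

lemma edge_power_expand:
  "(\<Prod>e\<in>E. Re (edge_char V e z) ^ m e) =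
    (\<Sum>X\<in>saturated m. \<Prod>x\<in>V. Re (z x) ^ n1 m X x * Im (z x) ^ n2 X x)"
proof -
  let ?R = "\<lambda>x. Re (spin V z x)" and ?I = "\<lambda>x. Im (spin V z x)"
  let ?F = "\<lambda>X. (\<Prod>h\<in>X. ?I (hsite h)) * (\<Prod>h\<in>half_links E m - X. ?R (hsite h))"
  have "(\<Prod>e\<in>E. Re (edge_char V e z) ^ m e) = (\<Prod>l\<in>links m. Re (edge_char V (fst l) z))"
  proof -
    have "(\<Prod>e\<in>E. Re (edge_char V e z) ^ m e) = (\<Prod>e\<in>E. \<Prod>i\<in>{..<m e}. Re (edge_char V e z))" by simp
    also have "\<dots> = (\<Prod>(e, i)\<in>Sigma E (\<lambda>e. {..<m e}). Re (edge_char V e z))"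
      by (rule prod.Sigma) (use finE in auto)
    finally show ?thesis by (simp add: links_def split_beta)
  qed
  also have "\<dots> = (\<Prod>l\<in>links m. ?I (src (fst l)) * ?I (tgt (fst l)) + ?R (src (fst l)) * ?R (tgt (fst l)))"
    by (simp add: edge_char_def mult_Re_identities(3) add.commute)
  also have "\<dots> = (\<Sum>Y\<in>Pow (links m). (\<Prod>l\<in>Y. ?I (src (fst l)) * ?I (tgt (fst l))) *
      (\<Prod>l\<in>links m - Y. ?R (src (fst l)) * ?R (tgt (fst l))))"
    by (rule prod_add[OF finite_links])
  also have "\<dots> = (\<Sum>Y\<in>Pow (links m). ?F (ends Y))"
  proof (rule sum.cong[OF refl])
    fix Y assume "Y \<in> Pow (links m)"
    then have Y: "Y \<subseteq> links m" "links m - Y \<subseteq> links m" by auto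
    have "half_links E m - ends Y = ends (links m - Y)" by (auto simp: half_links_ends ends_def)
    then show "(\<Prod>l\<in>Y. ?I (src (fst l)) * ?I (tgt (fst l))) * (\<Prod>l\<in>links m - Y. ?R (src (fst l)) * ?R (tgt (fst l))) = ?F (ends Y)"
      using prod_ends[OF Y(1), of ?I] prod_ends[OF Y(2), of ?R] by simp
  qed
  also have "\<dots> = (\<Sum>X\<in>{X. X \<subseteq> half_links E m \<and> (\<forall>h\<in>X. link_partner h \<in> X)}. ?F X)"
    by (rule sum.reindex_bij_betw[OF ends_bij])
  also have "\<dots> = (\<Sum>X\<in>saturated m. ?F X)"
  proof (rule sum.mono_neutral_right)
    show "finite {X. X \<subseteq> half_links E m \<and> (\<forall>h\<in>X. link_partner h \<in> X)}"
      by (rule finite_subset[where B="Pow (half_links E m)"]) (use finite_half_links in auto)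
    show "\<forall>X\<in>{X. X \<subseteq> half_links E m \<and> (\<forall>h\<in>X. link_partner h \<in> X)} - saturated m. ?F X = 0"
    proof
      fix X assume X: "X \<in> {X. X \<subseteq> half_links E m \<and> (\<forall>h\<in>X. link_partner h \<in> X)} - saturated m"
      then obtain h where "h \<in> X" "h \<in> bdry m" by (auto simp: saturated_def)
      then have "\<exists>h\<in>X. ?I (hsite h) = 0" by (auto simp: bdry_def spin_def intro!: bexI[of _ h])
      moreover have "finite X" using X finite_half_links finite_subset by blast
      ultimately have "(\<Prod>h\<in>X. ?I (hsite h)) = 0" by (simp add: prod_zero_iff)
      then show "?F X = 0" by simp
    qed
  qed (auto simp: saturated_def)
  also have "\<dots> = (\<Sum>X\<in>saturated m. \<Prod>x\<in>V. Re (z x) ^ n1 m X x * Im (z x) ^ n2 X x)"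
  proof (rule sum.cong[OF refl])
    fix X assume X: "X \<in> saturated m"
    have "(\<Prod>h\<in>X. ?I (hsite h)) = (\<Prod>x\<in>V. ?I x ^ card {h\<in>X. hsite h = x})"
      by (rule prod_by_site) (use X finite_half_links finite_subset in \<open>auto simp: saturated_def bdry_def\<close>)
    moreover have "(\<Prod>h\<in>half_links E m - X. ?R (hsite h)) = (\<Prod>x\<in>V. ?R x ^ card {h\<in>half_links E m - X. hsite h = x})"
      by (rule prod_by_site) (use finite_half_links in \<open>auto simp: spin_def\<close>)
    ultimately show "?F X = (\<Prod>x\<in>V. Re (z x) ^ n1 m X x * Im (z x) ^ n2 X x)"
      by (simp add: n1_def n2_def spin_def prod.distrib[symmetric] mult.commute)
  qed
  finally show ?thesis .
qed

lemma finite_pairings: "finite (pairings m)"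
proof (rule finite_subset)
  show "pairings m \<subseteq> matchings (inner m) (\<lambda>_. ())"
    using pairing_props by (auto simp: matchings_def)
  show "finite (matchings (inner m) (\<lambda>_. ()))"
    by (rule finite_matchings) (use finite_half_links in \<open>simp add: inner_def\<close>)
qed

text \<open>The function g of the spin at a is 1 for the partition function and \<open>cos 2\<theta>\<close> for the numerator;
  inserting it multiplies the moments at a by \<open>\<kappa>\<close>.\<close>

lemma integral_edge_powers:
  assumes g: "continuous_on UNIV g"
    and \<kappa>: "\<And>i j. (\<integral>z. g z * (Re z ^ i * Im z ^ j) \<partial>circ) = \<kappa> i j * moment i j"
  shows "(\<integral>z. g (z a) * (\<Prod>e\<in>E. (2 * Re (edge_char V e z)) ^ m e) \<partial>spins V) =
    (\<Sum>\<sigma>\<in>pairings m. (\<Prod>x\<in>V. 1 / fact (n_site E m x)) *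
       (\<Sum>X\<in>cols m \<sigma>. \<kappa> (n1 m X a) (n2 X a) * sqrt 2 ^ card (bdry m)))"
proof -
  let ?G = "\<lambda>X x \<zeta>. (if x = a then g \<zeta> else 1) * (Re \<zeta> ^ n1 m X x * Im \<zeta> ^ n2 X x)"
  have Gc: "continuous_on UNIV (?G X x)" for X x
    using g by (cases "x = a") (auto intro!: continuous_intros)
  have Gi: "integrable circ (?G X x)" for X x by (rule integrable_circ[OF Gc])
  have G: "(\<integral>\<zeta>. ?G X x \<zeta> \<partial>circ) = (if x = a then \<kappa> (n1 m X a) (n2 X a) else 1) * moment (n1 m X x) (n2 X x)" for X x
    using \<kappa>[of "n1 m X a" "n2 X a"] by (auto simp: moment_def)
  have ex: "g (z a) * (\<Prod>e\<in>E. (2 * Re (edge_char V e z)) ^ m e) = 2 ^ sum m E * (\<Sum>X\<in>saturated m. \<Prod>x\<in>V. ?G X x (z x))" for z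
  proof -
    have "(\<Prod>x\<in>V. ?G X x (z x)) = g (z a) * (\<Prod>x\<in>V. Re (z x) ^ n1 m X x * Im (z x) ^ n2 X x)" for X
      using finV aV by (simp add: prod.distrib prod.delta)
    moreover have "(\<Prod>e\<in>E. (2 * Re (edge_char V e z)) ^ m e) = 2 ^ sum m E * (\<Prod>e\<in>E. Re (edge_char V e z) ^ m e)"
      by (simp add: power_mult_distrib prod.distrib power_sum)
    ultimately show ?thesis by (simp add: edge_power_expand sum_distrib_left mult_ac)
  qed
  have int: "integrable (spins V) (\<lambda>z. \<Prod>x\<in>V. ?G X x (z x))" for X
    unfolding spins_def by (rule circs.product_integrable_prod[OF finV Gi])
  have "(\<integral>z. g (z a) * (\<Prod>e\<in>E. (2 * Re (edge_char V e z)) ^ m e) \<partial>spins V) =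
      2 ^ sum m E * (\<Sum>X\<in>saturated m. \<integral>z. (\<Prod>x\<in>V. ?G X x (z x)) \<partial>spins V)"
    unfolding ex by (subst integral_mult_right_zero, subst Bochner_Integration.integral_sum) (use int in auto)
  also have "\<dots> = 2 ^ sum m E * (\<Sum>X\<in>saturated m. \<kappa> (n1 m X a) (n2 X a) * (\<Prod>x\<in>V. moment (n1 m X x) (n2 X x)))"
  proof -
    have "(\<integral>z. (\<Prod>x\<in>V. ?G X x (z x)) \<partial>spins V) = \<kappa> (n1 m X a) (n2 X a) * (\<Prod>x\<in>V. moment (n1 m X x) (n2 X x))" for X
      unfolding spins_def circs.product_integral_prod[OF finV Gi] G
      using finV aV by (simp add: prod.distrib prod.delta)
    then show ?thesis by simp
  qed
  also have "\<dots> = (\<Sum>X\<in>saturated m. \<Sum>\<sigma>\<in>{\<sigma>\<in>pairings m. X \<in> cols m \<sigma>}.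
      (\<Prod>x\<in>V. 1 / fact (n_site E m x)) * (\<kappa> (n1 m X a) (n2 X a) * sqrt 2 ^ card (bdry m)))"
    unfolding sum_distrib_left
  proof (rule sum.cong[OF refl])
    fix X assume X: "X \<in> saturated m"
    then have sub: "X \<subseteq> half_links E m" by (auto simp: saturated_def)
    let ?c = "card {\<sigma>\<in>pairings m. X \<in> cols m \<sigma>}"
    have nz: "(\<Prod>x\<in>V. 2 ^ n_site E m x :: real) \<noteq> 0" using finV by (simp add: prod_zero_iff)
    have M: "(\<Prod>x\<in>V. moment (n1 m X x) (n2 X x)) =
        real ?c / (\<Prod>x\<in>V. 2 ^ n_site E m x) * (\<Prod>x\<in>V. 1 / fact (n_site E m x))"
      unfolding moment_eq n1_n2[OF sub] n_site_def[symmetric] card_pairings_col[OF X]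
      by (simp add: prod_dividef prod.distrib)
    \<comment> \<open>A factor 2 per link is \<open>sqrt 2\<close> per half-link: the inner ones
      give 2^n at each site, cancelling the moments, and the boundary ones remain. The factor
      \<open>?c\<close> is kept because evenness of the degrees is derived from the existence of a
      pairing.\<close>
    have *: "2 ^ sum m E * real ?c = sqrt 2 ^ card (bdry m) * (\<Prod>x\<in>V. 2 ^ n_site E m x) * real ?c"
    proof (cases "?c = 0")
      case False
      then obtain \<sigma> where s: "\<sigma> \<in> pairings m" by (metis (mono_tags, lifting) Collect_empty_eq card.empty)
      have ev: "even (deg E m x)" if "x \<in> V" for x
        unfolding card_half_links_site[symmetric]
      proof (rule even_card_involution[where f=\<sigma>])
        fix h assume h: "h \<in> {h \<in> half_links E m. hsite h = x}"
        then have hi: "h \<in> inner m" using that by (auto simp: inner_def)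
        show "\<sigma> h \<in> {h \<in> half_links E m. hsite h = x} \<and> \<sigma> h \<noteq> h \<and> \<sigma> (\<sigma> h) = h"
          using pairing_props[OF s, of h] hi h by (auto simp: inner_def)
      qed (use finite_half_links in auto)
      have "half_links E m = bdry m \<union> (\<Union>x\<in>V. {h \<in> half_links E m. hsite h = x})"
        by (auto simp: bdry_def)
      also have "card \<dots> = card (bdry m) + card (\<Union>x\<in>V. {h \<in> half_links E m. hsite h = x})"
        by (rule card_Un_disjoint) (use finite_half_links finV in \<open>auto simp: bdry_def\<close>)
      also have "card (\<Union>x\<in>V. {h \<in> half_links E m. hsite h = x}) = (\<Sum>x\<in>V. deg E m x)"
        by (subst card_UN_disjoint) (use finite_half_links finV in \<open>auto simp: card_half_links_site\<close>)
      also have "\<dots> = (\<Sum>x\<in>V. 2 * n_site E m x)"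
        by (rule sum.cong[OF refl]) (use ev in \<open>simp add: n_site_def\<close>)
      finally have "2 * sum m E = card (bdry m) + 2 * (\<Sum>x\<in>V. n_site E m x)"
        by (simp add: card_half_links sum_distrib_left)
      then have "sqrt 2 ^ (2 * sum m E) = sqrt 2 ^ card (bdry m) * sqrt 2 ^ (2 * (\<Sum>x\<in>V. n_site E m x))"
        by (simp only: power_add)
      then show ?thesis by (simp add: power_mult power_sum)
    qed simp
    have "2 ^ sum m E * (\<kappa> (n1 m X a) (n2 X a) * (\<Prod>x\<in>V. moment (n1 m X x) (n2 X x)))
       = (2 ^ sum m E * real ?c) * (\<kappa> (n1 m X a) (n2 X a) * (\<Prod>x\<in>V. 1 / fact (n_site E m x))) / (\<Prod>x\<in>V. 2 ^ n_site E m x)"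
      unfolding M by simp
    also have "\<dots> = sqrt 2 ^ card (bdry m) * real ?c * (\<kappa> (n1 m X a) (n2 X a) * (\<Prod>x\<in>V. 1 / fact (n_site E m x)))"
      unfolding * using nz by simp
    finally show "2 ^ sum m E * (\<kappa> (n1 m X a) (n2 X a) * (\<Prod>x\<in>V. moment (n1 m X x) (n2 X x))) =
      (\<Sum>\<sigma>\<in>{\<sigma>\<in>pairings m. X \<in> cols m \<sigma>}. (\<Prod>x\<in>V. 1 / fact (n_site E m x)) * (\<kappa> (n1 m X a) (n2 X a) * sqrt 2 ^ card (bdry m)))"
      by (simp add: mult_ac)
  qed
  also have "\<dots> = (\<Sum>\<sigma>\<in>pairings m. \<Sum>X\<in>{X\<in>saturated m. X \<in> cols m \<sigma>}.
      (\<Prod>x\<in>V. 1 / fact (n_site E m x)) * (\<kappa> (n1 m X a) (n2 X a) * sqrt 2 ^ card (bdry m)))"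
    by (rule sum.swap_restrict[OF finite_saturated finite_pairings])
  also have "\<dots> = (\<Sum>\<sigma>\<in>pairings m. (\<Prod>x\<in>V. 1 / fact (n_site E m x)) *
       (\<Sum>X\<in>cols m \<sigma>. \<kappa> (n1 m X a) (n2 X a) * sqrt 2 ^ card (bdry m)))"
  proof (rule sum.cong[OF refl])
    fix \<sigma> assume "\<sigma> \<in> pairings m"
    then have "{X\<in>saturated m. X \<in> cols m \<sigma>} = cols m \<sigma>" using cols_eq by auto
    then show "(\<Sum>X\<in>{X\<in>saturated m. X \<in> cols m \<sigma>}.
      (\<Prod>x\<in>V. 1 / fact (n_site E m x)) * (\<kappa> (n1 m X a) (n2 X a) * sqrt 2 ^ card (bdry m))) =
      (\<Prod>x\<in>V. 1 / fact (n_site E m x)) * (\<Sum>X\<in>cols m \<sigma>. \<kappa> (n1 m X a) (n2 X a) * sqrt 2 ^ card (bdry m))"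
      by (simp add: sum_distrib_left)
  qed
  finally show ?thesis .
qed

end

section \<open>Equality of the two models after summation over link numbers\<close>

context wire_graph
begin

lemma sum_cols_one:
  assumes s: "\<sigma> \<in> pairings m"
  shows "(\<Sum>X\<in>cols m \<sigma>. sqrt 2 ^ card (bdry m)) = 2 ^ num_loops E (m, \<sigma>)"
proof -
  interpret two_involutions "half_links E m" link_partner \<sigma> by (rule two_involutions[OF s])
  show ?thesis using sum_colourings by (simp add: fixpts_eq[OF s] num_loops_eq[OF s])
qed

text \<open>Write n1 - n2 as a sum of signs over the half-links at a and sum over colourings first:
  a half-link on an open loop contributes the number of colourings, any other one cancels.\<close>

lemma sum_cols_diff:
  assumes s: "\<sigma> \<in> pairings m"
  shows "(\<Sum>X\<in>cols m \<sigma>. (real (n1 m X a) - real (n2 X a)) * sqrt 2 ^ card (bdry m)) =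
    2 * real (n_open V E (m, \<sigma>) a) * 2 ^ num_loops E (m, \<sigma>)"
proof -
  interpret two_involutions "half_links E m" link_partner \<sigma> by (rule two_involutions[OF s])
  let ?H = "{h \<in> half_links E m. hsite h = a}"
  have fH: "finite ?H" using finite_half_links by simp
  have "real (n1 m X a) - real (n2 X a) = (\<Sum>h\<in>?H. if h \<in> X then - 1 else 1)" if X: "X \<in> cols m \<sigma>" for X
  proof -
    have "X \<subseteq> half_links E m" using X by (simp add: colourings_def)
    then have "{h \<in> X. hsite h = a} = {h \<in> ?H. h \<in> X}" "{h \<in> half_links E m - X. hsite h = a} = {h \<in> ?H. h \<notin> X}" by auto
    moreover have "(\<Sum>h\<in>?H. if h \<in> X then - 1 else 1 :: real) = - real (card {h \<in> ?H. h \<in> X}) + real (card {h \<in> ?H. h \<notin> X})"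
    proof -
      have "?H \<inter> {h. h \<in> X} = {h \<in> ?H. h \<in> X}" "?H \<inter> - {h. h \<in> X} = {h \<in> ?H. h \<notin> X}" by auto
      then show ?thesis by (simp only: sum.If_cases[OF fH] sum_constant mult_1_right mult_minus_right)
    qed
    ultimately show ?thesis by (simp only: n1_def n2_def)
  qed
  then have "(\<Sum>X\<in>cols m \<sigma>. real (n1 m X a) - real (n2 X a)) = (\<Sum>X\<in>cols m \<sigma>. \<Sum>h\<in>?H. if h \<in> X then - 1 else 1)"
    by (rule sum.cong[OF refl])
  also have "\<dots> = (\<Sum>h\<in>?H. \<Sum>X\<in>cols m \<sigma>. if h \<in> X then - 1 else 1)" by (rule sum.swap)
  also have "\<dots> = (\<Sum>h\<in>?H. if on_open_loop V E (m, \<sigma>) h then real (card (cols m \<sigma>)) else 0)"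
  proof (rule sum.cong[OF refl])
    fix h assume "h \<in> ?H"
    then have "h \<in> half_links E m" by simp
    from sum_colourings_sign[OF this] on_open_loop_iff[OF s this]
    show "(\<Sum>X\<in>cols m \<sigma>. if h \<in> X then - 1 else 1) = (if on_open_loop V E (m, \<sigma>) h then real (card (cols m \<sigma>)) else 0)"
      by simp
  qed
  also have "\<dots> = (\<Sum>h\<in>open_at m \<sigma>. real (card (cols m \<sigma>)))"
    by (rule sum.mono_neutral_cong_right) (use fH in \<open>auto simp: open_at_def\<close>)
  also have "\<dots> = 2 * real (n_open V E (m, \<sigma>) a) * real (card (cols m \<sigma>))"
    by (simp add: card_open_at[OF s])
  finally show ?thesis
    using sum_cols_one[OF s] by (simp add: sum_distrib_right[symmetric])
qed

text \<open>The dictionary between spin and wire observables, one link configuration at a time; the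
  summation over m is then done once for both the partition function and the numerator.\<close>

definition represents :: "(complex \<Rightarrow> real) \<Rightarrow> (wire \<Rightarrow> real) \<Rightarrow> bool" where
  "represents g f \<longleftrightarrow> continuous_on UNIV g \<and> (\<forall>z. norm z = 1 \<longrightarrow> \<bar>g z\<bar> \<le> 1) \<and> (\<forall>w. 0 \<le> f w) \<and>
    (\<forall>m. (\<integral>z. g (z a) * (\<Prod>e\<in>E. (2 * Re (edge_char V e z)) ^ m e) \<partial>spins V) =
      (\<Sum>\<sigma>\<in>pairings m. f (m, \<sigma>) * 2 ^ num_loops E (m, \<sigma>) * (\<Prod>x\<in>V. 1 / fact (n_site E m x))))"

lemma represents_one: "represents (\<lambda>_. 1) (\<lambda>_. 1)"
  unfolding represents_def
proof (intro conjI allI)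
  fix m
  have "(\<integral>z. 1 * (\<Prod>e\<in>E. (2 * Re (edge_char V e z)) ^ m e) \<partial>spins V) =
    (\<Sum>\<sigma>\<in>pairings m. (\<Prod>x\<in>V. 1 / fact (n_site E m x)) * (\<Sum>X\<in>cols m \<sigma>. 1 * sqrt 2 ^ card (bdry m)))"
    by (rule integral_edge_powers) (auto simp: moment_def)
  also have "\<dots> = (\<Sum>\<sigma>\<in>pairings m. 1 * 2 ^ num_loops E (m, \<sigma>) * (\<Prod>x\<in>V. 1 / fact (n_site E m x)))"
    by (rule sum.cong[OF refl]) (simp only: mult_1 sum_cols_one mult.commute)
  finally show "(\<integral>z. 1 * (\<Prod>e\<in>E. (2 * Re (edge_char V e z)) ^ m e) \<partial>spins V) =
    (\<Sum>\<sigma>\<in>pairings m. 1 * 2 ^ num_loops E (m, \<sigma>) * (\<Prod>x\<in>V. 1 / fact (n_site E m x)))" .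
qed auto

lemma represents_open: "represents (\<lambda>z. Re (z\<^sup>2)) (\<lambda>w. real (n_open V E w a) / (real (n_site E (fst w) a) + 1))"
  unfolding represents_def
proof (intro conjI allI impI)
  fix m
  define \<kappa> where "\<kappa> i j = (real i - real j) / (2 * (real ((i + j) div 2) + 1))" for i j
  have "(\<integral>z. Re ((z a)\<^sup>2) * (\<Prod>e\<in>E. (2 * Re (edge_char V e z)) ^ m e) \<partial>spins V) =
    (\<Sum>\<sigma>\<in>pairings m. (\<Prod>x\<in>V. 1 / fact (n_site E m x)) *
      (\<Sum>X\<in>cols m \<sigma>. \<kappa> (n1 m X a) (n2 X a) * sqrt 2 ^ card (bdry m)))"
    by (rule integral_edge_powers[where g="\<lambda>z. Re (z\<^sup>2)"]) (auto simp: moment_square \<kappa>_def intro!: continuous_intros)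
  also have "\<dots> = (\<Sum>\<sigma>\<in>pairings m. real (n_open V E (m, \<sigma>) a) / (real (n_site E m a) + 1) * 2 ^ num_loops E (m, \<sigma>) * (\<Prod>x\<in>V. 1 / fact (n_site E m x)))"
  proof (rule sum.cong[OF refl])
    fix \<sigma> assume s: "\<sigma> \<in> pairings m"
    have "(\<Sum>X\<in>cols m \<sigma>. \<kappa> (n1 m X a) (n2 X a) * sqrt 2 ^ card (bdry m)) =
      (\<Sum>X\<in>cols m \<sigma>. (real (n1 m X a) - real (n2 X a)) * sqrt 2 ^ card (bdry m) / (2 * (real (n_site E m a) + 1)))"
    proof (rule sum.cong[OF refl])
      fix X assume "X \<in> cols m \<sigma>"
      then have "X \<subseteq> half_links E m" using cols_eq[OF s] by (auto simp: saturated_def)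
      then show "\<kappa> (n1 m X a) (n2 X a) * sqrt 2 ^ card (bdry m) =
        (real (n1 m X a) - real (n2 X a)) * sqrt 2 ^ card (bdry m) / (2 * (real (n_site E m a) + 1))"
        by (simp add: \<kappa>_def n1_n2 n_site_def)
    qed
    also have "\<dots> = (2 * real (n_open V E (m, \<sigma>) a) * 2 ^ num_loops E (m, \<sigma>)) / (2 * (real (n_site E m a) + 1))"
      by (simp only: sum_divide_distrib[symmetric] sum_cols_diff[OF s])
    also have "\<dots> = real (n_open V E (m, \<sigma>) a) / (real (n_site E m a) + 1) * 2 ^ num_loops E (m, \<sigma>)"
      by (simp only: mult.assoc mult_divide_mult_cancel_left[of 2] zero_neq_numeral not_False_eq_True) simp
    finally show "(\<Prod>x\<in>V. 1 / fact (n_site E m x)) * (\<Sum>X\<in>cols m \<sigma>. \<kappa> (n1 m X a) (n2 X a) * sqrt 2 ^ card (bdry m)) =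
      real (n_open V E (m, \<sigma>) a) / (real (n_site E m a) + 1) * 2 ^ num_loops E (m, \<sigma>) * (\<Prod>x\<in>V. 1 / fact (n_site E m x))"
      by (simp only: mult.commute)
  qed
  finally show "(\<integral>z. Re ((z a)\<^sup>2) * (\<Prod>e\<in>E. (2 * Re (edge_char V e z)) ^ m e) \<partial>spins V) =
    (\<Sum>\<sigma>\<in>pairings m. real (n_open V E (m, \<sigma>) a) / (real (n_site E (fst (m, \<sigma>)) a) + 1) * 2 ^ num_loops E (m, \<sigma>) * (\<Prod>x\<in>V. 1 / fact (n_site E m x)))"
    by simp
next
  fix z :: complex assume "norm z = 1"
  then show "\<bar>Re (z\<^sup>2)\<bar> \<le> 1" by (intro abs_Re_unit) (simp add: norm_power)
qed (auto intro!: continuous_intros)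

text \<open>Cutting every link number at the same N makes the truncated sum a product over edges of
  truncated exponential series.\<close>

definition bounded_configs :: "nat \<Rightarrow> (edge \<Rightarrow> nat) set" where
  "bounded_configs N = {m. (\<forall>e. e \<notin> E \<longrightarrow> m e = 0) \<and> (\<forall>e\<in>E. m e \<le> N)}"

lemma bounded_configs_bij:
  "bij_betw (\<lambda>m e. if e \<in> E then m e else 0) (\<Pi>\<^sub>E e\<in>E. {..N}) (bounded_configs N)"
  by (rule bij_betwI[where g="\<lambda>m. restrict m E"])
     (auto simp: bounded_configs_def PiE_iff extensional_def fun_eq_iff)

lemma finite_bounded_configs: "finite (bounded_configs N)"
  using bij_betw_finite[OF bounded_configs_bij[of N]] finE by (auto intro!: finite_PiE)

text \<open>Evenness at the inner sites is encoded in \<open>pairings\<close>: a fixed-point-free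
  involution of the half-links at a site forces their number to be even.\<close>

lemma wire_configs_exhaust: "wire_configs V E = (\<Union>N. Sigma (bounded_configs N) pairings)"
proof (intro set_eqI iffI)
  fix w assume w: "w \<in> wire_configs V E"
  obtain m \<sigma> where ms: "w = (m, \<sigma>)" by (cases w)
  have "m \<in> bounded_configs (sum m E)"
    using w ms finE by (auto simp: wire_configs_def link_config_def bounded_configs_def intro: member_le_sum)
  then show "w \<in> (\<Union>N. Sigma (bounded_configs N) pairings)"
    using w ms by (auto simp: wire_configs_def pairings_def)
next
  fix w assume "w \<in> (\<Union>N. Sigma (bounded_configs N) pairings)"
  then obtain m \<sigma> N where w: "w = (m, \<sigma>)" "m \<in> bounded_configs N" and s: "\<sigma> \<in> pairings m" by auto
  have "even (deg E m x)" if "x \<in> V" for x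
    unfolding card_half_links_site[symmetric]
  proof (rule even_card_involution[where f=\<sigma>])
    fix h assume h: "h \<in> {h \<in> half_links E m. hsite h = x}"
    then have hi: "h \<in> inner m" using that by (auto simp: inner_def)
    show "\<sigma> h \<in> {h \<in> half_links E m. hsite h = x} \<and> \<sigma> h \<noteq> h \<and> \<sigma> (\<sigma> h) = h"
      using pairing_props[OF s, of h] hi h by (auto simp: inner_def)
  qed (use finite_half_links in auto)
  then show "w \<in> wire_configs V E"
    using w s by (auto simp: wire_configs_def link_config_def bounded_configs_def pairings_def)
qed

lemma sum_pairings_weight:
  assumes gf: "represents g f" and J: "0 \<le> J"
  shows "(\<Sum>\<sigma>\<in>pairings m. f (m, \<sigma>) * wire_weight V E 2 (\<lambda>_. J) (\<lambda>n. ln (fact n)) (m, \<sigma>)) =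
    (\<integral>z. g (z a) * (\<Prod>e\<in>E. (2 * J * Re (edge_char V e z)) ^ m e / fact (m e)) \<partial>spins V)"
proof -
  have ex: "exp (- (\<Sum>x\<in>V. ln (fact (n_site E m x)))) = (\<Prod>x\<in>V. 1 / fact (n_site E m x) :: real)"
    using finV by (simp add: exp_minus exp_sum inverse_eq_divide prod_dividef)
  have "(\<Sum>\<sigma>\<in>pairings m. f (m, \<sigma>) * wire_weight V E 2 (\<lambda>_. J) (\<lambda>n. ln (fact n)) (m, \<sigma>)) =
    (\<Prod>e\<in>E. J ^ m e / fact (m e)) * (\<Sum>\<sigma>\<in>pairings m. f (m, \<sigma>) * 2 ^ num_loops E (m, \<sigma>) * (\<Prod>x\<in>V. 1 / fact (n_site E m x)))"
    by (simp add: wire_weight_def ex sum_distrib_left mult_ac)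
  also have "\<dots> = (\<Prod>e\<in>E. J ^ m e / fact (m e)) * (\<integral>z. g (z a) * (\<Prod>e\<in>E. (2 * Re (edge_char V e z)) ^ m e) \<partial>spins V)"
    using gf by (simp add: represents_def)
  also have "\<dots> = (\<integral>z. g (z a) * (\<Prod>e\<in>E. (2 * J * Re (edge_char V e z)) ^ m e / fact (m e)) \<partial>spins V)"
    unfolding integral_mult_right_zero[symmetric]
  proof (rule Bochner_Integration.integral_cong[OF refl])
    fix z
    have "(\<Prod>e\<in>E. (2 * J * Re (edge_char V e z)) ^ m e / fact (m e)) =
      (\<Prod>e\<in>E. J ^ m e / fact (m e)) * (\<Prod>e\<in>E. (2 * Re (edge_char V e z)) ^ m e)"
      unfolding prod.distrib[symmetric] by (rule prod.cong[OF refl]) (simp add: power_mult_distrib)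
    then show "(\<Prod>e\<in>E. J ^ m e / fact (m e)) * (g (z a) * (\<Prod>e\<in>E. (2 * Re (edge_char V e z)) ^ m e)) =
      g (z a) * (\<Prod>e\<in>E. (2 * J * Re (edge_char V e z)) ^ m e / fact (m e))" by simp
  qed
  finally show ?thesis .
qed

text \<open>The sum over bounded link numbers is an integral of truncated exponentials, dominated by
  exp (2 J) per edge. The wire terms are nonnegative, so the limit in N is their unordered
  sum.\<close>

lemma wire_sum_eq_integral:
  assumes gf: "represents g f" and J: "0 \<le> J"
  shows "(\<Sum>\<^sub>\<infinity>w\<in>wire_configs V E. f w * wire_weight V E 2 (\<lambda>_. J) (\<lambda>n. ln (fact n)) w) =
    (\<integral>z. g (z a) * xy_weight V E (\<lambda>_. 2 * J) z \<partial>spins V)"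
  unfolding wire_configs_exhaust
proof (rule infsum_exhaust)
  have gc: "continuous_on UNIV g" and gb: "\<And>z. norm z = 1 \<Longrightarrow> \<bar>g z\<bar> \<le> 1" and f0: "\<And>w. 0 \<le> f w"
    using gf by (auto simp: represents_def)
  show "0 \<le> f w * wire_weight V E 2 (\<lambda>_. J) (\<lambda>n. ln (fact n)) w" for w
    using f0[of w] J by (auto simp: wire_weight_def intro!: mult_nonneg_nonneg prod_nonneg)
  show "finite (Sigma (bounded_configs N) pairings)" for N
    using finite_bounded_configs finite_pairings by auto
  show "incseq (\<lambda>N. Sigma (bounded_configs N) pairings)"
    by (intro incseq_SucI Sigma_mono) (auto simp: bounded_configs_def intro: le_SucI)
  let ?W = "\<lambda>w. f w * wire_weight V E 2 (\<lambda>_. J) (\<lambda>n. ln (fact n)) w"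
  let ?x = "\<lambda>z e. 2 * J * Re (edge_char V e z)"
  let ?h = "\<lambda>N z. g (z a) * (\<Prod>e\<in>E. \<Sum>k\<le>N. ?x z e ^ k / fact k)"
  have gm [measurable]: "(\<lambda>z. g (z a)) \<in> borel_measurable (spins V)"
    by (rule measurable_compose[OF measurable_spin[OF aV] borel_measurable_continuous_onI[OF gc]])
  have xb: "\<bar>?x z e\<bar> \<le> 2 * J" if "z \<in> space (spins V)" for z e
    using abs_Re_unit[OF norm_edge_char[OF that, of e]] J by (simp add: abs_mult mult_left_le)
  have partial: "(\<Sum>w\<in>Sigma (bounded_configs N) pairings. ?W w) = (\<integral>z. ?h N z \<partial>spins V)" for N
  proof -
    have int: "integrable (spins V) (\<lambda>z. g (z a) * (\<Prod>e\<in>E. ?x z e ^ m e / fact (m e)))" for m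
    proof (rule spins.integrable_bounded[where B="1 * (\<Prod>e\<in>E. (2 * J) ^ m e / fact (m e))"])
      fix z assume z: "z \<in> space (spins V)"
      have "\<bar>\<Prod>e\<in>E. ?x z e ^ m e / fact (m e)\<bar> \<le> (\<Prod>e\<in>E. (2 * J) ^ m e / fact (m e))"
        unfolding abs_prod abs_divide power_abs abs_of_nonneg[OF fact_ge_zero]
        by (intro prod_mono conjI divide_right_mono power_mono xb[OF z]) auto
      then show "norm (g (z a) * (\<Prod>e\<in>E. ?x z e ^ m e / fact (m e))) \<le> 1 * (\<Prod>e\<in>E. (2 * J) ^ m e / fact (m e))"
        unfolding real_norm_def abs_mult using gb[OF norm_spin[OF z aV]] by (intro mult_mono) auto
    qed measurable
    have "(\<Sum>w\<in>Sigma (bounded_configs N) pairings. ?W w) = (\<Sum>m\<in>bounded_configs N. \<Sum>\<sigma>\<in>pairings m. ?W (m, \<sigma>))"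
      using finite_bounded_configs finite_pairings by (subst sum.Sigma) auto
    also have "\<dots> = (\<Sum>m\<in>bounded_configs N. \<integral>z. g (z a) * (\<Prod>e\<in>E. ?x z e ^ m e / fact (m e)) \<partial>spins V)"
      by (simp only: sum_pairings_weight[OF gf J])
    also have "\<dots> = (\<Sum>m\<in>(\<Pi>\<^sub>E e\<in>E. {..N}). \<integral>z. g (z a) * (\<Prod>e\<in>E. ?x z e ^ m e / fact (m e)) \<partial>spins V)"
      by (subst sum.reindex_bij_betw[OF bounded_configs_bij, symmetric])
         (intro sum.cong refl Bochner_Integration.integral_cong arg_cong2[where f="(*)"] prod.cong, auto)
    also have "\<dots> = (\<integral>z. (\<Sum>m\<in>(\<Pi>\<^sub>E e\<in>E. {..N}). g (z a) * (\<Prod>e\<in>E. ?x z e ^ m e / fact (m e))) \<partial>spins V)"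
      by (rule Bochner_Integration.integral_sum[symmetric]) (rule int)
    also have "\<dots> = (\<integral>z. ?h N z \<partial>spins V)"
      using finE by (subst prod_sum_PiE) (auto simp: sum_distrib_left)
    finally show ?thesis .
  qed
  have "(\<lambda>N. \<integral>z. ?h N z \<partial>spins V) \<longlonglongrightarrow> (\<integral>z. g (z a) * xy_weight V E (\<lambda>_. 2 * J) z \<partial>spins V)"
  proof (rule integral_dominated_convergence[where w="\<lambda>_. 1 * (\<Prod>e\<in>E. exp (2 * J))"])
    show "AE z in spins V. (\<lambda>N. ?h N z) \<longlonglongrightarrow> g (z a) * xy_weight V E (\<lambda>_. 2 * J) z"
    proof (rule AE_I2)
      fix z
      have "(\<lambda>N. \<Sum>k\<le>N. x ^ k / fact k) \<longlonglongrightarrow> exp x" for x :: real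
        using exp_converges[of x] unfolding sums_def_le by (simp add: divide_inverse mult.commute)
      then have "(\<lambda>N. ?h N z) \<longlonglongrightarrow> g (z a) * (\<Prod>e\<in>E. exp (?x z e))"
        by (intro tendsto_intros)
      then show "(\<lambda>N. ?h N z) \<longlonglongrightarrow> g (z a) * xy_weight V E (\<lambda>_. 2 * J) z"
        using finE by (simp add: xy_weight_def exp_sum)
    qed
    show "AE z in spins V. norm (?h N z) \<le> 1 * (\<Prod>e\<in>E. exp (2 * J))" for N
    proof (rule AE_I2)
      fix z assume z: "z \<in> space (spins V)"
      have "\<bar>\<Sum>k\<le>N. ?x z e ^ k / fact k\<bar> \<le> exp (2 * J)" for e
      proof -
        have "\<bar>\<Sum>k\<le>N. ?x z e ^ k / fact k\<bar> \<le> (\<Sum>k\<le>N. \<bar>?x z e ^ k / fact k\<bar>)" by (rule sum_abs)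
        also have "\<dots> \<le> (\<Sum>k\<le>N. (2 * J) ^ k /\<^sub>R fact k)"
        proof (rule sum_mono)
          fix k
          have "\<bar>?x z e ^ k / fact k\<bar> \<le> (2 * J) ^ k / fact k"
            unfolding abs_divide power_abs abs_of_nonneg[OF fact_ge_zero]
            by (intro divide_right_mono power_mono xb[OF z]) auto
          then show "\<bar>?x z e ^ k / fact k\<bar> \<le> (2 * J) ^ k /\<^sub>R fact k"
            by (simp add: divide_inverse mult.commute)
        qed
        also have "\<dots> \<le> (\<Sum>k. (2 * J) ^ k /\<^sub>R fact k)"
          by (intro sum_le_suminf summable_exp_generic) (use J in auto)
        also have "\<dots> = exp (2 * J)" by (simp add: exp_def)
        finally show ?thesis .
      qed
      then have "\<bar>\<Prod>e\<in>E. \<Sum>k\<le>N. ?x z e ^ k / fact k\<bar> \<le> (\<Prod>e\<in>E. exp (2 * J))"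
        unfolding abs_prod by (intro prod_mono) auto
      then show "norm (?h N z) \<le> 1 * (\<Prod>e\<in>E. exp (2 * J))"
        unfolding real_norm_def abs_mult using gb[OF norm_spin[OF z aV]] by (intro mult_mono) auto
    qed
  qed measurable
  then show "(\<lambda>N. \<Sum>w\<in>Sigma (bounded_configs N) pairings. ?W w) \<longlonglongrightarrow> (\<integral>z. g (z a) * xy_weight V E (\<lambda>_. 2 * J) z \<partial>spins V)"
    by (simp only: partial)
qed

theorem wire_expect_eq_xy_mag:
  assumes "0 \<le> J"
  shows "wire_expect V E 2 (\<lambda>_. J) (\<lambda>n. ln (fact n))
     (\<lambda>w. real (n_open V E w a) / (real (n_site E (fst w) a) + 1)) = xy_mag V E (\<lambda>_. 2 * J) a"
proof -
  have "partition_fn V E 2 (\<lambda>_. J) (\<lambda>n. ln (fact n)) = xy_Z V E (\<lambda>_. 2 * J)"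
    using wire_sum_eq_integral[OF represents_one assms] by (simp add: partition_fn_def xy_Z_def)
  moreover have "xy_N V E (\<lambda>_. 2 * J) a = (\<integral>z. Re ((z a)\<^sup>2) * xy_weight V E (\<lambda>_. 2 * J) z \<partial>spins V)"
    using aV by (simp add: xy_N_def spin_def)
  ultimately show ?thesis
    using wire_sum_eq_integral[OF represents_open assms] by (simp add: wire_expect_def xy_mag_def)
qed

end

section \<open>High temperature\<close>

text \<open>Expand \<open>exp (K cos) = (exp (K cos) - exp (- K)) + exp (- K)\<close> over the sets A of edges carrying the first,
  nonnegative term. If A does not connect a to the outside, rotating the cluster of a by a quarter turn
  changes the sign of the observable.\<close>

lemma sum_supersets_prod:
  fixes g :: "'a \<Rightarrow> real"
  assumes "finite E" "B \<subseteq> E"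
  shows "(\<Sum>A\<in>{A\<in>Pow E. B \<subseteq> A}. (\<Prod>e\<in>A. g e) * (\<Prod>e\<in>E-A. q)) = (\<Prod>e\<in>B. g e) * (\<Prod>e\<in>E-B. g e + q)"
proof -
  have fB: "finite B" using assms finite_subset by auto
  have "(\<Sum>A\<in>{A\<in>Pow E. B \<subseteq> A}. (\<Prod>e\<in>A. g e) * (\<Prod>e\<in>E-A. q)) =
    (\<Sum>A\<in>Pow (E-B). (\<Prod>e\<in>B \<union> A. g e) * (\<Prod>e\<in>E-(B \<union> A). q))"
    by (rule sum.reindex_bij_witness[where i="\<lambda>A. B \<union> A" and j="\<lambda>A. A - B"])
       (use assms in \<open>auto simp: Un_absorb1\<close>)
  also have "\<dots> = (\<Sum>A\<in>Pow (E-B). (\<Prod>e\<in>B. g e) * ((\<Prod>e\<in>A. g e) * (\<Prod>e\<in>E-B-A. q)))"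
  proof (rule sum.cong[OF refl])
    fix A assume A: "A \<in> Pow (E - B)"
    then have "finite A" using assms finite_subset[of A E] by auto
    then have "(\<Prod>e\<in>B \<union> A. g e) = (\<Prod>e\<in>B. g e) * (\<Prod>e\<in>A. g e)"
      using A fB by (intro prod.union_disjoint) auto
    moreover have "E - (B \<union> A) = E - B - A" by auto
    ultimately show "(\<Prod>e\<in>B \<union> A. g e) * (\<Prod>e\<in>E-(B \<union> A). q) = (\<Prod>e\<in>B. g e) * ((\<Prod>e\<in>A. g e) * (\<Prod>e\<in>E-B-A. q))"
      by (simp only: mult.assoc)
  qed
  also have "\<dots> = (\<Prod>e\<in>B. g e) * (\<Prod>e\<in>E-B. g e + q)"
    using assms by (subst prod_add) (auto simp: sum_distrib_left)
  finally show ?thesis .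
qed

text \<open>W holds a certificate with n edges for every connection from a to the outside. A given B
  is contained in the random edge set A with weight at most p^n times the total, and a union bound
  over W finishes.\<close>

lemma (in wire_graph) xy_mag_percolation_bound:
  assumes K: "0 \<le> K"
    and W: "finite W" "\<And>B. B \<in> W \<Longrightarrow> B \<subseteq> E \<and> card B = n"
    and conn: "\<And>A y. A \<subseteq> E \<Longrightarrow> y \<notin> V \<Longrightarrow> (a, y) \<in> {(x, y). {x, y} \<in> A}\<^sup>* \<Longrightarrow> \<exists>B\<in>W. B \<subseteq> A"
  shows "xy_mag V E (\<lambda>_. K) a \<le> card W * (1 - exp (- 2 * K)) ^ n"
proof -
  define p where "p = 1 - exp (- 2 * K)"
  define g where "g e z = exp (K * Re (edge_char V e z)) - exp (- K)" for e z
  define w where "w A z = (\<Prod>e\<in>A. g e z) * (\<Prod>e\<in>E-A. exp (- K))" for A z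
  have p0: "0 \<le> p" using K by (simp add: p_def)
  have we: "xy_weight V E (\<lambda>_. K) z = (\<Prod>e\<in>E. g e z + exp (- K))" for z
    using finE by (simp add: xy_weight_def exp_sum g_def)
  have wsum: "xy_weight V E (\<lambda>_. K) z = (\<Sum>A\<in>Pow E. w A z)" for z
    unfolding we w_def by (rule prod_add[OF finE])
  \<comment> \<open>The share of the first term in the weight of an edge is largest when the two
    spins are aligned, where it equals p.\<close>
  have g0: "0 \<le> g e z" and gp: "g e z \<le> p * (g e z + exp (- K))" if z: "z \<in> space (spins V)" for e z
  proof -
    have r: "\<bar>Re (edge_char V e z)\<bar> \<le> 1" using z by (intro abs_Re_unit) simp
    then have "- K \<le> K * Re (edge_char V e z)" "K * Re (edge_char V e z) \<le> K"
      using K mult_left_mono[of "-1" "Re (edge_char V e z)" K] mult_left_mono[of "Re (edge_char V e z)" 1 K] by auto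
    then show "0 \<le> g e z" by (simp add: g_def)
    have "exp (- 2 * K) * exp (K * Re (edge_char V e z)) \<le> exp (- 2 * K) * exp K"
      using \<open>K * Re (edge_char V e z) \<le> K\<close> by (intro mult_left_mono) auto
    also have "\<dots> = exp (- K)" by (simp add: exp_add[symmetric])
    finally show "g e z \<le> p * (g e z + exp (- K))" by (simp add: g_def p_def algebra_simps)
  qed
  have gm [measurable]: "g e \<in> borel_measurable (spins V)" for e unfolding g_def by measurable
  have wm [measurable]: "w A \<in> borel_measurable (spins V)" for A unfolding w_def by measurable
  have w0: "0 \<le> w A z" if "z \<in> space (spins V)" for A z
    unfolding w_def using g0[OF that] by (intro mult_nonneg_nonneg prod_nonneg) auto
  have wb: "w A z \<le> exp (K * card E)" if z: "z \<in> space (spins V)" and A: "A \<subseteq> E" for A z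
  proof -
    have "w A z \<le> (\<Sum>A\<in>Pow E. w A z)"
      by (rule member_le_sum) (use A finE w0[OF z] in auto)
    also have "\<dots> \<le> exp (K * card E)"
      unfolding wsum[symmetric] using xy_weight_bounds(1)[of E "\<lambda>_. K" z V] K z by (simp add: mult.commute)
    finally show ?thesis .
  qed
  have iw: "integrable (spins V) (w A)" if "A \<subseteq> E" for A
    by (rule spins.integrable_bounded[where B="exp (K * card E)"]) (use wb w0 that in auto)
  let ?c = "\<lambda>z. Re ((spin V z a)\<^sup>2)"
  have cb: "\<bar>?c z\<bar> \<le> 1" if "z \<in> space (spins V)" for z
    using that by (intro abs_Re_unit) (simp add: norm_power)
  have icw: "integrable (spins V) (\<lambda>z. ?c z * w A z)" if A: "A \<subseteq> E" for A
  proof (rule spins.integrable_bounded[where B="1 * exp (K * card E)"])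
    fix z assume z: "z \<in> space (spins V)"
    show "norm (?c z * w A z) \<le> 1 * exp (K * card E)"
      unfolding real_norm_def abs_mult by (intro mult_mono cb z) (use wb[OF z A] w0[OF z] in auto)
  qed measurable
  define bad where "bad = {A\<in>Pow E. \<exists>B\<in>W. B \<subseteq> A}"
  have zero: "(\<integral>z. ?c z * w A z \<partial>spins V) = 0" if A: "A \<in> Pow E - bad" for A
  proof -
    define C where "C = {y. (a, y) \<in> {(x, y). {x, y} \<in> A}\<^sup>*}"
    have AE: "A \<subseteq> E" using A by auto
    have CV: "C \<subseteq> V" using conn[OF AE] A by (auto simp: C_def bad_def)
    have aC: "a \<in> C" by (simp add: C_def)
    have AC: "src e \<in> C \<longleftrightarrow> tgt e \<in> C" if e: "e \<in> A" for e
    proof -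
      have "{src e, tgt e} \<in> A" "{tgt e, src e} \<in> A"
        using edge[of e] AE e by (auto simp: insert_commute)
      then show ?thesis unfolding C_def by (auto intro: rtrancl_into_rtrancl)
    qed
    \<comment> \<open>A quarter turn of the cluster: an edge of A has both ends or none in C, and C
      avoids the boundary, so only the observable changes, by a sign.\<close>
    define u where "u x = (if x \<in> C then \<i> else 1)" for x :: site
    have sp: "spin V (mulc V u z) x = u x * spin V z x" for z x
      using CV by (auto simp: spin_def mulc_def u_def)
    have ge: "g e (mulc V u z) = g e z" if e: "e \<in> A" for e z
    proof -
      have "u (src e) * cnj (u (tgt e)) = 1" using AC[OF e] by (auto simp: u_def)
      then have "edge_char V e (mulc V u z) = edge_char V e z"
        unfolding edge_char_def sp by (simp add: mult_ac)
      then show ?thesis by (simp add: g_def)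
    qed
    have "(\<integral>z. ?c z * w A z \<partial>spins V) = (\<integral>z. ?c (mulc V u z) * w A (mulc V u z) \<partial>spins V)"
      by (rule integral_spins_mulc[OF finV, symmetric]) (auto simp: u_def)
    also have "\<dots> = (\<integral>z. - (?c z * w A z) \<partial>spins V)"
      using ge aC by (intro Bochner_Integration.integral_cong refl) (simp add: w_def sp u_def power_mult_distrib)
    finally show ?thesis by simp
  qed
  have "xy_N V E (\<lambda>_. K) a = (\<integral>z. (\<Sum>A\<in>Pow E. ?c z * w A z) \<partial>spins V)"
    by (simp add: xy_N_def wsum sum_distrib_left)
  also have "\<dots> = (\<Sum>A\<in>Pow E. \<integral>z. ?c z * w A z \<partial>spins V)"
    by (rule Bochner_Integration.integral_sum) (use icw in auto)
  also have "\<dots> = (\<Sum>A\<in>bad. \<integral>z. ?c z * w A z \<partial>spins V)"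
    by (rule sum.mono_neutral_right) (use finE zero in \<open>auto simp: bad_def\<close>)
  also have "\<dots> \<le> (\<Sum>A\<in>bad. \<integral>z. w A z \<partial>spins V)"
  proof (rule sum_mono)
    fix A assume "A \<in> bad"
    then have A: "A \<subseteq> E" by (auto simp: bad_def)
    show "(\<integral>z. ?c z * w A z \<partial>spins V) \<le> (\<integral>z. w A z \<partial>spins V)"
    proof (rule Bochner_Integration.integral_mono[OF icw[OF A] iw[OF A]])
      fix z assume z: "z \<in> space (spins V)"
      have "?c z * w A z \<le> 1 * w A z" by (rule mult_right_mono) (use cb[OF z] w0[OF z] in auto)
      then show "?c z * w A z \<le> w A z" by simp
    qed
  qed
  also have "\<dots> = (\<integral>z. (\<Sum>A\<in>bad. w A z) \<partial>spins V)"
    by (rule Bochner_Integration.integral_sum[symmetric]) (use iw in \<open>auto simp: bad_def\<close>)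
  also have "\<dots> \<le> (\<integral>z. card W * p ^ n * xy_weight V E (\<lambda>_. K) z \<partial>spins V)"
  proof (rule Bochner_Integration.integral_mono)
    show "integrable (spins V) (\<lambda>z. \<Sum>A\<in>bad. w A z)"
      by (rule Bochner_Integration.integrable_sum) (use iw in \<open>auto simp: bad_def\<close>)
    show "integrable (spins V) (\<lambda>z. card W * p ^ n * xy_weight V E (\<lambda>_. K) z)"
      by (intro integrable_mult_right integrable_xy_weight1) (use K in auto)
    fix z assume z: "z \<in> space (spins V)"
    \<comment> \<open>Union bound; summing over all A that contain B restores the full factors on
      the edges outside B.\<close>
    have "(\<Sum>A\<in>bad. w A z) \<le> (\<Sum>A\<in>bad. \<Sum>B\<in>W. if B \<subseteq> A then w A z else 0)"
    proof (rule sum_mono)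
      fix A assume "A \<in> bad"
      then obtain B where B: "B \<in> W" "B \<subseteq> A" by (auto simp: bad_def)
      have "(if B \<subseteq> A then w A z else 0) \<le> (\<Sum>B\<in>W. if B \<subseteq> A then w A z else 0)"
        by (rule member_le_sum) (use B W w0[OF z] in auto)
      then show "w A z \<le> (\<Sum>B\<in>W. if B \<subseteq> A then w A z else 0)" using B by simp
    qed
    also have "\<dots> = (\<Sum>B\<in>W. \<Sum>A\<in>bad. if B \<subseteq> A then w A z else 0)" by (rule sum.swap)
    also have "\<dots> \<le> (\<Sum>B\<in>W. p ^ n * xy_weight V E (\<lambda>_. K) z)"
    proof (rule sum_mono)
      fix B assume B: "B \<in> W"
      then have BE: "B \<subseteq> E" "card B = n" using W by auto
      have "(\<Sum>A\<in>bad. if B \<subseteq> A then w A z else 0) = (\<Sum>A\<in>{A\<in>Pow E. B \<subseteq> A}. w A z)"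
        by (rule sum.mono_neutral_cong) (use finE B in \<open>auto simp: bad_def\<close>)
      also have "\<dots> = (\<Prod>e\<in>B. g e z) * (\<Prod>e\<in>E-B. g e z + exp (- K))"
        unfolding w_def by (rule sum_supersets_prod[OF finE BE(1)])
      also have "\<dots> \<le> (\<Prod>e\<in>B. p * (g e z + exp (- K))) * (\<Prod>e\<in>E-B. g e z + exp (- K))"
        using g0[OF z] gp[OF z] by (intro mult_right_mono prod_mono prod_nonneg) (auto intro: add_nonneg_nonneg)
      also have "\<dots> = p ^ n * ((\<Prod>e\<in>E-B. g e z + exp (- K)) * (\<Prod>e\<in>B. g e z + exp (- K)))"
        using BE by (simp add: prod.distrib)
      also have "(\<Prod>e\<in>E-B. g e z + exp (- K)) * (\<Prod>e\<in>B. g e z + exp (- K)) = xy_weight V E (\<lambda>_. K) z"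
        unfolding we by (rule prod.subset_diff[symmetric, OF BE(1) finE])
      finally show "(\<Sum>A\<in>bad. if B \<subseteq> A then w A z else 0) \<le> p ^ n * xy_weight V E (\<lambda>_. K) z" .
    qed
    finally show "(\<Sum>A\<in>bad. w A z) \<le> card W * p ^ n * xy_weight V E (\<lambda>_. K) z" by simp
  qed
  also have "\<dots> = card W * p ^ n * xy_Z V E (\<lambda>_. K)" by (simp add: xy_Z_def)
  finally show ?thesis
    using xy_Z_pos[of E "\<lambda>_. K" V] K by (simp add: xy_mag_def p_def divide_le_eq)
qed

section \<open>Long-range order from path averages\<close>

text \<open>\<open>exp (K * Re z) / vm_Z K\<close> is the von Mises density, the law of the noise on
  one edge; \<open>vm_r\<close> is the mean of the squared noise variable, the attenuation of an
  observed squared gradient.\<close>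

definition vm_Z :: "real \<Rightarrow> real" where "vm_Z K = (\<integral>z. exp (K * Re z) \<partial>circ)"

definition vm_r :: "real \<Rightarrow> real" where "vm_r K = (\<integral>z. Re (z\<^sup>2) * exp (K * Re z) \<partial>circ) / vm_Z K"

lemma integrable_circ_complex:
  fixes f :: "complex \<Rightarrow> complex"
  assumes "continuous_on UNIV f"
  shows "integrable circ f"
proof -
  have "compact (f ` sphere 0 1)"
    using assms by (intro compact_continuous_image) (auto intro: continuous_on_subset)
  then have "bounded (f ` sphere 0 1)" by (rule compact_imp_bounded)
  then obtain B where "\<forall>z\<in>sphere 0 1. norm (f z) \<le> B" unfolding bounded_iff by blast
  moreover have "f \<in> borel_measurable circ"
    using measurable_compose[OF measurable_circ_borel borel_measurable_continuous_onI[OF assms]] .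
  ultimately show ?thesis by (intro circ.integrable_bounded[where B=B]) auto
qed

lemma borel_measurable_complex_of_real:
  assumes "f \<in> borel_measurable M"
  shows "(\<lambda>x. complex_of_real (f x)) \<in> borel_measurable M"
  by (intro borel_measurable_continuous_on[where f=complex_of_real] continuous_intros assms)

lemma vm_Z_pos: "0 < vm_Z K"
proof -
  have "(\<integral>z. exp (- \<bar>K\<bar>) \<partial>circ) \<le> vm_Z K" unfolding vm_Z_def
  proof (rule Bochner_Integration.integral_mono)
    fix z :: complex assume "z \<in> space circ"
    then have "\<bar>K * Re z\<bar> \<le> \<bar>K\<bar>" using abs_Re_unit[of z] by (simp add: abs_mult mult_left_le)
    then show "exp (- \<bar>K\<bar>) \<le> exp (K * Re z)" by simp
  qed (auto intro!: integrable_circ continuous_intros)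
  then have "exp (- \<bar>K\<bar>) \<le> vm_Z K" by (simp add: circ.prob_space[simplified])
  then show ?thesis by (meson exp_gt_zero less_le_trans)
qed

text \<open>The mean is real by symmetry under conjugation; the imaginary part is removed here by an
  explicit primitive along the angle.\<close>

lemma vm_second_moment:
  assumes K: "0 < K"
  shows "(\<integral>z. z\<^sup>2 * of_real (exp (K * Re z)) \<partial>circ) = of_real (vm_r K * vm_Z K)"
proof (rule complex_eqI)
  have i: "integrable circ (\<lambda>z. z\<^sup>2 * of_real (exp (K * Re z)))"
    by (intro integrable_circ_complex continuous_intros)
  have "Re (\<integral>z. z\<^sup>2 * of_real (exp (K * Re z)) \<partial>circ) = (\<integral>z. Re (z\<^sup>2) * exp (K * Re z) \<partial>circ)"
    using i by (subst integral_Re[symmetric]) (auto simp: times_complex.sel(1)[of _ "complex_of_real _"])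
  then show "Re (\<integral>z. z\<^sup>2 * of_real (exp (K * Re z)) \<partial>circ) = Re (of_real (vm_r K * vm_Z K))"
    using vm_Z_pos[of K] by (simp add: vm_r_def)
  have "Im (\<integral>z. z\<^sup>2 * of_real (exp (K * Re z)) \<partial>circ) = (\<integral>z. 2 * (Re z * Im z * exp (K * Re z)) \<partial>circ)"
    by (subst integral_Im[symmetric, OF i], rule Bochner_Integration.integral_cong[OF refl])
       (simp add: times_complex.sel power2_eq_square)
  also have "\<dots> = 2 * (\<integral>z. Re z * Im z * exp (K * Re z) \<partial>circ)" by simp
  also have "(\<integral>z. Re z * Im z * exp (K * Re z) \<partial>circ) = 0"
  proof (rule integral_circ_deriv[where g="\<lambda>z. (1 / K\<^sup>2 - Re z / K) * exp (K * Re z)"])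
    fix t
    show "((\<lambda>t. (1 / K\<^sup>2 - Re (cis t) / K) * exp (K * Re (cis t))) has_real_derivative
        Re (cis t) * Im (cis t) * exp (K * Re (cis t))) (at t)"
      using K by (auto intro!: derivative_eq_intros simp: field_simps power2_eq_square)
  qed (intro continuous_intros)
  finally show "Im (\<integral>z. z\<^sup>2 * of_real (exp (K * Re z)) \<partial>circ) = Im (of_real (vm_r K * vm_Z K))"
    by (simp only: Im_complex_of_real mult_zero_right)
qed

text \<open>Differentiating Im z exp (K Re z) shows that K E[(Im z)^2] = E[Re z] <= 1 under the von
  Mises law, and Re (z^2) = 1 - 2 (Im z)^2 on the circle.\<close>

lemma vm_r_ge:
  assumes K: "0 < K"
  shows "1 - 2 / K \<le> vm_r K"
proof -
  let ?e = "\<lambda>z. exp (K * Re z)"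
  have i: "integrable circ (\<lambda>z. Re z * ?e z)" "integrable circ (\<lambda>z. (Im z)\<^sup>2 * ?e z)" "integrable circ ?e"
    by (auto intro!: integrable_circ continuous_intros)
  have "(\<integral>z. Re z * ?e z - K * ((Im z)\<^sup>2 * ?e z) \<partial>circ) = 0"
  proof (rule integral_circ_deriv[where g="\<lambda>z. Im z * ?e z"])
    fix t
    show "((\<lambda>t. Im (cis t) * exp (K * Re (cis t))) has_real_derivative
       Re (cis t) * exp (K * Re (cis t)) - K * ((Im (cis t))\<^sup>2 * exp (K * Re (cis t)))) (at t)"
      by (auto intro!: derivative_eq_intros simp: power2_eq_square)
  qed (intro continuous_intros)
  then have 1: "(\<integral>z. Re z * ?e z \<partial>circ) = K * (\<integral>z. (Im z)\<^sup>2 * ?e z \<partial>circ)"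
    using i by simp
  have 2: "(\<integral>z. Re z * ?e z \<partial>circ) \<le> vm_Z K" unfolding vm_Z_def
  proof (rule Bochner_Integration.integral_mono[OF i(1) i(3)])
    fix z :: complex assume "z \<in> space circ"
    then have "Re z \<le> 1" using abs_Re_unit[of z] by simp
    then show "Re z * ?e z \<le> ?e z" by simp
  qed
  have "(\<integral>z. Re (z\<^sup>2) * ?e z \<partial>circ) = (\<integral>z. ?e z - 2 * ((Im z)\<^sup>2 * ?e z) \<partial>circ)"
  proof (rule Bochner_Integration.integral_cong[OF refl])
    fix z :: complex assume "z \<in> space circ"
    then have "(Re z)\<^sup>2 = 1 - (Im z)\<^sup>2" using cmod_power2[of z] by simp
    then have "Re (z\<^sup>2) = 1 - 2 * (Im z)\<^sup>2"
      by (simp add: power2_eq_square times_complex.sel)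
    then show "Re (z\<^sup>2) * ?e z = ?e z - 2 * ((Im z)\<^sup>2 * ?e z)"
      by (simp only: left_diff_distrib mult_1_left mult.assoc)
  qed
  also have "\<dots> = vm_Z K - 2 * (\<integral>z. (Im z)\<^sup>2 * ?e z \<partial>circ)"
    unfolding vm_Z_def using i by simp
  also have "\<dots> \<ge> vm_Z K - 2 * (vm_Z K / K)"
    using 1 2 K by (simp add: field_simps)
  finally have "(1 - 2 / K) * vm_Z K \<le> (\<integral>z. Re (z\<^sup>2) * ?e z \<partial>circ)"
    by (simp add: algebra_simps)
  then show ?thesis using vm_Z_pos[of K] by (simp add: vm_r_def le_divide_eq)
qed

lemma integral_circ_rotate:
  fixes f :: "complex \<Rightarrow> 'b :: {banach, second_countable_topology}"
  assumes w: "norm w = 1" and f: "f \<in> borel_measurable borel"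
  shows "(\<integral>z. f (w * z) \<partial>circ) = (\<integral>z. f z \<partial>circ)"
proof -
  have m: "(\<lambda>z. w * z) \<in> measurable circ circ" by (rule measurable_circI) (auto simp: w norm_mult)
  have fm: "f \<in> borel_measurable circ" using measurable_compose[OF measurable_circ_borel f] .
  have "(\<integral>z. f z \<partial>distr circ circ (\<lambda>z. w * z)) = (\<integral>z. f (w * z) \<partial>circ)"
    by (rule integral_distr[OF m fm])
  then show ?thesis by (simp add: distr_rotate_circ w)
qed

text \<open>Couplings \<open>K Re (cnj (\<omega> e) * \<xi> e)\<close> with phases \<open>\<omega>\<close> cannot increase the magnetization. Average over
  \<open>\<omega>\<close> with the a priori weight, for which the phases are noisy observations of the gradients \<open>\<xi> e\<close>: the
  average T over paths of the products of the squared phases is then an estimator of the squared spin at a,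
  and the second moment of T only involves pairwise intersections of paths.\<close>

lemma (in wire_graph) xy_mag_path_bound:
  fixes C :: real
  assumes K: "0 < K" "0 < vm_r K"
    and \<Gamma>: "finite \<Gamma>" "\<Gamma> \<noteq> {}"
    and sub: "\<And>\<gamma>. \<gamma> \<in> \<Gamma> \<Longrightarrow> P \<gamma> \<subseteq> E"
    and tele: "\<And>\<gamma> z. \<gamma> \<in> \<Gamma> \<Longrightarrow> z \<in> space (spins V) \<Longrightarrow> (\<Prod>e\<in>P \<gamma>. edge_char V e z) = spin V z a"
    and C: "(\<Sum>\<gamma>\<in>\<Gamma>. \<Sum>\<gamma>'\<in>\<Gamma>. (1 / (vm_r K)\<^sup>2) ^ card (P \<gamma> \<inter> P \<gamma>')) \<le> C * (card \<Gamma>)\<^sup>2"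
  shows "1 \<le> xy_mag V E (\<lambda>_. K) a * ((1 + C) / 2)"
proof -
  define r where "r = vm_r K"
  have r: "0 < r" "r \<noteq> 0" using K by (auto simp: r_def)
  define w where "w \<zeta> = exp (K * Re \<zeta>) / vm_Z K" for \<zeta> :: complex
  have wc: "continuous_on UNIV w" unfolding w_def by (intro continuous_intros) (use vm_Z_pos[of K] in auto)
  have wb [measurable]: "w \<in> borel_measurable borel" by (rule borel_measurable_continuous_onI[OF wc])
  have w0: "0 < w \<zeta>" for \<zeta> using vm_Z_pos[of K] by (simp add: w_def)
  define B where "B = exp K / vm_Z K"
  have wB: "w \<zeta> \<le> B" if "norm \<zeta> = 1" for \<zeta>
  proof -
    have "K * Re \<zeta> \<le> K" using abs_Re_unit[OF that] K by simp
    then show ?thesis unfolding w_def B_def using vm_Z_pos[of K] by (intro divide_right_mono) auto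
  qed
  have B0: "0 \<le> B" using vm_Z_pos[of K] by (simp add: B_def)
  have W1: "(\<integral>\<zeta>. of_real (w \<zeta>) \<partial>circ) = (1::complex)"
    using vm_Z_pos[of K] by (simp add: w_def vm_Z_def[symmetric])
  have W2: "(\<integral>\<zeta>. \<zeta>\<^sup>2 * of_real (w \<zeta>) \<partial>circ) = of_real r"
  proof -
    have "(\<integral>\<zeta>. \<zeta>\<^sup>2 * of_real (w \<zeta>) \<partial>circ) = (\<integral>\<zeta>. \<zeta>\<^sup>2 * of_real (exp (K * Re \<zeta>)) / of_real (vm_Z K) \<partial>circ)"
      by (simp add: w_def)
    also have "\<dots> = of_real r"
      using vm_second_moment[OF K(1)] vm_Z_pos[of K] by (simp add: r_def)
    finally show ?thesis .
  qed
  have W2': "(\<integral>\<zeta>. (cnj \<zeta>)\<^sup>2 * of_real (w \<zeta>) \<partial>circ) = of_real r"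
  proof -
    have "(\<integral>\<zeta>. (cnj \<zeta>)\<^sup>2 * of_real (w \<zeta>) \<partial>circ) = (\<integral>\<zeta>. cnj (\<zeta>\<^sup>2 * of_real (w \<zeta>)) \<partial>circ)" by simp
    also have "\<dots> = cnj (\<integral>\<zeta>. \<zeta>\<^sup>2 * of_real (w \<zeta>) \<partial>circ)" by (rule Bochner_Integration.integral_cnj)
    finally show ?thesis by (simp add: W2)
  qed
  \<comment> \<open>A phase observed through the gradient c is c times a noise variable, so its
    square has mean r c^2.\<close>
  have M: "(\<integral>\<zeta>. \<zeta>\<^sup>2 * of_real (w (cnj c * \<zeta>)) \<partial>circ) = of_real r * c\<^sup>2"
    "(\<integral>\<zeta>. (cnj \<zeta>)\<^sup>2 * of_real (w (cnj c * \<zeta>)) \<partial>circ) = of_real r * (cnj c)\<^sup>2"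
    "(\<integral>\<zeta>. of_real (w (cnj c * \<zeta>)) \<partial>circ) = (1::complex)" if c: "norm c = 1" for c
  proof -
    have n: "norm (cnj c) = 1" using c by simp
    have cc: "c * cnj c = 1" using c by (simp add: complex_norm_square[symmetric])
    have m1: "(\<lambda>\<zeta>. (c * \<zeta>)\<^sup>2 * of_real (w \<zeta>)) \<in> borel_measurable borel"
      "(\<lambda>\<zeta>. (cnj (c * \<zeta>))\<^sup>2 * of_real (w \<zeta>)) \<in> borel_measurable borel"
      "(\<lambda>\<zeta>. of_real (w \<zeta>) :: complex) \<in> borel_measurable borel"
      using wc by (auto intro!: borel_measurable_continuous_onI continuous_intros)
    have e: "c * (cnj c * \<zeta>) = \<zeta>" for \<zeta> using cc by (simp add: mult.assoc[symmetric])
    show "(\<integral>\<zeta>. \<zeta>\<^sup>2 * of_real (w (cnj c * \<zeta>)) \<partial>circ) = of_real r * c\<^sup>2"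
      using integral_circ_rotate[OF n m1(1)] W2 by (simp only: e power_mult_distrib mult.assoc integral_mult_right_zero) (simp add: mult.commute)
    show "(\<integral>\<zeta>. (cnj \<zeta>)\<^sup>2 * of_real (w (cnj c * \<zeta>)) \<partial>circ) = of_real r * (cnj c)\<^sup>2"
      using integral_circ_rotate[OF n m1(2)] W2'
      by (simp only: e complex_cnj_mult power_mult_distrib mult.assoc integral_mult_right_zero) (simp add: mult.commute)
    show "(\<integral>\<zeta>. of_real (w (cnj c * \<zeta>)) \<partial>circ) = (1::complex)"
      using integral_circ_rotate[OF n m1(3)] W1 by simp
  qed
  let ?\<Omega> = "spins E"
  \<comment> \<open>The joint density of independent observations given z. Read as a function of z
    for fixed \<open>\<omega>\<close> it is, up to a constant, the Gibbs weight with phases; this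
    double role is the point of the Nishimori line.\<close>
  define WW where "WW \<omega> z = (\<Prod>e\<in>E. w (cnj (edge_char V e z) * \<omega> e))" for \<omega> z
  have em [measurable]: "(\<lambda>\<omega>. \<omega> e) \<in> borel_measurable ?\<Omega>" if "e \<in> E" for e by (rule measurable_spin[OF that])
  have n1: "norm (cnj (edge_char V e z) * \<omega> e) = 1" if "e \<in> E" "\<omega> \<in> space ?\<Omega>" "z \<in> space (spins V)" for e \<omega> z
    using that by (simp add: norm_mult norm_spin)
  have WW0: "0 < WW \<omega> z" for \<omega> z unfolding WW_def by (intro prod_pos) (simp add: w0)
  have WWB: "WW \<omega> z \<le> B ^ card E" if "\<omega> \<in> space ?\<Omega>" "z \<in> space (spins V)" for \<omega> z
  proof -
    have "WW \<omega> z \<le> (\<Prod>e\<in>E. B)" unfolding WW_def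
      by (intro prod_mono conjI wB n1 that less_imp_le[OF w0]) auto
    then show ?thesis by simp
  qed
  have pair_m: "(\<lambda>p. WW (fst p) (snd p)) \<in> borel_measurable (?\<Omega> \<Otimes>\<^sub>M spins V)"
  proof -
    have "(\<lambda>p. cnj (edge_char V e (snd p)) * fst p e) \<in> borel_measurable (?\<Omega> \<Otimes>\<^sub>M spins V)" if "e \<in> E" for e
      by (intro borel_measurable_times borel_measurable_cnj
          measurable_compose[OF measurable_snd measurable_edge_char] measurable_compose[OF measurable_fst em[OF that]])
    then show ?thesis unfolding WW_def
      by (intro borel_measurable_prod measurable_compose[OF _ wb]) auto
  qed
  define N where "N = real (card \<Gamma>)"
  have N: "0 < N" using \<Gamma> by (simp add: N_def card_gt_0_iff)
  \<comment> \<open>Dividing by r undoes the attenuation, so that each single path gives an unbiased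
    estimator of the squared spin at a.\<close>
  define q where "q \<gamma> \<omega> = (\<Prod>e\<in>P \<gamma>. (\<omega> e)\<^sup>2 / of_real r)" for \<gamma> and \<omega> :: "edge \<Rightarrow> complex"
  define T where "T \<omega> = (\<Sum>\<gamma>\<in>\<Gamma>. q \<gamma> \<omega>) / of_real N" for \<omega>
  have qm: "q \<gamma> \<in> borel_measurable ?\<Omega>" if "\<gamma> \<in> \<Gamma>" for \<gamma>
  proof -
    have "(\<lambda>\<omega>. \<omega> e) \<in> borel_measurable ?\<Omega>" if "e \<in> P \<gamma>" for e using sub[OF \<open>\<gamma> \<in> \<Gamma>\<close>] that em by blast
    then show ?thesis unfolding q_def by measurable
  qed
  have Tm [measurable]: "T \<in> borel_measurable ?\<Omega>" unfolding T_def using qm by measurable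
  have q_norm: "norm (q \<gamma> \<omega>) = (1 / r) ^ card (P \<gamma>)" if "\<gamma> \<in> \<Gamma>" "\<omega> \<in> space ?\<Omega>" for \<gamma> \<omega>
  proof -
    have "norm (q \<gamma> \<omega>) = (\<Prod>e\<in>P \<gamma>. 1 / r)"
      unfolding q_def prod_norm[symmetric]
      by (rule prod.cong[OF refl]) (use sub[OF that(1)] that(2) r in \<open>auto simp: norm_divide norm_power norm_spin\<close>)
    then show ?thesis by simp
  qed
  define TB where "TB = (\<Sum>\<gamma>\<in>\<Gamma>. (1 / r) ^ card (P \<gamma>)) / N"
  have TB: "norm (T \<omega>) \<le> TB" if "\<omega> \<in> space ?\<Omega>" for \<omega>
  proof -
    have "norm (\<Sum>\<gamma>\<in>\<Gamma>. q \<gamma> \<omega>) \<le> (\<Sum>\<gamma>\<in>\<Gamma>. (1 / r) ^ card (P \<gamma>))"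
      using q_norm that by (intro order.trans[OF norm_sum] sum_mono) auto
    then show ?thesis using N by (simp add: T_def TB_def norm_divide divide_right_mono)
  qed
  have prod_int: "(\<integral>\<omega>. (\<Prod>e\<in>E. h e (\<omega> e)) \<partial>?\<Omega>) = (\<Prod>e\<in>E. \<integral>\<zeta>. h e \<zeta> \<partial>circ)"
    if "\<And>e. e \<in> E \<Longrightarrow> continuous_on UNIV (h e)" for h :: "edge \<Rightarrow> complex \<Rightarrow> complex"
    unfolding spins_def by (rule circs.product_integral_prod[OF finE integrable_circ_complex]) (rule that)
  have wcc: "continuous_on UNIV (\<lambda>\<zeta>. w (c * \<zeta>))" for c
    by (rule continuous_on_compose2[OF wc]) (auto intro!: continuous_intros)
  have ifc: "continuous_on UNIV (\<lambda>\<zeta>. if b then f \<zeta> else g \<zeta>)"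
    if "continuous_on UNIV f" "continuous_on UNIV g" for b and f g :: "complex \<Rightarrow> complex"
    using that by (cases b) auto
  have unb: "(\<integral>\<omega>. cnj (T \<omega>) * of_real (WW \<omega> z) \<partial>?\<Omega>) = (cnj (spin V z a))\<^sup>2" if z: "z \<in> space (spins V)" for z
  proof -
    have one: "(\<integral>\<omega>. cnj (q \<gamma> \<omega>) * of_real (WW \<omega> z) \<partial>?\<Omega>) = (cnj (spin V z a))\<^sup>2" if g: "\<gamma> \<in> \<Gamma>" for \<gamma>
    proof -
      let ?h = "\<lambda>e \<zeta>. (if e \<in> P \<gamma> then (cnj \<zeta>)\<^sup>2 / of_real r else 1) * of_real (w (cnj (edge_char V e z) * \<zeta>))"
      have "cnj (q \<gamma> \<omega>) * of_real (WW \<omega> z) = (\<Prod>e\<in>E. ?h e (\<omega> e))" for \<omega>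
      proof -
        have "cnj (q \<gamma> \<omega>) = (\<Prod>e\<in>E. if e \<in> P \<gamma> then (cnj (\<omega> e))\<^sup>2 / of_real r else 1)"
          using sub[OF g] finE by (simp add: q_def prod.If_cases Int_absorb1)
        then show ?thesis by (simp add: WW_def prod.distrib)
      qed
      then have "(\<integral>\<omega>. cnj (q \<gamma> \<omega>) * of_real (WW \<omega> z) \<partial>?\<Omega>) = (\<Prod>e\<in>E. \<integral>\<zeta>. ?h e \<zeta> \<partial>circ)"
        by (simp only:) (rule prod_int, auto intro!: continuous_intros wcc ifc simp: r)
      also have "\<dots> = (\<Prod>e\<in>E. if e \<in> P \<gamma> then (cnj (edge_char V e z))\<^sup>2 else 1)"
      proof (rule prod.cong[OF refl])
        fix e assume "e \<in> E"
        have n: "norm (edge_char V e z) = 1" using z by simp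
        show "(\<integral>\<zeta>. ?h e \<zeta> \<partial>circ) = (if e \<in> P \<gamma> then (cnj (edge_char V e z))\<^sup>2 else 1)"
        proof (cases "e \<in> P \<gamma>")
          case True
          have "(\<integral>\<zeta>. ?h e \<zeta> \<partial>circ) = (\<integral>\<zeta>. ((cnj \<zeta>)\<^sup>2 * of_real (w (cnj (edge_char V e z) * \<zeta>))) / of_real r \<partial>circ)"
            using True by simp
          also have "\<dots> = (cnj (edge_char V e z))\<^sup>2"
            by (subst integral_divide_zero, subst M(2)[OF n]) (use r in simp)
          finally show ?thesis using True by simp
        qed (use M(3)[OF n] in simp)
      qed
      also have "\<dots> = (cnj (\<Prod>e\<in>P \<gamma>. edge_char V e z))\<^sup>2"
        using sub[OF g] finE by (simp add: prod.If_cases Int_absorb1 prod_power_distrib)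
      finally show ?thesis using tele[OF g z] by simp
    qed
    have int: "integrable ?\<Omega> (\<lambda>\<omega>. cnj (q \<gamma> \<omega>) * of_real (WW \<omega> z))" if g: "\<gamma> \<in> \<Gamma>" for \<gamma>
    proof (rule spins.integrable_bounded[where B="(1 / r) ^ card (P \<gamma>) * B ^ card E"])
      have "(\<lambda>\<omega>. WW \<omega> z) \<in> borel_measurable ?\<Omega>" using measurable_Pair1[OF pair_m] z by simp
      then show "(\<lambda>\<omega>. cnj (q \<gamma> \<omega>) * of_real (WW \<omega> z)) \<in> borel_measurable ?\<Omega>"
        by (intro borel_measurable_times borel_measurable_cnj qm[OF g] borel_measurable_complex_of_real)
      fix \<omega> assume o: "\<omega> \<in> space ?\<Omega>"
      show "norm (cnj (q \<gamma> \<omega>) * of_real (WW \<omega> z)) \<le> (1 / r) ^ card (P \<gamma>) * B ^ card E"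
        unfolding norm_mult complex_mod_cnj q_norm[OF g o] norm_of_real
        using WWB[OF o z] WW0[of \<omega> z] r by (intro mult_left_mono) auto
    qed
    have "(\<integral>\<omega>. cnj (T \<omega>) * of_real (WW \<omega> z) \<partial>?\<Omega>) = (\<integral>\<omega>. (\<Sum>\<gamma>\<in>\<Gamma>. cnj (q \<gamma> \<omega>) * of_real (WW \<omega> z)) / of_real N \<partial>?\<Omega>)"
      by (simp add: T_def sum_distrib_right)
    also have "\<dots> = (\<Sum>\<gamma>\<in>\<Gamma>. \<integral>\<omega>. cnj (q \<gamma> \<omega>) * of_real (WW \<omega> z) \<partial>?\<Omega>) / of_real N"
      using int by (subst integral_divide_zero) (simp add: Bochner_Integration.integral_sum)
    also have "\<dots> = (cnj (spin V z a))\<^sup>2" using one N by (simp add: N_def)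
    finally show ?thesis .
  qed
  have second: "(\<integral>\<omega>. (norm (T \<omega>))\<^sup>2 * WW \<omega> z \<partial>?\<Omega>) \<le> C" if z: "z \<in> space (spins V)" for z
  proof -
    have WWm: "(\<lambda>\<omega>. WW \<omega> z) \<in> borel_measurable ?\<Omega>" using measurable_Pair1[OF pair_m] z by simp
    \<comment> \<open>Independence over edges: on a common edge the two unit factors cancel and
      leave 1 / r^2, and on every other edge the mean has modulus 1.\<close>
    have one: "norm (\<integral>\<omega>. q \<gamma> \<omega> * cnj (q \<gamma>' \<omega>) * of_real (WW \<omega> z) \<partial>?\<Omega>) \<le> (1 / r\<^sup>2) ^ card (P \<gamma> \<inter> P \<gamma>')"
      if g: "\<gamma> \<in> \<Gamma>" "\<gamma>' \<in> \<Gamma>" for \<gamma> \<gamma>'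
    proof -
      let ?a = "\<lambda>e \<zeta>. (if e \<in> P \<gamma> then \<zeta>\<^sup>2 / of_real r else 1)"
      let ?b = "\<lambda>e \<zeta>. (if e \<in> P \<gamma>' then (cnj \<zeta>)\<^sup>2 / of_real r else 1)"
      let ?h = "\<lambda>e \<zeta>. ?a e \<zeta> * ?b e \<zeta> * of_real (w (cnj (edge_char V e z) * \<zeta>))"
      have "q \<gamma> \<omega> * cnj (q \<gamma>' \<omega>) * of_real (WW \<omega> z) = (\<Prod>e\<in>E. ?h e (\<omega> e))" for \<omega>
      proof -
        have "cnj (q \<gamma>' \<omega>) = (\<Prod>e\<in>E. ?b e (\<omega> e))" "q \<gamma> \<omega> = (\<Prod>e\<in>E. ?a e (\<omega> e))"
          using sub[OF g(1)] sub[OF g(2)] finE by (simp_all add: q_def prod.If_cases Int_absorb1)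
        then show ?thesis by (simp add: WW_def prod.distrib)
      qed
      then have "(\<integral>\<omega>. q \<gamma> \<omega> * cnj (q \<gamma>' \<omega>) * of_real (WW \<omega> z) \<partial>?\<Omega>) = (\<Prod>e\<in>E. \<integral>\<zeta>. ?h e \<zeta> \<partial>circ)"
        by (simp only:) (rule prod_int, auto intro!: continuous_intros wcc ifc simp: r)
      then have "norm (\<integral>\<omega>. q \<gamma> \<omega> * cnj (q \<gamma>' \<omega>) * of_real (WW \<omega> z) \<partial>?\<Omega>) = (\<Prod>e\<in>E. norm (\<integral>\<zeta>. ?h e \<zeta> \<partial>circ))"
        by (simp only: prod_norm)
      also have "\<dots> = (\<Prod>e\<in>E. if e \<in> P \<gamma> \<inter> P \<gamma>' then 1 / r\<^sup>2 else 1)"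
      proof (rule prod.cong[OF refl])
        fix e assume "e \<in> E"
        let ?w = "\<lambda>\<zeta>. of_real (w (cnj (edge_char V e z) * \<zeta>)) :: complex"
        have n: "norm (edge_char V e z) = 1" using z by simp
        consider "e \<in> P \<gamma> \<inter> P \<gamma>'" | "e \<in> P \<gamma>" "e \<notin> P \<gamma>'" | "e \<notin> P \<gamma>" "e \<in> P \<gamma>'" | "e \<notin> P \<gamma>" "e \<notin> P \<gamma>'" by blast
        then show "norm (\<integral>\<zeta>. ?h e \<zeta> \<partial>circ) = (if e \<in> P \<gamma> \<inter> P \<gamma>' then 1 / r\<^sup>2 else 1)"
        proof cases
          case 1
          have "(\<integral>\<zeta>. ?h e \<zeta> \<partial>circ) = (\<integral>\<zeta>. ?w \<zeta> / of_real (r\<^sup>2) \<partial>circ)"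
          proof (rule Bochner_Integration.integral_cong[OF refl])
            fix \<zeta> :: complex assume "\<zeta> \<in> space circ"
            then have "\<zeta> * cnj \<zeta> = 1" by (simp add: complex_norm_square[symmetric])
            then have "\<zeta>\<^sup>2 * (cnj \<zeta>)\<^sup>2 = 1" by (simp add: power_mult_distrib[symmetric])
            then show "?h e \<zeta> = ?w \<zeta> / of_real (r\<^sup>2)" using 1 by (simp add: power2_eq_square)
          qed
          also have "\<dots> = 1 / of_real (r\<^sup>2)" using M(3)[OF n] by simp
          finally show ?thesis using 1 r by (simp add: norm_divide norm_power)
        next
          case 2
          have "(\<integral>\<zeta>. ?h e \<zeta> \<partial>circ) = (\<integral>\<zeta>. (\<zeta>\<^sup>2 * ?w \<zeta>) / of_real r \<partial>circ)" using 2 by simp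
          also have "\<dots> = (edge_char V e z)\<^sup>2" by (subst integral_divide_zero, subst M(1)[OF n]) (use r in simp)
          finally show ?thesis using 2 n by (simp add: norm_power)
        next
          case 3
          have "(\<integral>\<zeta>. ?h e \<zeta> \<partial>circ) = (\<integral>\<zeta>. ((cnj \<zeta>)\<^sup>2 * ?w \<zeta>) / of_real r \<partial>circ)" using 3 by simp
          also have "\<dots> = (cnj (edge_char V e z))\<^sup>2" by (subst integral_divide_zero, subst M(2)[OF n]) (use r in simp)
          finally show ?thesis using 3 n by (simp add: norm_power)
        next
          case 4
          then show ?thesis using M(3)[OF n] by simp
        qed
      qed
      also have "\<dots> = (1 / r\<^sup>2) ^ card (P \<gamma> \<inter> P \<gamma>')"
      proof -
        have "E \<inter> {e. e \<in> P \<gamma> \<inter> P \<gamma>'} = P \<gamma> \<inter> P \<gamma>'" using sub[OF g(1)] by auto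
        then show ?thesis by (simp only: prod.If_cases[OF finE] prod_constant power_one mult_1_right)
      qed
      finally show ?thesis by simp
    qed
    have int: "integrable ?\<Omega> (\<lambda>\<omega>. q \<gamma> \<omega> * cnj (q \<gamma>' \<omega>) * of_real (WW \<omega> z))" if g: "\<gamma> \<in> \<Gamma>" "\<gamma>' \<in> \<Gamma>" for \<gamma> \<gamma>'
    proof (rule spins.integrable_bounded[where B="(1 / r) ^ card (P \<gamma>) * (1 / r) ^ card (P \<gamma>') * B ^ card E"])
      show "(\<lambda>\<omega>. q \<gamma> \<omega> * cnj (q \<gamma>' \<omega>) * of_real (WW \<omega> z)) \<in> borel_measurable ?\<Omega>"
        by (intro borel_measurable_times borel_measurable_cnj qm g borel_measurable_complex_of_real WWm)
      fix \<omega> assume o: "\<omega> \<in> space ?\<Omega>"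
      show "norm (q \<gamma> \<omega> * cnj (q \<gamma>' \<omega>) * of_real (WW \<omega> z)) \<le> (1 / r) ^ card (P \<gamma>) * (1 / r) ^ card (P \<gamma>') * B ^ card E"
        unfolding norm_mult complex_mod_cnj q_norm[OF g(1) o] q_norm[OF g(2) o] norm_of_real
        using WWB[OF o z] WW0[of \<omega> z] r by (intro mult_left_mono) auto
    qed
    have sq: "of_real ((norm (T \<omega>))\<^sup>2 * WW \<omega> z) =
      (\<Sum>\<gamma>\<in>\<Gamma>. \<Sum>\<gamma>'\<in>\<Gamma>. q \<gamma> \<omega> * cnj (q \<gamma>' \<omega>) * of_real (WW \<omega> z)) / of_real (N\<^sup>2)" for \<omega>
    proof -
      have "complex_of_real ((norm (T \<omega>))\<^sup>2) = T \<omega> * cnj (T \<omega>)" by (rule complex_norm_square)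
      also have "\<dots> = ((\<Sum>\<gamma>\<in>\<Gamma>. q \<gamma> \<omega>) * (\<Sum>\<gamma>\<in>\<Gamma>. cnj (q \<gamma> \<omega>))) / of_real (N\<^sup>2)"
        by (simp add: T_def power2_eq_square)
      finally have "complex_of_real ((norm (T \<omega>))\<^sup>2) * of_real (WW \<omega> z) =
        (\<Sum>\<gamma>\<in>\<Gamma>. q \<gamma> \<omega>) * (\<Sum>\<gamma>\<in>\<Gamma>. cnj (q \<gamma> \<omega>)) * of_real (WW \<omega> z) / of_real (N\<^sup>2)"
        by simp
      then show ?thesis
        unfolding of_real_mult sum_product unfolding sum_distrib_right .
    qed
    have "complex_of_real (\<integral>\<omega>. (norm (T \<omega>))\<^sup>2 * WW \<omega> z \<partial>?\<Omega>) = (\<integral>\<omega>. of_real ((norm (T \<omega>))\<^sup>2 * WW \<omega> z) \<partial>?\<Omega>)"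
      by (rule integral_complex_of_real[symmetric])
    also have "\<dots> = (\<Sum>\<gamma>\<in>\<Gamma>. \<Sum>\<gamma>'\<in>\<Gamma>. \<integral>\<omega>. q \<gamma> \<omega> * cnj (q \<gamma>' \<omega>) * of_real (WW \<omega> z) \<partial>?\<Omega>) / of_real (N\<^sup>2)"
      unfolding sq using int by (subst integral_divide_zero) (simp add: Bochner_Integration.integral_sum)
    finally have eq: "complex_of_real (\<integral>\<omega>. (norm (T \<omega>))\<^sup>2 * WW \<omega> z \<partial>?\<Omega>) =
      (\<Sum>\<gamma>\<in>\<Gamma>. \<Sum>\<gamma>'\<in>\<Gamma>. \<integral>\<omega>. q \<gamma> \<omega> * cnj (q \<gamma>' \<omega>) * of_real (WW \<omega> z) \<partial>?\<Omega>) / of_real (N\<^sup>2)" .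
    have "norm (\<integral>\<omega>. (norm (T \<omega>))\<^sup>2 * WW \<omega> z \<partial>?\<Omega>) =
      norm (complex_of_real (\<integral>\<omega>. (norm (T \<omega>))\<^sup>2 * WW \<omega> z \<partial>?\<Omega>))"
      by (rule norm_of_real[symmetric, unfolded real_norm_def[symmetric]])
    also have "\<dots> = norm (\<Sum>\<gamma>\<in>\<Gamma>. \<Sum>\<gamma>'\<in>\<Gamma>. \<integral>\<omega>. q \<gamma> \<omega> * cnj (q \<gamma>' \<omega>) * of_real (WW \<omega> z) \<partial>?\<Omega>) / N\<^sup>2"
      unfolding eq norm_divide norm_of_real by simp
    also have "\<dots> \<le> (\<Sum>\<gamma>\<in>\<Gamma>. \<Sum>\<gamma>'\<in>\<Gamma>. (1 / r\<^sup>2) ^ card (P \<gamma> \<inter> P \<gamma>')) / N\<^sup>2"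
      by (intro divide_right_mono order.trans[OF norm_sum] sum_mono one) auto
    also have "\<dots> \<le> C" using C N by (simp add: r_def N_def divide_le_eq)
    finally show ?thesis by simp
  qed
  define m where "m = xy_mag V E (\<lambda>_. K) a"
  have m0: "0 \<le> m" unfolding m_def by (rule xy_mag_nonneg) (use finV finE K in auto)
  define Zw where "Zw \<omega> = (\<integral>z. WW \<omega> z \<partial>spins V)" for \<omega>
  \<comment> \<open>For every fixed realization of the phases, Ginibre's inequality bounds the mean
    squared spin of the phased model by m in modulus.\<close>
  have mmp: "norm (\<integral>z. (spin V z a)\<^sup>2 * of_real (WW \<omega> z) \<partial>spins V) \<le> m * Zw \<omega>" if o: "\<omega> \<in> space ?\<Omega>" for \<omega>
  proof -
    let ?H = "\<lambda>z. exp (\<Sum>e\<in>E. K * Re (cnj (\<omega> e) * edge_char V e z))"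
    have WH: "WW \<omega> z = ?H z / vm_Z K ^ card E" for z
    proof -
      have "Re (cnj (edge_char V e z) * \<omega> e) = Re (cnj (\<omega> e) * edge_char V e z)" for e
        by (simp add: times_complex.sel mult.commute)
      then show ?thesis using finE by (simp add: WW_def w_def exp_sum prod_dividef)
    qed
    have Z: "0 < xy_Z V E (\<lambda>_. K)" by (rule xy_Z_pos) (use K in auto)
    have v: "0 < vm_Z K ^ card E" using vm_Z_pos[of K] by simp
    have "norm (\<integral>z. (spin V z a)\<^sup>2 * of_real (?H z) \<partial>spins V) * xy_Z V E (\<lambda>_. K) \<le>
      (\<integral>z. ?H z \<partial>spins V) * xy_N V E (\<lambda>_. K) a"
      by (rule xy_ginibre) (use finV finE K o norm_spin[OF o] in auto)
    then have "norm (\<integral>z. (spin V z a)\<^sup>2 * of_real (?H z) \<partial>spins V) \<le> m * (\<integral>z. ?H z \<partial>spins V)"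
      using Z by (simp add: m_def xy_mag_def field_simps)
    then have "norm (\<integral>z. (spin V z a)\<^sup>2 * of_real (?H z) \<partial>spins V) / vm_Z K ^ card E \<le> m * (\<integral>z. ?H z \<partial>spins V) / vm_Z K ^ card E"
      using v by (intro divide_right_mono) auto
    moreover have "(\<integral>z. (spin V z a)\<^sup>2 * of_real (WW \<omega> z) \<partial>spins V) =
      (\<integral>z. (spin V z a)\<^sup>2 * of_real (?H z) \<partial>spins V) / of_real (vm_Z K ^ card E)"
      unfolding integral_divide_zero[symmetric]
      by (rule Bochner_Integration.integral_cong[OF refl]) (simp add: WH)
    moreover have "Zw \<omega> = (\<integral>z. ?H z \<partial>spins V) / vm_Z K ^ card E"
      by (simp add: Zw_def WH)
    ultimately show ?thesis using vm_Z_pos[of K] by (simp add: norm_divide norm_power abs_of_pos)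
  qed
  have TW0: "0 \<le> TB" using q_norm r N by (auto simp: TB_def intro!: divide_nonneg_nonneg sum_nonneg)
  have fb1: "norm (cnj (T (fst (\<omega>, z))) * ((spin V (snd (\<omega>, z)) a)\<^sup>2 * of_real (WW (fst (\<omega>, z)) (snd (\<omega>, z))))) \<le> TB * B ^ card E"
    if "\<omega> \<in> space ?\<Omega>" "z \<in> space (spins V)" for \<omega> z
  proof -
    have "norm (T \<omega>) * (norm (spin V z a) ^ 2 * \<bar>WW \<omega> z\<bar>) \<le> TB * (1 * B ^ card E)"
      using WWB[OF that] WW0[of \<omega> z] TB[OF that(1)] TW0 that(2) by (intro mult_mono) auto
    then show ?thesis by (simp add: norm_mult norm_power)
  qed
  have sm: "(\<lambda>p. spin V (snd p) a) \<in> borel_measurable (?\<Omega> \<Otimes>\<^sub>M spins V)"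
    by (rule measurable_compose[OF measurable_snd measurable_spin_ext])
  have Tfm: "(\<lambda>p. T (fst p)) \<in> borel_measurable (?\<Omega> \<Otimes>\<^sub>M spins V)"
    by (rule measurable_compose[OF measurable_fst Tm])
  let ?F = "\<lambda>p. cnj (T (fst p)) * ((spin V (snd p) a)\<^sup>2 * of_real (WW (fst p) (snd p)))"
  have Fm: "?F \<in> borel_measurable (?\<Omega> \<Otimes>\<^sub>M spins V)"
    by (intro borel_measurable_times borel_measurable_cnj borel_measurable_power borel_measurable_complex_of_real sm Tfm pair_m)
  \<comment> \<open>By unbiasedness the correlation of T with the squared spin is exactly 1;
    integrating over z first, the same quantity is controlled by m.\<close>
  have "(\<integral>\<omega>. (\<integral>z. cnj (T \<omega>) * ((spin V z a)\<^sup>2 * of_real (WW \<omega> z)) \<partial>spins V) \<partial>?\<Omega>) =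
    (\<integral>z. (\<integral>\<omega>. cnj (T \<omega>) * ((spin V z a)\<^sup>2 * of_real (WW \<omega> z)) \<partial>?\<Omega>) \<partial>spins V)"
    using spins.integral_prod_bounded(1,2)[where f="?F", OF prob_space_spins Fm fb1] by simp
  also have "\<dots> = (\<integral>z. 1 \<partial>spins V)"
  proof (rule Bochner_Integration.integral_cong[OF refl])
    fix z assume z: "z \<in> space (spins V)"
    have "(\<integral>\<omega>. cnj (T \<omega>) * ((spin V z a)\<^sup>2 * of_real (WW \<omega> z)) \<partial>?\<Omega>) =
      (\<integral>\<omega>. (spin V z a)\<^sup>2 * (cnj (T \<omega>) * of_real (WW \<omega> z)) \<partial>?\<Omega>)" by (simp add: mult_ac)
    also have "\<dots> = (spin V z a * cnj (spin V z a))\<^sup>2" by (simp add: unb[OF z] power_mult_distrib)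
    also have "\<dots> = 1" using z by (simp add: complex_norm_square[symmetric])
    finally show "(\<integral>\<omega>. cnj (T \<omega>) * ((spin V z a)\<^sup>2 * of_real (WW \<omega> z)) \<partial>?\<Omega>) = 1" .
  qed
  also have "\<dots> = (1::complex)" by (simp add: spins.prob_space[simplified])
  finally have eq1: "(\<integral>\<omega>. cnj (T \<omega>) * (\<integral>z. (spin V z a)\<^sup>2 * of_real (WW \<omega> z) \<partial>spins V) \<partial>?\<Omega>) = 1" by simp
  have Zm: "Zw \<in> borel_measurable ?\<Omega>"
    unfolding Zw_def using pair_m by (intro spins.borel_measurable_lebesgue_integral) (simp add: split_beta')
  have Z0: "0 \<le> Zw \<omega>" for \<omega> unfolding Zw_def using WW0 by (intro integral_nonneg_AE AE_I2) (simp add: less_imp_le)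
  have iWW: "integrable (spins V) (WW \<omega>)" if "\<omega> \<in> space ?\<Omega>" for \<omega>
    by (rule spins.integrable_bounded[where B="B ^ card E"])
       (use measurable_Pair2[OF pair_m] that WWB[OF that] WW0 in \<open>auto simp: less_imp_le\<close>)
  have ZB: "Zw \<omega> \<le> B ^ card E" if "\<omega> \<in> space ?\<Omega>" for \<omega>
  proof -
    have "Zw \<omega> \<le> (\<integral>z. B ^ card E \<partial>spins V)" unfolding Zw_def
      by (rule Bochner_Integration.integral_mono[OF iWW[OF that]]) (use WWB[OF that] in auto)
    then show ?thesis by (simp add: spins.prob_space[simplified])
  qed
  have iZ: "integrable ?\<Omega> (\<lambda>\<omega>. f \<omega> * Zw \<omega>)"
    if "f \<in> borel_measurable ?\<Omega>" "\<And>\<omega>. \<omega> \<in> space ?\<Omega> \<Longrightarrow> \<bar>f \<omega>\<bar> \<le> c" for f c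
  proof (rule spins.integrable_bounded[where B="c * B ^ card E"])
    show "(\<lambda>\<omega>. f \<omega> * Zw \<omega>) \<in> borel_measurable ?\<Omega>" using that(1) Zm by measurable
    fix \<omega> assume o: "\<omega> \<in> space ?\<Omega>"
    show "norm (f \<omega> * Zw \<omega>) \<le> c * B ^ card E"
      unfolding real_norm_def abs_mult using that(2)[OF o] ZB[OF o] Z0[of \<omega>] by (intro mult_mono) auto
  qed
  have fubR: "(\<integral>\<omega>. f \<omega> * Zw \<omega> \<partial>?\<Omega>) = (\<integral>z. (\<integral>\<omega>. f \<omega> * WW \<omega> z \<partial>?\<Omega>) \<partial>spins V)"
    if f: "f \<in> borel_measurable ?\<Omega>" "\<And>\<omega>. \<omega> \<in> space ?\<Omega> \<Longrightarrow> \<bar>f \<omega>\<bar> \<le> c" for f :: "_ \<Rightarrow> real" and c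
  proof -
    let ?G = "\<lambda>p. f (fst p) * WW (fst p) (snd p)"
    have m: "?G \<in> borel_measurable (?\<Omega> \<Otimes>\<^sub>M spins V)"
      by (intro borel_measurable_times pair_m measurable_compose[OF measurable_fst f(1)])
    have b: "norm (?G (\<omega>, z)) \<le> c * B ^ card E" if "\<omega> \<in> space ?\<Omega>" "z \<in> space (spins V)" for \<omega> z
    proof -
      have "\<bar>f \<omega>\<bar> * \<bar>WW \<omega> z\<bar> \<le> c * B ^ card E"
        using WWB[OF that] WW0[of \<omega> z] f(2)[OF that(1)] by (intro mult_mono) auto
      then show ?thesis by (simp add: abs_mult)
    qed
    show ?thesis
      using spins.integral_prod_bounded(1,2)[where f="?G", OF prob_space_spins m b] by (simp add: Zw_def)
  qed
  have Tn: "(\<lambda>\<omega>. norm (T \<omega>)) \<in> borel_measurable ?\<Omega>" by measurable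
  have "1 = norm (\<integral>\<omega>. cnj (T \<omega>) * (\<integral>z. (spin V z a)\<^sup>2 * of_real (WW \<omega> z) \<partial>spins V) \<partial>?\<Omega>)"
    unfolding eq1 by simp
  also have "\<dots> \<le> (\<integral>\<omega>. norm (cnj (T \<omega>) * (\<integral>z. (spin V z a)\<^sup>2 * of_real (WW \<omega> z) \<partial>spins V)) \<partial>?\<Omega>)"
    by (rule integral_norm_bound)
  also have "\<dots> \<le> (\<integral>\<omega>. m * ((1 + (norm (T \<omega>))\<^sup>2) / 2 * Zw \<omega>) \<partial>?\<Omega>)"
  proof (rule integral_mono')
    show "integrable ?\<Omega> (\<lambda>\<omega>. m * ((1 + (norm (T \<omega>))\<^sup>2) / 2 * Zw \<omega>))"
    proof (intro integrable_mult_right iZ)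
      show "(\<lambda>\<omega>. (1 + (norm (T \<omega>))\<^sup>2) / 2) \<in> borel_measurable ?\<Omega>" using Tn by measurable
      show "\<bar>(1 + (norm (T \<omega>))\<^sup>2) / 2\<bar> \<le> (1 + TB\<^sup>2) / 2" if "\<omega> \<in> space ?\<Omega>" for \<omega>
        using power_mono[OF TB[OF that] norm_ge_zero, of 2] by simp
    qed
    fix \<omega> assume o: "\<omega> \<in> space ?\<Omega>"
    \<comment> \<open>The elementary bound x <= (1 + x^2) / 2 takes the place of Cauchy-Schwarz and
      accounts for the factor (1 + C) / 2.\<close>
    have "norm (T \<omega>) \<le> (1 + (norm (T \<omega>))\<^sup>2) / 2"
      using zero_le_power2[of "norm (T \<omega>) - 1"] by (simp add: power2_diff)
    then have "norm (T \<omega>) * (m * Zw \<omega>) \<le> (1 + (norm (T \<omega>))\<^sup>2) / 2 * (m * Zw \<omega>)"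
      using m0 Z0[of \<omega>] by (intro mult_right_mono) auto
    moreover have "norm (T \<omega>) * norm (\<integral>z. (spin V z a)\<^sup>2 * of_real (WW \<omega> z) \<partial>spins V) \<le> norm (T \<omega>) * (m * Zw \<omega>)"
      by (intro mult_left_mono mmp[OF o]) auto
    ultimately show "norm (cnj (T \<omega>) * (\<integral>z. (spin V z a)\<^sup>2 * of_real (WW \<omega> z) \<partial>spins V)) \<le> m * ((1 + (norm (T \<omega>))\<^sup>2) / 2 * Zw \<omega>)"
      by (simp add: norm_mult mult_ac)
    show "0 \<le> m * ((1 + (norm (T \<omega>))\<^sup>2) / 2 * Zw \<omega>)"
      using m0 Z0[of \<omega>] by (auto intro!: mult_nonneg_nonneg divide_nonneg_nonneg add_nonneg_nonneg)
  qed
  also have "\<dots> = m * ((\<integral>\<omega>. 1 * Zw \<omega> \<partial>?\<Omega>) + (\<integral>\<omega>. (norm (T \<omega>))\<^sup>2 * Zw \<omega> \<partial>?\<Omega>)) / 2"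
  proof -
    have i1: "integrable ?\<Omega> (\<lambda>\<omega>. 1 * Zw \<omega>)" by (rule iZ[where c=1]) auto
    have i2: "integrable ?\<Omega> (\<lambda>\<omega>. (norm (T \<omega>))\<^sup>2 * Zw \<omega>)"
    proof (rule iZ[where c="TB\<^sup>2"])
      show "(\<lambda>\<omega>. (norm (T \<omega>))\<^sup>2) \<in> borel_measurable ?\<Omega>" using Tn by measurable
      show "\<bar>(norm (T \<omega>))\<^sup>2\<bar> \<le> TB\<^sup>2" if "\<omega> \<in> space ?\<Omega>" for \<omega>
        using power_mono[OF TB[OF that] norm_ge_zero, of 2] by simp
    qed
    have "(\<integral>\<omega>. (1 + (norm (T \<omega>))\<^sup>2) / 2 * Zw \<omega> \<partial>?\<Omega>) = (\<integral>\<omega>. (1 * Zw \<omega> + (norm (T \<omega>))\<^sup>2 * Zw \<omega>) / 2 \<partial>?\<Omega>)"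
      by (simp add: field_simps)
    then show ?thesis using i1 i2 by simp
  qed
  also have "(\<integral>\<omega>. 1 * Zw \<omega> \<partial>?\<Omega>) = 1"
  proof -
    have "(\<integral>\<omega>. WW \<omega> z \<partial>?\<Omega>) = 1" if z: "z \<in> space (spins V)" for z
    proof -
      have "complex_of_real (\<integral>\<omega>. WW \<omega> z \<partial>?\<Omega>) = (\<integral>\<omega>. (\<Prod>e\<in>E. of_real (w (cnj (edge_char V e z) * \<omega> e))) \<partial>?\<Omega>)"
        unfolding integral_complex_of_real[symmetric] by (simp add: WW_def)
      also have "\<dots> = (\<Prod>e\<in>E. \<integral>\<zeta>. of_real (w (cnj (edge_char V e z) * \<zeta>)) \<partial>circ)"
        by (rule prod_int) (intro continuous_intros wcc)
      also have "\<dots> = 1" using M(3) z by simp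
      finally show ?thesis by simp
    qed
    then have "(\<integral>z. (\<integral>\<omega>. 1 * WW \<omega> z \<partial>?\<Omega>) \<partial>spins V) = (\<integral>z. 1 \<partial>spins V)"
      by (intro Bochner_Integration.integral_cong refl) simp
    then show ?thesis using fubR[of "\<lambda>_. 1" 1] by (simp add: spins.prob_space[simplified])
  qed
  also have "m * (1 + (\<integral>\<omega>. (norm (T \<omega>))\<^sup>2 * Zw \<omega> \<partial>?\<Omega>)) / 2 \<le> m * (1 + C) / 2"
  proof -
    have m2: "(\<lambda>\<omega>. (norm (T \<omega>))\<^sup>2) \<in> borel_measurable ?\<Omega>" using Tn by measurable
    have b2: "\<bar>(norm (T \<omega>))\<^sup>2\<bar> \<le> TB\<^sup>2" if "\<omega> \<in> space ?\<Omega>" for \<omega>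
      using power_mono[OF TB[OF that] norm_ge_zero, of 2] by simp
    have C0: "0 \<le> C"
    proof -
      have "0 \<le> (\<Sum>\<gamma>\<in>\<Gamma>. \<Sum>\<gamma>'\<in>\<Gamma>. (1 / (vm_r K)\<^sup>2) ^ card (P \<gamma> \<inter> P \<gamma>'))"
        by (intro sum_nonneg) auto
      with C have "0 \<le> C * (card \<Gamma>)\<^sup>2" by linarith
      then show ?thesis using N by (simp add: N_def zero_le_mult_iff)
    qed
    have "(\<integral>\<omega>. (norm (T \<omega>))\<^sup>2 * Zw \<omega> \<partial>?\<Omega>) = (\<integral>z. (\<integral>\<omega>. (norm (T \<omega>))\<^sup>2 * WW \<omega> z \<partial>?\<Omega>) \<partial>spins V)"
      by (rule fubR[where c="TB\<^sup>2"]) (use m2 b2 in auto)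
    also have "\<dots> \<le> (\<integral>z. C \<partial>spins V)"
      by (rule Bochner_Integration.integral_mono') (use second C0 in auto)
    finally have "(\<integral>\<omega>. (norm (T \<omega>))\<^sup>2 * Zw \<omega> \<partial>?\<Omega>) \<le> (\<integral>z. C \<partial>spins V)" .
    then have "(\<integral>\<omega>. (norm (T \<omega>))\<^sup>2 * Zw \<omega> \<partial>?\<Omega>) \<le> C" by (simp add: spins.prob_space[simplified])
    then show ?thesis using m0 by (intro divide_right_mono mult_left_mono) auto
  qed
  finally show ?thesis by (simp add: m_def)
qed

section \<open>The box\<close>

lemma nn_sym:
  assumes "nn x y"
  shows "nn y x"
proof -
  have l: "length x = length y" and s: "(\<Sum>i<length x. \<bar>x ! i - y ! i\<bar>) = 1" using assms by (auto simp: nn_def)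
  have "(\<Sum>i<length y. \<bar>y ! i - x ! i\<bar>) = (\<Sum>i<length x. \<bar>x ! i - y ! i\<bar>)"
    using l by (simp add: abs_minus_commute)
  then show ?thesis using l s by (simp add: nn_def)
qed

lemma nn_length: "nn x y \<Longrightarrow> length y = length x"
  by (simp add: nn_def)

lemma nn_step:
  assumes "nn x y"
  obtains i s where "i < length x" "s \<in> {1, -1}" "y = x[i := x ! i + s]"
proof -
  let ?n = "length x" and ?d = "\<lambda>j. \<bar>x ! j - y ! j\<bar>"
  have l: "length y = ?n" and s: "(\<Sum>j<?n. ?d j) = 1" using assms by (auto simp: nn_def)
  have "\<exists>i<?n. ?d i \<noteq> 0"
  proof (rule ccontr)
    assume "\<not> ?thesis"
    then have "(\<Sum>j<?n. ?d j) = 0" by (intro sum.neutral) auto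
    then show False using s by simp
  qed
  then obtain i where i: "i < ?n" "?d i \<noteq> 0" by blast
  have "(\<Sum>j<?n. ?d j) = ?d i + (\<Sum>j\<in>{..<?n} - {i}. ?d j)" using i by (subst sum.remove) auto
  moreover have "0 \<le> (\<Sum>j\<in>{..<?n} - {i}. ?d j)" by (intro sum_nonneg) simp
  moreover have "1 \<le> ?d i" using i by linarith
  ultimately have di: "?d i = 1" and z: "(\<Sum>j\<in>{..<?n} - {i}. ?d j) = 0" using s by linarith+
  have "y ! j = x ! j" if "j < ?n" "j \<noteq> i" for j
    using z that by (subst (asm) sum_nonneg_eq_0_iff) auto
  moreover have "y ! i = x ! i + (y ! i - x ! i)" by simp
  ultimately have "y = x[i := x ! i + (y ! i - x ! i)]"
    using l i by (intro nth_equalityI) (auto simp: nth_list_update)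
  moreover have "y ! i - x ! i \<in> {1, -1}" using di by auto
  ultimately show ?thesis using that i by blast
qed

lemma nn_coord:
  assumes "nn x y" "i < length x"
  shows "\<bar>y ! i - x ! i\<bar> \<le> 1"
proof -
  obtain j s where "j < length x" "s \<in> {1, -1}" "y = x[j := x ! j + s]" using nn_step[OF assms(1)] .
  then show ?thesis using assms(2) by (cases "i = j") auto
qed

lemma nn_sum_list:
  assumes "nn x y"
  shows "sum_list y = sum_list x + 1 \<or> sum_list y = sum_list x - 1"
proof -
  obtain j s where j: "j < length x" "s \<in> {1, -1}" "y = x[j := x ! j + s]" using nn_step[OF assms] .
  have "sum_list y = (\<Sum>i\<in>{0..<length x}. y ! i)" using j by (simp add: sum_list_sum_nth)
  also have "\<dots> = y ! j + (\<Sum>i\<in>{0..<length x} - {j}. y ! i)" using j by (subst sum.remove[of _ j]) auto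
  also have "(\<Sum>i\<in>{0..<length x} - {j}. y ! i) = (\<Sum>i\<in>{0..<length x} - {j}. x ! i)"
    using j by (intro sum.cong) auto
  also have "y ! j = s + x ! j" using j by simp
  also have "s + x ! j + (\<Sum>i\<in>{0..<length x} - {j}. x ! i) = s + (\<Sum>i\<in>{0..<length x}. x ! i)"
    using j by (subst (2) sum.remove[of _ j]) auto
  also have "\<dots> = s + sum_list x" by (simp add: sum_list_sum_nth)
  finally show ?thesis using j by auto
qed

lemma src_tgt:
  assumes "sum_list x < sum_list y"
  shows "src {x, y} = x" "tgt {x, y} = y"
proof -
  show s: "src {x, y} = x" unfolding src_def by (rule the_equality) (use assms in auto)
  show "tgt {x, y} = y" unfolding tgt_def s by (rule other_end_eq) (use assms in auto)
qed

lemma nn_src_tgt: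
  assumes "nn x y"
  shows "(src {x, y} = x \<and> tgt {x, y} = y) \<or> (src {x, y} = y \<and> tgt {x, y} = x)"
proof (cases "sum_list x < sum_list y")
  case True then show ?thesis using src_tgt by blast
next
  case False
  then have "sum_list y < sum_list x" using nn_sum_list[OF assms] by auto
  from src_tgt[OF this] show ?thesis by (simp add: insert_commute)
qed

definition neighbours :: "site \<Rightarrow> site set" where
  "neighbours x = (\<lambda>(i, s). x[i := x ! i + s]) ` ({..<length x} \<times> {1, -1})"

lemma nn_neighbours: "nn x y \<Longrightarrow> y \<in> neighbours x"
  by (erule nn_step) (auto simp: neighbours_def)

lemma finite_neighbours: "finite (neighbours x)"
  by (simp add: neighbours_def)

lemma card_neighbours: "card (neighbours x) \<le> 2 * length x"
proof -
  have "card (neighbours x) \<le> card ({..<length x} \<times> {1, -1 :: int})"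
    unfolding neighbours_def by (rule card_image_le) simp
  then show ?thesis by (simp add: card_cartesian_product)
qed

lemma box_edges_eq: "box_edges d L = {{x, y} | x y. x \<in> box d L \<and> nn x y}"
proof -
  have "y \<in> box d L \<union> box_boundary d L" if "x \<in> box d L" "nn x y" for x y
  proof -
    have "length y = d" using that nn_length by (auto simp: box_def)
    then show ?thesis using that by (auto simp: box_boundary_def)
  qed
  then show ?thesis unfolding box_edges_def by blast
qed

lemma finite_box: "finite (box d L)"
proof (rule finite_subset)
  show "box d L \<subseteq> {xs. set xs \<subseteq> {- int L..int L} \<and> length xs = d}"
    by (auto simp: box_def in_set_conv_nth abs_le_iff) (smt (verit))
  show "finite {xs. set xs \<subseteq> {- int L..int L} \<and> length xs = d}"
    by (rule finite_lists_length_eq) simp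
qed

lemma finite_box_edges: "finite (box_edges d L)"
proof (rule finite_subset)
  show "box_edges d L \<subseteq> (\<lambda>(x, y). {x, y}) ` (SIGMA x:box d L. neighbours x)"
  proof
    fix e assume "e \<in> box_edges d L"
    then obtain x y where "e = {x, y}" "x \<in> box d L" "nn x y" by (auto simp: box_edges_eq)
    then show "e \<in> (\<lambda>(x, y). {x, y}) ` (SIGMA x:box d L. neighbours x)"
      using nn_neighbours by (intro image_eqI[where x="(x, y)"]) auto
  qed
  show "finite ((\<lambda>(x, y). {x, y}) ` (SIGMA x:box d L. neighbours x))"
    using finite_box finite_neighbours by auto
qed

lemma origin_box: "origin d \<in> box d L"
  by (simp add: origin_def box_def)

lemma box_edge_src_tgt:
  assumes "e \<in> box_edges d L"
  shows "e = {src e, tgt e}" "src e \<noteq> tgt e" "nn (src e) (tgt e)" "src e \<in> box d L \<or> tgt e \<in> box d L"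
proof -
  obtain x y where e: "e = {x, y}" "x \<in> box d L" "nn x y" using assms by (auto simp: box_edges_eq)
  have "x \<noteq> y" using nn_sum_list[OF e(3)] by auto
  with nn_src_tgt[OF e(3)] e nn_sym[OF e(3)]
  show "e = {src e, tgt e}" "src e \<noteq> tgt e" "nn (src e) (tgt e)" "src e \<in> box d L \<or> tgt e \<in> box d L"
    by auto
qed

lemma wire_graph_box: "wire_graph (box d L) (box_edges d L) (origin d)"
  by unfold_locales (use finite_box finite_box_edges origin_box box_edge_src_tgt in auto)

section \<open>Finite-volume magnetization and its limit\<close>

definition box_mag :: "nat \<Rightarrow> real \<Rightarrow> nat \<Rightarrow> real" where
  "box_mag d K L = xy_mag (box d L) (box_edges d L) (\<lambda>_. K) (origin d)"

lemma m_L_eq: "0 \<le> J \<Longrightarrow> m_L d J L = box_mag d (2 * J) L"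
  unfolding m_L_def box_mag_def by (rule wire_graph.wire_expect_eq_xy_mag[OF wire_graph_box])

lemma box_mag_nonneg: "0 \<le> K \<Longrightarrow> 0 \<le> box_mag d K L"
  unfolding box_mag_def by (rule xy_mag_nonneg[OF finite_box finite_box_edges])

lemma box_mag_mono: "0 \<le> K \<Longrightarrow> K \<le> K' \<Longrightarrow> box_mag d K L \<le> box_mag d K' L"
  unfolding box_mag_def by (rule xy_mag_mono_K[OF finite_box finite_box_edges]) simp

lemma box_mag_decseq:
  assumes "0 \<le> K"
  shows "decseq (box_mag d K)"
proof (rule decseq_SucI)
  fix L
  have sub: "box d L \<subseteq> box d (Suc L)" by (auto simp: box_def)
  show "box_mag d K (Suc L) \<le> box_mag d K L"
    unfolding box_mag_def
  proof (rule xy_mag_antimono_volume[OF finite_box finite_box_edges sub _ origin_box])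
    show "box_edges d L \<subseteq> box_edges d (Suc L)" using sub by (auto simp: box_edges_eq)
    fix e assume e: "e \<in> box_edges d (Suc L) - box_edges d L"
    then have e': "e \<in> box_edges d (Suc L)" by simp
    note st = box_edge_src_tgt[OF e']
    have "{src e, tgt e} \<notin> box_edges d L" using e st(1) by simp
    \<comment> \<open>\<open>box_edges\<close> contains every lattice edge with an end in the box,
      so a new edge has none.\<close>
    then show "src e \<notin> box d L \<and> tgt e \<notin> box d L"
      using st(3) nn_sym[OF st(3)] unfolding box_edges_eq by (auto simp: insert_commute)
  qed (use assms in auto)
qed

text \<open>Padding with zeros embeds the smaller lattice as a coordinate subspace. It preserves
  coordinate sums, hence the orientation of edges, and sends boundary sites to sites outside the
  larger box.\<close>

lemma box_mag_mono_dim: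
  assumes K: "0 \<le> K" and d: "d \<le> d'"
  shows "box_mag d K L \<le> box_mag d' K L"
proof -
  define f where "f x = x @ replicate (d' - d) (0::int)" for x
  have fs: "sum_list (f x) = sum_list x" for x by (simp add: f_def sum_list_replicate)
  have inj: "inj f" by (simp add: f_def inj_def)
  have fb: "f x \<in> box d' L \<longleftrightarrow> x \<in> box d L" if "length x = d" for x
  proof
    assume "f x \<in> box d' L"
    then have "\<bar>f x ! i\<bar> \<le> int L" if "i < d'" for i using that by (auto simp: box_def)
    then have "\<bar>x ! i\<bar> \<le> int L" if "i < d" for i
      using that \<open>length x = d\<close> d by (metis f_def less_le_trans nth_append)
    then show "x \<in> box d L" using that by (simp add: box_def)
  next
    assume "x \<in> box d L"
    then show "f x \<in> box d' L" using d by (auto simp: box_def f_def nth_append)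
  qed
  have fn: "nn (f x) (f y)" if "nn x y" for x y
  proof -
    have l: "length y = length x" using nn_length[OF that] .
    have "(\<Sum>i<length (f x). \<bar>f x ! i - f y ! i\<bar>) = (\<Sum>i<length x. \<bar>x ! i - y ! i\<bar>)"
      by (rule sum.mono_neutral_cong_right) (auto simp: f_def nth_append l)
    moreover have "(\<Sum>i<length x. \<bar>x ! i - y ! i\<bar>) = 1" using that unfolding nn_def by (rule conjunct2)
    moreover have "length (f x) = length (f y)" by (simp add: f_def l)
    ultimately show ?thesis by (simp only: nn_def)
  qed
  have st: "src (f ` e) = f (src e) \<and> tgt (f ` e) = f (tgt e)" if e: "e \<in> box_edges d L" for e
  proof -
    note p = box_edge_src_tgt[OF e]
    have "sum_list (src e) < sum_list (tgt e)"
    proof (rule ccontr)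
      assume "\<not> ?thesis"
      then have "sum_list (tgt e) < sum_list (src e)" using nn_sum_list[OF p(3)] by auto
      then have "src {tgt e, src e} = tgt e" by (rule src_tgt)
      then show False using p(1,2) by (simp add: insert_commute)
    qed
    then have "src {f (src e), f (tgt e)} = f (src e)" "tgt {f (src e), f (tgt e)} = f (tgt e)"
      by (simp_all add: src_tgt fs)
    moreover have "f ` e = {f (src e), f (tgt e)}" using arg_cong[OF p(1), of "image f"] by simp
    ultimately show ?thesis by simp
  qed
  have len: "length (src e) = d" "length (tgt e) = d" if "e \<in> box_edges d L" for e
    using box_edge_src_tgt(3,4)[OF that] nn_length[of "src e" "tgt e"] by (auto simp: box_def)
  have "box_mag d K L \<le> xy_mag (box d' L) (box_edges d' L) (\<lambda>_. K) (f (origin d))"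
    unfolding box_mag_def
  proof (rule xy_mag_embed[where g="image f", OF finite_box finite_box finite_box_edges finite_box_edges K])
    show "inj_on f (box d L)" using inj by (rule inj_on_subset) simp
    show "f x \<in> box d' L" if "x \<in> box d L" for x using that fb by (simp add: box_def)
    show "f ` e \<in> box_edges d' L" if e: "e \<in> box_edges d L" for e
    proof -
      obtain x y where xy: "e = {x, y}" "x \<in> box d L" "nn x y" using e by (auto simp: box_edges_eq)
      have "f x \<in> box d' L" using xy fb by (simp add: box_def)
      then show ?thesis using fn[OF xy(3)] xy(1) by (auto simp: box_edges_eq)
    qed
    show "inj_on (image f) (box_edges d L)" using inj by (auto simp: inj_on_def inj_image_eq_iff)
  qed (use origin_box st fb len in auto)
  also have "f (origin d) = origin d'" using d by (simp add: f_def origin_def replicate_add[symmetric])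
  finally show ?thesis by (simp add: box_mag_def)
qed

definition mag :: "nat \<Rightarrow> real \<Rightarrow> real" where "mag d K = lim (box_mag d K)"

lemma box_mag_tendsto: "0 \<le> K \<Longrightarrow> box_mag d K \<longlonglongrightarrow> mag d K"
proof -
  assume K: "0 \<le> K"
  have "\<forall>L. 0 \<le> box_mag d K L" using box_mag_nonneg[OF K] by simp
  then obtain l where l: "box_mag d K \<longlonglongrightarrow> l"
    by (rule decseq_convergent[OF box_mag_decseq[OF K]])
  show ?thesis unfolding mag_def limI[OF l] by (rule l)
qed

lemma mag_le: "0 \<le> K \<Longrightarrow> mag d K \<le> box_mag d K L"
  by (rule decseq_ge[OF box_mag_decseq box_mag_tendsto])

lemma mag_nonneg: "0 \<le> K \<Longrightarrow> 0 \<le> mag d K"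
  using LIMSEQ_le_const[OF box_mag_tendsto] box_mag_nonneg by blast

lemma mag_mono: "0 \<le> K \<Longrightarrow> K \<le> K' \<Longrightarrow> mag d K \<le> mag d K'"
  by (rule LIMSEQ_le[OF box_mag_tendsto box_mag_tendsto]) (auto intro: box_mag_mono)

lemma mag_mono_dim: "0 \<le> K \<Longrightarrow> d \<le> d' \<Longrightarrow> mag d K \<le> mag d' K"
  by (rule LIMSEQ_le[OF box_mag_tendsto box_mag_tendsto]) (auto intro: box_mag_mono_dim)

section \<open>Absence of order at high temperature\<close>

fun walks :: "site \<Rightarrow> nat \<Rightarrow> site list set" where
  "walks a 0 = {[a]}"
| "walks a (Suc n) = (\<Union>zs\<in>walks a n. (\<lambda>y. zs @ [y]) ` neighbours (last zs))"

lemma finite_walks: "finite (walks a n)"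
  by (induction n) (auto simp: finite_neighbours)

lemma walks_length: "zs \<in> walks a n \<Longrightarrow> zs \<noteq> [] \<and> length (last zs) = length a"
  by (induction n arbitrary: zs) (auto simp: neighbours_def)

lemma card_walks: "card (walks a n) \<le> (2 * length a) ^ n"
proof (induction n)
  case (Suc n)
  have "card (walks a (Suc n)) \<le> (\<Sum>zs\<in>walks a n. card ((\<lambda>y. zs @ [y]) ` neighbours (last zs)))"
    unfolding walks.simps by (rule card_UN_le[OF finite_walks])
  also have "\<dots> \<le> (\<Sum>zs\<in>walks a n. 2 * length a)"
  proof (rule sum_mono)
    fix zs assume "zs \<in> walks a n"
    then have "length (last zs) = length a" using walks_length by blast
    then show "card ((\<lambda>y. zs @ [y]) ` neighbours (last zs)) \<le> 2 * length a"
      using card_image_le[OF finite_neighbours, of "\<lambda>y. zs @ [y]" "last zs"] card_neighbours[of "last zs"] by simp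
  qed
  also have "\<dots> \<le> (2 * length a) ^ Suc n" using Suc by (simp add: mult.commute)
  finally show ?case .
qed simp

lemma take_walks:
  assumes "n < length zs" "zs ! 0 = a" "\<And>i. Suc i < length zs \<Longrightarrow> nn (zs ! i) (zs ! Suc i)"
  shows "take (Suc n) zs \<in> walks a n"
  using assms(1)
proof (induction n)
  case 0
  then show ?case using assms(2) by (cases zs) auto
next
  case (Suc n)
  have 1: "take (Suc (Suc n)) zs = take (Suc n) zs @ [zs ! Suc n]"
    using Suc.prems by (rule take_Suc_conv_app_nth)
  have "last (take (Suc n) zs) = zs ! n" using Suc.prems by (simp add: take_Suc_conv_app_nth)
  then have "zs ! Suc n \<in> neighbours (last (take (Suc n) zs))"
    using assms(3)[OF Suc.prems] nn_neighbours by simp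
  then show ?case using Suc 1 by auto
qed

definition walk_edges :: "site list \<Rightarrow> nat \<Rightarrow> edge set" where
  "walk_edges zs n = (\<lambda>i. {zs ! i, zs ! Suc i}) ` {..<n}"

lemma card_walk_edges:
  assumes "distinct zs" "n < length zs"
  shows "card (walk_edges zs n) = n"
proof -
  have "inj_on (\<lambda>i. {zs ! i, zs ! Suc i}) {..<n}"
  proof (rule inj_onI)
    fix i j assume ij: "i \<in> {..<n}" "j \<in> {..<n}" "{zs ! i, zs ! Suc i} = {zs ! j, zs ! Suc j}"
    then have "i < length zs" "Suc i < length zs" "j < length zs" "Suc j < length zs" using assms by auto
    with ij(3) show "i = j" using assms(1) by (auto simp: doubleton_eq_iff nth_eq_iff_index_eq)
  qed
  then show ?thesis by (simp add: walk_edges_def card_image)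
qed

text \<open>A walk needs at least L + 1 steps to leave the box, since a step changes each coordinate
  by at most 1. The certificates are edge sets of initial segments of self-avoiding connections;
  their number is at most that of all walks with L + 1 steps.\<close>

lemma box_mag_high_temperature:
  assumes K: "0 \<le> K"
  shows "box_mag d K L \<le> (2 * real d * (1 - exp (- 2 * K))) ^ Suc L"
proof -
  interpret wire_graph "box d L" "box_edges d L" "origin d" by (rule wire_graph_box)
  define n where "n = Suc L"
  define W where "W = {B \<in> (\<lambda>zs. walk_edges zs n) ` walks (origin d) n. B \<subseteq> box_edges d L \<and> card B = n}"
  have cW: "card W \<le> (2 * d) ^ n"
  proof -
    have "card W \<le> card ((\<lambda>zs. walk_edges zs n) ` walks (origin d) n)"
      unfolding W_def by (rule card_mono) (auto simp: finite_walks)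
    also have "\<dots> \<le> card (walks (origin d) n)" by (rule card_image_le[OF finite_walks])
    also have "\<dots> \<le> (2 * d) ^ n" using card_walks[of "origin d" n] by (simp add: origin_def)
    finally show ?thesis .
  qed
  have "box_mag d K L \<le> card W * (1 - exp (- 2 * K)) ^ n"
    unfolding box_mag_def
  proof (rule xy_mag_percolation_bound[OF K])
    show "finite W" using finite_walks by (simp add: W_def)
    show "B \<subseteq> box_edges d L \<and> card B = n" if "B \<in> W" for B using that by (simp add: W_def)
    fix A y assume A: "A \<subseteq> box_edges d L" and y: "y \<notin> box d L"
      and conn: "(origin d, y) \<in> {(x, y). {x, y} \<in> A}\<^sup>*"
    let ?r = "\<lambda>x y. {x, y} \<in> A"
    have "?r\<^sup>*\<^sup>* (origin d) y" using conn by (simp add: rtranclp_rtrancl_eq)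
    then obtain xs' where "rtrancl_path ?r (origin d) xs' y" by (auto simp: rtranclp_eq_rtrancl_path)
    \<comment> \<open>Without repeated vertices the first n edges are distinct, as the certificates
      in \<open>W\<close> require.\<close>
    then obtain xs where xs: "rtrancl_path ?r (origin d) xs y" "distinct (origin d # xs)"
      by (rule rtrancl_path_distinct)
    define zs where "zs = origin d # xs"
    have step: "{zs ! i, zs ! Suc i} \<in> A" if "Suc i < length zs" for i
      using rtrancl_path_nth[OF xs(1), of i] that by (simp add: zs_def)
    have nnz: "nn (zs ! i) (zs ! Suc i)" if i: "Suc i < length zs" for i
    proof -
      have "{zs ! i, zs ! Suc i} \<in> box_edges d L" using step[OF i] A by auto
      then obtain u v where uv: "{zs ! i, zs ! Suc i} = {u, v}" "nn u v"
        unfolding box_edges_eq by blast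
      then show ?thesis using nn_sym by (auto simp: doubleton_eq_iff)
    qed
    have coord: "length (zs ! i) = d \<and> (\<forall>k<d. \<bar>zs ! i ! k\<bar> \<le> int i)" if "i < length zs" for i
      using that
    proof (induction i)
      case 0 then show ?case by (simp add: zs_def origin_def)
    next
      case (Suc i)
      then have IH: "length (zs ! i) = d" "\<forall>k<d. \<bar>zs ! i ! k\<bar> \<le> int i" by auto
      note s = nnz[OF Suc.prems]
      have "\<bar>zs ! Suc i ! k\<bar> \<le> int (Suc i)" if "k < d" for k
      proof -
        have "\<bar>zs ! Suc i ! k - zs ! i ! k\<bar> \<le> 1" "\<bar>zs ! i ! k\<bar> \<le> int i"
          using nn_coord[OF s, of k] IH that by auto
        then show ?thesis by linarith
      qed
      then show ?case using nn_length[OF s] IH by simp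
    qed
    have nl: "n < length zs"
    proof (rule ccontr)
      assume "\<not> ?thesis"
      then have le: "length xs \<le> L" by (simp add: zs_def n_def)
      have "y = zs ! length xs"
      proof (cases "xs = []")
        case True
        then show ?thesis using xs(1) by (auto simp: zs_def elim: rtrancl_path.cases)
      next
        case False
        then show ?thesis using rtrancl_path_last[OF xs(1)] by (simp add: zs_def last_conv_nth nth_Cons')
      qed
      then have "length y = d" "\<forall>k<d. \<bar>y ! k\<bar> \<le> int (length xs)" using coord[of "length xs"] by (auto simp: zs_def)
      then have "y \<in> box d L" using le by (force simp: box_def)
      then show False using y by simp
    qed
    have sub: "walk_edges zs n \<subseteq> A" using step nl by (auto simp: walk_edges_def)
    have "walk_edges (take (Suc n) zs) n = walk_edges zs n"
      unfolding walk_edges_def by (intro image_cong refl) auto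
    moreover have "take (Suc n) zs \<in> walks (origin d) n"
      by (rule take_walks[OF nl]) (use nnz in \<open>auto simp: zs_def\<close>)
    ultimately have "walk_edges zs n \<in> (\<lambda>zs. walk_edges zs n) ` walks (origin d) n" by (metis imageI)
    then have "walk_edges zs n \<in> W"
      using card_walk_edges[OF _ nl] xs(2) sub A by (auto simp: W_def zs_def)
    then show "\<exists>B\<in>W. B \<subseteq> A" using sub by blast
  qed
  also have "\<dots> \<le> real ((2 * d) ^ n) * (1 - exp (- 2 * K)) ^ n"
    using cW K by (intro mult_right_mono of_nat_mono zero_le_power) auto
  also have "\<dots> = (2 * real d * (1 - exp (- 2 * K))) ^ n"
    by (simp only: power_mult_distrib of_nat_power of_nat_mult of_nat_numeral)
  finally show ?thesis by (simp only: n_def)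
qed

lemma mag_zero_high_temperature:
  assumes K: "0 \<le> K" and small: "2 * real d * (1 - exp (- 2 * K)) < 1"
  shows "mag d K = 0"
proof -
  let ?x = "2 * real d * (1 - exp (- 2 * K))"
  have "0 \<le> ?x" using K by (intro mult_nonneg_nonneg) auto
  then have "(\<lambda>L. ?x ^ Suc L) \<longlonglongrightarrow> 0" using small by (intro LIMSEQ_Suc LIMSEQ_power_zero) simp
  then have "mag d K \<le> 0"
    by (rule LIMSEQ_le_const) (use order.trans[OF mag_le box_mag_high_temperature] K in auto)
  then show ?thesis using mag_nonneg[OF K, of d] by simp
qed

section \<open>Absence of order in two dimensions\<close>

definition sup_norm :: "site \<Rightarrow> nat" where "sup_norm x = nat (max \<bar>x ! 0\<bar> \<bar>x ! 1\<bar>)"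

lemma sup_norm_box: "length x = 2 \<Longrightarrow> x \<in> box 2 L \<longleftrightarrow> sup_norm x \<le> L"
proof -
  assume l: "length x = 2"
  have "(\<forall>i<2::nat. P i) \<longleftrightarrow> P 0 \<and> P 1" for P using less_2_cases by auto
  then show ?thesis using l by (simp add: box_def sup_norm_def nat_le_iff)
qed

lemma sup_norm_nn:
  assumes "nn x y" "length x = 2"
  shows "sup_norm y = sup_norm x \<or> sup_norm y = Suc (sup_norm x) \<or> sup_norm x = Suc (sup_norm y)"
proof -
  have "\<bar>y ! 0 - x ! 0\<bar> \<le> 1" "\<bar>y ! 1 - x ! 1\<bar> \<le> 1"
    using nn_coord[OF assms(1), of 0] nn_coord[OF assms(1), of 1] assms(2) by auto
  then have m: "\<bar>max \<bar>y ! 0\<bar> \<bar>y ! 1\<bar> - max \<bar>x ! 0\<bar> \<bar>x ! 1\<bar>\<bar> \<le> 1"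
    unfolding max_def by (smt (verit))
  have arith: "nat q = nat p \<or> nat q = Suc (nat p) \<or> nat p = Suc (nat q)"
    if "\<bar>q - p\<bar> \<le> 1" "0 \<le> p" "0 \<le> q" for p q :: int
    using that by linarith
  show ?thesis unfolding sup_norm_def by (rule arith[OF m]) auto
qed

text \<open>The shell is covered by two pairs of opposite sides of 2 k + 1 points each; corners are
  counted twice, and k = 0 is included.\<close>

lemma card_shell: "card {x \<in> box 2 L. sup_norm x = k} \<le> 8 * k + 4"
proof -
  let ?k = "int k"
  let ?S = "({-?k, ?k} \<times> {-?k..?k}) \<union> ({-?k..?k} \<times> {-?k, ?k})"
  have "{x \<in> box 2 L. sup_norm x = k} \<subseteq> (\<lambda>(i, j). [i, j]) ` ?S"
  proof
    fix x assume x: "x \<in> {x \<in> box 2 L. sup_norm x = k}"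
    then have "length x = 2" by (simp add: box_def)
    then obtain i j where ij: "x = [i, j]" by (auto simp: length_Suc_conv numeral_2_eq_2)
    then have "(i, j) \<in> ?S" using x by (auto simp: sup_norm_def max_def split: if_splits)
    then show "x \<in> (\<lambda>(i, j). [i, j]) ` ?S" using ij by force
  qed
  then have "card {x \<in> box 2 L. sup_norm x = k} \<le> card ((\<lambda>(i, j). [i, j]) ` ?S)"
    by (rule card_mono[rotated]) simp
  also have "\<dots> \<le> card ?S" by (rule card_image_le) simp
  also have "\<dots> \<le> card ({-?k, ?k} \<times> {-?k..?k}) + card ({-?k..?k} \<times> {-?k, ?k})" by (rule card_Un_le)
  also have "\<dots> \<le> 2 * (2 * k + 1) + (2 * k + 1) * 2"
    unfolding card_cartesian_product by (intro add_mono mult_mono) (auto simp: card_insert_if)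
  finally show ?thesis by simp
qed

text \<open>A shell of radius k has order k sites, so the sum is harmonic. The 12 is 8 + 4 from
  \<open>card_shell\<close>, and \<open>max 1\<close> handles the origin.\<close>

lemma sum_shells: "(\<Sum>x\<in>box 2 L. 1 / (real (max 1 (sup_norm x)))\<^sup>2) \<le> 24 * harm (Suc L)"
proof -
  let ?g = "\<lambda>k. 1 / (real (max 1 k))\<^sup>2"
  have "(\<Sum>x\<in>box 2 L. ?g (sup_norm x)) = (\<Sum>k\<in>{0..L}. \<Sum>x\<in>{x \<in> box 2 L. sup_norm x = k}. ?g (sup_norm x))"
    by (rule sum.group[symmetric]) (use finite_box sup_norm_box in \<open>auto simp: box_def\<close>)
  also have "\<dots> \<le> (\<Sum>k\<in>{0..L}. 12 / real (max 1 k))"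
  proof (rule sum_mono)
    fix k
    have "(\<Sum>x\<in>{x \<in> box 2 L. sup_norm x = k}. ?g (sup_norm x)) = real (card {x \<in> box 2 L. sup_norm x = k}) * ?g k"
      by simp
    also have "\<dots> \<le> (12 * real (max 1 k)) * ?g k"
      using card_shell[of L k] by (intro mult_right_mono) (auto simp: max_def)
    also have "\<dots> = 12 / real (max 1 k)" by (simp add: power2_eq_square)
    finally show "(\<Sum>x\<in>{x \<in> box 2 L. sup_norm x = k}. ?g (sup_norm x)) \<le> 12 / real (max 1 k)" .
  qed
  also have "\<dots> = 12 + 12 * harm L"
  proof -
    have "(\<Sum>k\<in>{0..L}. 12 / real (max 1 k)) = 12 + (\<Sum>k\<in>{1..L}. 12 / real (max 1 k))"
      by (subst sum.atLeast_Suc_atMost) auto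
    also have "(\<Sum>k\<in>{1..L}. 12 / real (max 1 k)) = 12 * harm L"
      by (auto simp: harm_def sum_distrib_left divide_inverse max_def intro!: sum.cong)
    finally show ?thesis .
  qed
  also have "\<dots> \<le> 24 * harm (Suc L)"
  proof -
    have "harm (Suc 0) \<le> (harm (Suc L) :: real)" "harm L \<le> (harm (Suc L) :: real)" by (intro harm_mono; simp)+
    then show ?thesis by (simp add: harm_expand)
  qed
  finally show ?thesis .
qed

text \<open>The rotation angle decreases from pi / 2 at the origin to 0 outside, linearly in the
  harmonic number of the sup norm. With H = \<open>harm (Suc L)\<close> its increment at distance k
  is of order 1 / (k H), over order k edges, so the energy is of order 1 / H.\<close>

lemma box_mag_two_dim:
  assumes K: "0 \<le> K"
  shows "box_mag 2 K L \<le> 12 * pi\<^sup>2 * K / harm (Suc L)"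
proof -
  let ?H = "harm (Suc L) :: real"
  have H: "0 < ?H" by simp
  \<comment> \<open>\<open>min\<close> freezes the profile at 0 from radius L + 1 on, the first
    radius outside the box.\<close>
  define \<psi> where "\<psi> k = pi / 2 * (1 - harm (min k (Suc L)) / ?H)" for k
  define \<phi> where "\<phi> x = (if length x = 2 then \<psi> (sup_norm x) else 0)" for x :: site
  have out: "\<phi> x = 0" if "x \<notin> box 2 L" for x
  proof (cases "length x = 2")
    case True
    then have "min (sup_norm x) (Suc L) = Suc L" using that sup_norm_box[of x L] by simp
    moreover have "?H \<noteq> 0" using H by (rule less_imp_neq[symmetric])
    ultimately show ?thesis using True by (simp add: \<phi>_def \<psi>_def)
  qed (simp add: \<phi>_def)
  have orig: "\<phi> (origin 2) = pi / 2"
    by (simp add: \<phi>_def \<psi>_def origin_def sup_norm_def numeral_2_eq_2 harm_expand)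
  have step: "(\<psi> (Suc k) - \<psi> k)\<^sup>2 \<le> (pi / (2 * ?H))\<^sup>2 * (1 / (real (Suc k))\<^sup>2)" for k
  proof (cases "k \<le> L")
    case True
    have diff: "pi / 2 * (1 - x / h) - pi / 2 * (1 - y / h) = - (pi / (2 * h)) * (x - y)" for x y h :: real
      by (cases "h = 0") (simp_all add: field_simps)
    have "min (Suc k) (Suc L) = Suc k" "min k (Suc L) = k" using True by auto
    then have "\<psi> (Suc k) - \<psi> k = - (pi / (2 * ?H)) * (harm (Suc k) - harm k)"
      by (simp only: \<psi>_def diff)
    also have "harm (Suc k) - harm k = 1 / real (Suc k)"
      by (simp add: harm_Suc[of k] inverse_eq_divide del: of_nat_Suc)
    finally have "\<psi> (Suc k) - \<psi> k = - (pi / (2 * ?H)) * (1 / real (Suc k))" .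
    then show ?thesis by (simp add: power_mult_distrib power_divide del: of_nat_Suc)
  qed (simp add: \<psi>_def)
  have edge_le: "(\<phi> x - \<phi> y)\<^sup>2 \<le> (pi / (2 * ?H))\<^sup>2 * (1 / (real (max 1 (sup_norm x)))\<^sup>2)"
    if x: "x \<in> box 2 L" and xy: "nn x y" for x y
  proof -
    have l: "length x = 2" "length y = 2" using x nn_length[OF xy] by (auto simp: box_def)
    let ?c = "(pi / (2 * ?H))\<^sup>2"
    consider "sup_norm y = sup_norm x" | "sup_norm y = Suc (sup_norm x)" | "sup_norm x = Suc (sup_norm y)"
      using sup_norm_nn[OF xy l(1)] by blast
    then show ?thesis
    proof cases
      case 1 then show ?thesis using l by (simp add: \<phi>_def)
    next
      case 2
      have "(\<phi> x - \<phi> y)\<^sup>2 = (\<psi> (Suc (sup_norm x)) - \<psi> (sup_norm x))\<^sup>2"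
        using l 2 by (simp add: \<phi>_def power2_commute)
      also have "\<dots> \<le> ?c * (1 / (real (Suc (sup_norm x)))\<^sup>2)" by (rule step)
      also have "\<dots> \<le> ?c * (1 / (real (max 1 (sup_norm x)))\<^sup>2)"
        by (intro mult_left_mono divide_left_mono power_mono) auto
      finally show ?thesis .
    next
      case 3
      have "(\<phi> x - \<phi> y)\<^sup>2 = (\<psi> (Suc (sup_norm y)) - \<psi> (sup_norm y))\<^sup>2"
        using l 3 by (simp add: \<phi>_def)
      also have "\<dots> \<le> ?c * (1 / (real (Suc (sup_norm y)))\<^sup>2)" by (rule step)
      finally show ?thesis using 3 by (simp add: max_def)
    qed
  qed
  let ?w = "\<lambda>(x, y). (\<phi> x - \<phi> y)\<^sup>2"
  have "box_mag 2 K L \<le> (\<Sum>e\<in>box_edges 2 L. K * (\<phi> (src e) - \<phi> (tgt e))\<^sup>2) / 2"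
    unfolding box_mag_def
    by (rule xy_mag_rotation_bound[OF finite_box finite_box_edges]) (use K out orig in auto)
  also have "(\<Sum>e\<in>box_edges 2 L. K * (\<phi> (src e) - \<phi> (tgt e))\<^sup>2) = K * (\<Sum>e\<in>box_edges 2 L. (\<phi> (src e) - \<phi> (tgt e))\<^sup>2)"
    by (simp add: sum_distrib_left)
  also have "(\<Sum>e\<in>box_edges 2 L. (\<phi> (src e) - \<phi> (tgt e))\<^sup>2) \<le> (\<Sum>x\<in>box 2 L. 4 * ((pi / (2 * ?H))\<^sup>2 * (1 / (real (max 1 (sup_norm x)))\<^sup>2)))"
  proof -
    \<comment> \<open>Oriented edges whose first end lies in the box: every edge occurs at least
      once, and at most four of them start at a given site.\<close>
    define P where "P = (SIGMA x:box 2 L. {y \<in> neighbours x. nn x y})"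
    have fP: "finite P" unfolding P_def using finite_box finite_neighbours by auto
    have "box_edges 2 L = (\<lambda>(x, y). {x, y}) ` P"
      unfolding box_edges_eq P_def using nn_neighbours by force
    then have "(\<Sum>e\<in>box_edges 2 L. (\<phi> (src e) - \<phi> (tgt e))\<^sup>2) \<le>
      (\<Sum>p\<in>P. ((\<lambda>e. (\<phi> (src e) - \<phi> (tgt e))\<^sup>2) \<circ> (\<lambda>(x, y). {x, y})) p)"
      by (simp only:) (rule sum_image_le[OF fP], simp)
    also have "\<dots> = (\<Sum>p\<in>P. ?w p)"
    proof (rule sum.cong[OF refl])
      fix p assume "p \<in> P"
      then obtain x y where p: "p = (x, y)" "nn x y" by (auto simp: P_def)
      then show "((\<lambda>e. (\<phi> (src e) - \<phi> (tgt e))\<^sup>2) \<circ> (\<lambda>(x, y). {x, y})) p = ?w p"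
        using nn_src_tgt[OF p(2)] by (auto simp: power2_commute)
    qed
    also have "\<dots> = (\<Sum>x\<in>box 2 L. \<Sum>y\<in>{y \<in> neighbours x. nn x y}. (\<phi> x - \<phi> y)\<^sup>2)"
      unfolding P_def by (rule sum.Sigma[symmetric]) (use finite_box finite_neighbours in auto)
    also have "\<dots> \<le> (\<Sum>x\<in>box 2 L. 4 * ((pi / (2 * ?H))\<^sup>2 * (1 / (real (max 1 (sup_norm x)))\<^sup>2)))"
    proof (rule sum_mono)
      fix x assume x: "x \<in> box 2 L"
      let ?b = "(pi / (2 * ?H))\<^sup>2 * (1 / (real (max 1 (sup_norm x)))\<^sup>2)"
      have "(\<Sum>y\<in>{y \<in> neighbours x. nn x y}. (\<phi> x - \<phi> y)\<^sup>2) \<le> real (card {y \<in> neighbours x. nn x y}) * ?b"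
        by (rule sum_bounded_above) (use edge_le[OF x] in auto)
      also have "card {y \<in> neighbours x. nn x y} \<le> 4"
        using card_mono[OF finite_neighbours, of "{y \<in> neighbours x. nn x y}" x] card_neighbours[of x] x
        by (auto simp: box_def)
      then have "real (card {y \<in> neighbours x. nn x y}) * ?b \<le> 4 * ?b"
        by (intro mult_right_mono) auto
      finally show "(\<Sum>y\<in>{y \<in> neighbours x. nn x y}. (\<phi> x - \<phi> y)\<^sup>2) \<le> 4 * ?b" .
    qed
    finally show ?thesis .
  qed
  also have "(\<Sum>x\<in>box 2 L. 4 * ((pi / (2 * ?H))\<^sup>2 * (1 / (real (max 1 (sup_norm x)))\<^sup>2))) =
      4 * (pi / (2 * ?H))\<^sup>2 * (\<Sum>x\<in>box 2 L. 1 / (real (max 1 (sup_norm x)))\<^sup>2)"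
    by (simp add: sum_distrib_left mult.assoc)
  also have "\<dots> \<le> 4 * (pi / (2 * ?H))\<^sup>2 * (24 * ?H)"
    by (intro mult_left_mono sum_shells) auto
  also have "K * (4 * (pi / (2 * ?H))\<^sup>2 * (24 * ?H)) / 2 = 12 * pi\<^sup>2 * K / ?H"
    using H by (simp add: power2_eq_square field_simps)
  finally show ?thesis using K by (simp add: mult_left_mono divide_right_mono)
qed

lemma mag_two_dim:
  assumes K: "0 \<le> K"
  shows "mag 2 K = 0"
proof -
  have "filterlim (\<lambda>L. harm (Suc L) :: real) at_top sequentially"
    using harm_at_top by (rule filterlim_compose) (rule filterlim_Suc)
  then have "(\<lambda>L. 12 * pi\<^sup>2 * K / harm (Suc L)) \<longlonglongrightarrow> 0"
    by (rule tendsto_divide_0[OF tendsto_const filterlim_at_top_imp_at_infinity])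
  then have "mag 2 K \<le> 0"
    by (rule LIMSEQ_le_const) (use order.trans[OF mag_le[OF K] box_mag_two_dim[OF K]] in auto)
  then show ?thesis using mag_nonneg[OF K, of 2] by simp
qed

section \<open>Unpredictable lattice paths\<close>

lemma odd_decomposition: "0 < t \<Longrightarrow> \<exists>j i. t = 2 ^ j * (2 * i + 1)" for t :: nat
proof (induction t rule: less_induct)
  case (less t)
  show ?case
  proof (cases "even t")
    case True
    then obtain s where s: "t = 2 * s" by (elim evenE)
    then obtain j i where "s = 2 ^ j * (2 * i + 1)" using less by force
    then have "t = 2 ^ Suc j * (2 * i + 1)" using s by simp
    then show ?thesis by blast
  next
    case False
    then obtain i where "t = 2 ^ 0 * (2 * i + 1)" by (auto elim: oddE)
    then show ?thesis by blast
  qed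
qed

text \<open>Every time \<open>t > 0\<close> is \<open>2 ^ lev t * (2 * idx t + 1)\<close>. The times of level j come in blocks of \<open>4 ^ j\<close> consecutive
  ones; block b of level j carries a variable \<open>U (j, b)\<close>, uniform on \<open>{..<4 ^ j}\<close>, which is the number of
  times in the block at which the walk moves in its horizontal direction (the first for even j, the second
  for odd j). At all other times the walk moves in the third direction.\<close>

definition lev :: "nat \<Rightarrow> nat" where "lev t = multiplicity 2 t"

definition idx :: "nat \<Rightarrow> nat" where "idx t = t div 2 ^ Suc (lev t)"

lemma lev_eq: "lev (2 ^ j * (2 * i + 1)) = j"
  unfolding lev_def
proof (rule multiplicity_eqI)
  have "(2::nat) ^ j \<noteq> 0" by simp
  from dvd_times_left_cancel_iff[OF this, of 2 "2 * i + 1"]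
  show "\<not> 2 ^ Suc j dvd 2 ^ j * (2 * i + 1)" unfolding power_Suc2 by (rule ssubst) simp
qed simp

lemma idx_eq: "idx (2 ^ j * (2 * i + 1)) = i"
proof -
  have "2 ^ j * (2 * i + 1) div (2 ^ j * 2) = (2 * i + 1) div (2::nat)"
    by (subst div_mult_mult1) auto
  then show ?thesis unfolding idx_def lev_eq by (simp add: mult.commute)
qed

lemma lev_idx: "0 < t \<Longrightarrow> t = 2 ^ lev t * (2 * idx t + 1)"
  using odd_decomposition[of t] lev_eq idx_eq by metis

type_synonym choices = "nat \<times> nat \<Rightarrow> nat"

definition var :: "nat \<Rightarrow> nat \<times> nat" where "var t = (lev t, idx t div 4 ^ lev t)"

definition up :: "choices \<Rightarrow> nat \<Rightarrow> bool" where "up U t \<longleftrightarrow> idx t mod 4 ^ lev t < U (var t)"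

definition X1 :: "choices \<Rightarrow> nat \<Rightarrow> nat" where "X1 U t = card {r\<in>{1..t}. even (lev r) \<and> up U r}"

definition X2 :: "choices \<Rightarrow> nat \<Rightarrow> nat" where "X2 U t = card {r\<in>{1..t}. odd (lev r) \<and> up U r}"

definition blk :: "nat \<Rightarrow> nat \<Rightarrow> nat set" where
  "blk j b = (\<lambda>i. 2 ^ j * (2 * i + 1)) ` {b * 4 ^ j..<Suc b * 4 ^ j}"

lemma blk_iff: "0 < r \<Longrightarrow> r \<in> blk j b \<longleftrightarrow> var r = (j, b)"
proof
  assume "r \<in> blk j b"
  then obtain i where i: "r = 2 ^ j * (2 * i + 1)" "b * 4 ^ j \<le> i" "i < Suc b * 4 ^ j" by (auto simp: blk_def)
  have "i div 4 ^ j = b" by (rule div_nat_eqI) (use i in \<open>auto simp: mult.commute\<close>)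
  then show "var r = (j, b)" unfolding var_def i(1) lev_eq idx_eq by simp
next
  assume r: "0 < r" and v: "var r = (j, b)"
  then have j: "lev r = j" and b: "idx r div 4 ^ j = b" by (auto simp: var_def)
  have "b * 4 ^ j \<le> idx r" using b by (metis div_times_less_eq_dividend)
  moreover have "idx r < Suc b * 4 ^ j"
    using b dividend_less_div_times[of "4 ^ j" "idx r"] by (simp add: mult.commute)
  moreover have "r = 2 ^ j * (2 * idx r + 1)" using lev_idx[OF r] j by simp
  ultimately show "r \<in> blk j b" unfolding blk_def by auto
qed

lemma blk_pos: "r \<in> blk j b \<Longrightarrow> 0 < r"
  by (auto simp: blk_def)

lemma blk_var: "r \<in> blk j b \<Longrightarrow> var r = (j, b)"
  using blk_iff[OF blk_pos[of r j b], of j b] by simp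

text \<open>The index modulo 4^j runs once through \<open>{..<4 ^ j}\<close> along a block, so the
  moves counted are those at its first \<open>U (j, b)\<close> times.\<close>

lemma card_blk_up:
  assumes "U (j, b) \<le> 4 ^ j"
  shows "card {r\<in>blk j b. up U r} = U (j, b)"
proof -
  let ?f = "\<lambda>i. 2 ^ j * (2 * i + 1) :: nat" and ?u = "U (j, b)"
  have "{r\<in>blk j b. up U r} = ?f ` {b * 4 ^ j..<b * 4 ^ j + ?u}"
  proof (intro set_eqI iffI)
    fix r assume r: "r \<in> {r\<in>blk j b. up U r}"
    then obtain i where i: "r = ?f i" "b * 4 ^ j \<le> i" "i < Suc b * 4 ^ j" by (auto simp: blk_def)
    have "var r = (j, b)" using r by (simp add: blk_var)
    moreover have "lev r = j" "idx r = i" unfolding i(1) by (rule lev_eq, rule idx_eq)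
    ultimately have "i mod 4 ^ j < ?u" using r by (simp add: up_def)
    moreover have "i mod 4 ^ j = i - b * 4 ^ j"
    proof -
      have "i div 4 ^ j = b" by (rule div_nat_eqI) (use i in \<open>auto simp: mult.commute\<close>)
      then show ?thesis by (simp add: minus_div_mult_eq_mod[symmetric])
    qed
    ultimately show "r \<in> ?f ` {b * 4 ^ j..<b * 4 ^ j + ?u}" using i by auto
  next
    fix r assume "r \<in> ?f ` {b * 4 ^ j..<b * 4 ^ j + ?u}"
    then obtain i where i: "r = ?f i" "b * 4 ^ j \<le> i" "i < b * 4 ^ j + ?u" by auto
    then have i2: "i < Suc b * 4 ^ j" using assms by simp
    have rb: "r \<in> blk j b" using i i2 by (auto simp: blk_def)
    then have "var r = (j, b)" by (rule blk_var)
    moreover have "i mod 4 ^ j < ?u"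
    proof -
      have "i div 4 ^ j = b" by (rule div_nat_eqI) (use i i2 in \<open>auto simp: mult.commute\<close>)
      then have "i mod 4 ^ j = i - b * 4 ^ j" by (simp add: minus_div_mult_eq_mod[symmetric])
      then show ?thesis using i by simp
    qed
    moreover have "lev r = j" "idx r = i" unfolding i(1) by (rule lev_eq, rule idx_eq)
    ultimately have "up U r" by (simp add: up_def)
    then show "r \<in> {r\<in>blk j b. up U r}" using rb by simp
  qed
  moreover have "inj_on ?f A" for A by (auto simp: inj_on_def)
  ultimately show ?thesis by (simp add: card_image)
qed

text \<open>Times of level j are 2 * 2^j apart, so a block occupies a window of length 2 * 8^j. The
  window after the one that contains s ends no later than s + 4 * 8^j.\<close>

lemma blk_in:
  assumes "s + 4 * 8 ^ j \<le> t"
  shows "blk j (s div (2 * 8 ^ j) + 1) \<subseteq> {s<..t}"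
proof
  define b where "b = s div (2 * 8 ^ j) + 1"
  fix r assume "r \<in> blk j (s div (2 * 8 ^ j) + 1)"
  then obtain i where i: "r = 2 ^ j * (2 * i + 1)" "b * 4 ^ j \<le> i" "i < Suc b * 4 ^ j"
    by (auto simp: blk_def b_def)
  have e: "(2::nat) ^ j * (2 * (c * 4 ^ j)) = (2 * 8 ^ j) * c" for c
  proof -
    have "(2::nat) ^ j * 4 ^ j = 8 ^ j" by (simp add: power_mult_distrib[symmetric])
    then show ?thesis by (metis mult.assoc mult.commute)
  qed
  have "s < (2 * 8 ^ j) * b"
    unfolding b_def using dividend_less_times_div[of "2 * 8 ^ j" s] by simp
  also have "\<dots> = 2 ^ j * (2 * (b * 4 ^ j))" by (rule e[symmetric])
  also have "\<dots> \<le> 2 ^ j * (2 * i)" using i by simp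
  also have "\<dots> \<le> r" using i by simp
  finally have 1: "s < r" .
  have "r \<le> 2 ^ j * (2 * (Suc b * 4 ^ j))" unfolding i(1) using i(3) by (intro mult_left_mono) auto
  also have "\<dots> = (2 * 8 ^ j) * (s div (2 * 8 ^ j)) + 4 * 8 ^ j"
    unfolding e by (simp add: b_def)
  also have "\<dots> \<le> s + 4 * 8 ^ j" by simp
  finally show "r \<in> {s<..t}" using 1 assms by simp
qed

text \<open>With j = 2 q, the length 32 * 64^q = 4 * 8^(j + 1) guarantees complete blocks of both
  levels j and j + 1, by \<open>blk_in\<close>. The value q = 0 stands for gaps too short to use,
  where the bound is the trivial 1.\<close>

definition gap_scale :: "nat \<Rightarrow> nat" where "gap_scale k = (LEAST q. k < 32 * 64 ^ Suc q)"

text \<open>Two uniform variables with 4^j and 4^(j + 1) values must take prescribed values, which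
  has probability 1 / (4 * 256^q). For gaps of order 64^q this is decay with exponent 4/3, hence
  summable.\<close>

definition gap_prob :: "nat \<Rightarrow> real" where "gap_prob k = (1 / 256) ^ gap_scale k"

lemma gap_scale_less: "k < 32 * 64 ^ Suc (gap_scale k)"
proof -
  have "k < 2 ^ k" by (rule less_exp)
  also have "(2::nat) ^ k \<le> 64 ^ Suc k" by (rule order.trans[OF power_mono[of 2 64 k]]) auto
  finally have "k < 32 * 64 ^ Suc k" by simp
  then show ?thesis unfolding gap_scale_def by (rule LeastI)
qed

lemma gap_scale_ge:
  assumes "gap_scale k = Suc q"
  shows "32 * 64 ^ Suc q \<le> k"
proof -
  have "q < gap_scale k" using assms by simp
  then have "\<not> k < 32 * 64 ^ Suc q" unfolding gap_scale_def by (rule not_less_Least)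
  then show ?thesis by simp
qed

text \<open>Scale q has at most 2048 * 64^q gaps with bound 256^(-q) each, and 2048 * 4 / 3 is below
  3000.\<close>

lemma sum_gap_prob: "(\<Sum>k\<in>{1..n}. gap_prob k) \<le> 3000"
proof -
  let ?Q = "gap_scale ` {1..n}"
  have "(\<Sum>k\<in>{1..n}. gap_prob k) = (\<Sum>q\<in>?Q. \<Sum>k\<in>{k\<in>{1..n}. gap_scale k = q}. gap_prob k)"
    by (rule sum.group[symmetric]) auto
  also have "\<dots> \<le> (\<Sum>q\<in>?Q. 2048 * (1 / 4) ^ q)"
  proof (rule sum_mono)
    fix q
    have "{k\<in>{1..n}. gap_scale k = q} \<subseteq> {..<32 * 64 ^ Suc q}" using gap_scale_less by auto
    then have c: "card {k\<in>{1..n}. gap_scale k = q} \<le> 32 * 64 ^ Suc q"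
      using card_mono[of "{..<32 * 64 ^ Suc q}"] by force
    have "(\<Sum>k\<in>{k\<in>{1..n}. gap_scale k = q}. gap_prob k) = real (card {k\<in>{1..n}. gap_scale k = q}) * (1 / 256) ^ q"
      by (simp add: gap_prob_def)
    also have "\<dots> \<le> real (32 * 64 ^ Suc q) * (1 / 256) ^ q"
      using c by (intro mult_right_mono of_nat_mono) auto
    also have "\<dots> = 2048 * (64 * (1 / 256)) ^ q" unfolding power_mult_distrib by simp
    finally show "(\<Sum>k\<in>{k\<in>{1..n}. gap_scale k = q}. gap_prob k) \<le> 2048 * (1 / 4) ^ q" by simp
  qed
  also have "\<dots> = 2048 * (\<Sum>q\<in>?Q. (1 / 4) ^ q)" by (simp add: sum_distrib_left)
  also have "(\<Sum>q\<in>?Q. (1 / 4) ^ q) \<le> (\<Sum>q. (1 / 4 :: real) ^ q)"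
    by (rule sum_le_suminf) (auto intro: summable_geometric)
  also have "\<dots> = 4 / 3" by (subst suminf_geometric) auto
  finally show ?thesis by simp
qed

text \<open>A finite uniform space, so that probabilities are counts. Times up to T only read
  variables whose level and block number are at most T.\<close>

definition Omega :: "nat \<Rightarrow> choices set" where
  "Omega T = (\<Pi>\<^sub>E (j, b)\<in>{..T} \<times> {..T}. {..<4 ^ j})"

lemma finite_Omega: "finite (Omega T)"
  unfolding Omega_def by (intro finite_PiE) auto

lemma Omega_nonempty: "Omega T \<noteq> {}"
  unfolding Omega_def by (auto simp: PiE_eq_empty_iff lessThan_empty_iff)

lemma Omega_less: "U \<in> Omega T \<Longrightarrow> j \<le> T \<Longrightarrow> b \<le> T \<Longrightarrow> U (j, b) < 4 ^ j"
  unfolding Omega_def by (auto dest: PiE_mem[of U _ _ "(j, b)"])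

lemma Omega_upd: "U \<in> Omega T \<Longrightarrow> j \<le> T \<Longrightarrow> b \<le> T \<Longrightarrow> u < 4 ^ j \<Longrightarrow> U((j, b) := u) \<in> Omega T"
  unfolding Omega_def by (auto simp: PiE_iff extensional_def)

lemma X_split:
  assumes sub: "blk j b \<subseteq> {1..t}" and U: "U (j, b) \<le> 4 ^ j"
  shows "card {r\<in>{1..t}. (even (lev r) \<longleftrightarrow> even j) \<and> up U r} =
    card {r\<in>{1..t}. (even (lev r) \<longleftrightarrow> even j) \<and> up U r \<and> var r \<noteq> (j, b)} + U (j, b)"
proof -
  have "{r\<in>{1..t}. (even (lev r) \<longleftrightarrow> even j) \<and> up U r} =
    {r\<in>{1..t}. (even (lev r) \<longleftrightarrow> even j) \<and> up U r \<and> var r \<noteq> (j, b)} \<union> {r\<in>blk j b. up U r}"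
  proof (intro set_eqI iffI)
    fix r assume r: "r \<in> {r\<in>{1..t}. (even (lev r) \<longleftrightarrow> even j) \<and> up U r}"
    then have "0 < r" by simp
    from blk_iff[OF this, of j b] r
    show "r \<in> {r\<in>{1..t}. (even (lev r) \<longleftrightarrow> even j) \<and> up U r \<and> var r \<noteq> (j, b)} \<union> {r\<in>blk j b. up U r}" by auto
  next
    fix r assume r: "r \<in> {r\<in>{1..t}. (even (lev r) \<longleftrightarrow> even j) \<and> up U r \<and> var r \<noteq> (j, b)} \<union> {r\<in>blk j b. up U r}"
    show "r \<in> {r\<in>{1..t}. (even (lev r) \<longleftrightarrow> even j) \<and> up U r}"
    proof (cases "r \<in> blk j b")
      case True
      then have "var r = (j, b)" by (rule blk_var)
      then have "lev r = j" by (simp add: var_def)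
      then show ?thesis using True r sub by auto
    qed (use r in auto)
  qed
  moreover have "{r\<in>{1..t}. (even (lev r) \<longleftrightarrow> even j) \<and> up U r \<and> var r \<noteq> (j, b)} \<inter> {r\<in>blk j b. up U r} = {}"
    by (auto dest: blk_var)
  moreover have "finite {r\<in>blk j b. up U r}" using finite_subset[OF sub] by simp
  ultimately show ?thesis by (simp add: card_Un_disjoint card_blk_up[of U j b, OF U])
qed

text \<open>By \<open>X_split\<close> the coordinate is \<open>U (j, b)\<close> plus a number
  depending only on the other variables whose level has the same parity, so it can be solved for
  \<open>U (j, b)\<close>.\<close>

lemma X_determines:
  assumes sub: "blk j b \<subseteq> {1..t}" and U: "U (j, b) \<le> 4 ^ j" "U' (j, b) \<le> 4 ^ j"
    and agree: "\<And>i. i \<noteq> (j, b) \<Longrightarrow> (even (fst i) \<longleftrightarrow> even j) \<Longrightarrow> U i = U' i"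
    and eq: "card {r\<in>{1..t}. (even (lev r) \<longleftrightarrow> even j) \<and> up U r} = card {r\<in>{1..t}. (even (lev r) \<longleftrightarrow> even j) \<and> up U' r}"
  shows "U (j, b) = U' (j, b)"
proof -
  have "{r\<in>{1..t}. (even (lev r) \<longleftrightarrow> even j) \<and> up U r \<and> var r \<noteq> (j, b)} =
    {r\<in>{1..t}. (even (lev r) \<longleftrightarrow> even j) \<and> up U' r \<and> var r \<noteq> (j, b)}"
    using agree by (auto simp: up_def var_def)
  then show ?thesis using eq X_split[of j b t U, OF sub U(1)] X_split[of j b t U', OF sub U(2)] by simp
qed

text \<open>A long gap from s to t contains a complete block of some even level j and a complete block of level
  \<open>j + 1\<close>. Their two variables do not influence the walk up to time s, and given all other variables they are
  determined by the position at time t.\<close>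

lemma hit_prob:
  fixes Y :: "choices \<Rightarrow> real"
  assumes st: "s < t" "t \<le> T" and Y0: "\<And>U. 0 \<le> Y U"
    and dep: "\<And>U U'. (\<And>r. r \<in> {1..s} \<Longrightarrow> up U r = up U' r) \<Longrightarrow> Y U = Y U'"
  shows "(\<Sum>U\<in>Omega T. if X1 U t = c1 \<and> X2 U t = c2 then Y U else 0) \<le> gap_prob (t - s) * (\<Sum>U\<in>Omega T. Y U)"
proof (cases "gap_scale (t - s)")
  case 0
  then show ?thesis by (auto simp: gap_prob_def Y0 intro!: sum_mono)
next
  case (Suc q')
  define q where "q = Suc q'"
  define j where "j = 2 * q"
  have q: "gap_scale (t - s) = q" and k: "32 * 64 ^ q \<le> t - s" using gap_scale_ge[OF Suc] Suc by (auto simp: q_def)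
  have e8: "(8::nat) ^ j = 64 ^ q" by (simp add: j_def power_mult)
  define b1 b2 where "b1 = s div (2 * 8 ^ j) + 1" and "b2 = s div (2 * 8 ^ Suc j) + 1"
  have in1: "blk j b1 \<subseteq> {s<..t}" unfolding b1_def by (rule blk_in) (use k e8 st in simp)
  have in2: "blk (Suc j) b2 \<subseteq> {s<..t}" unfolding b2_def by (rule blk_in) (use k e8 st in simp)
  have "j < 2 ^ j" by (rule less_exp)
  also have "(2::nat) ^ j \<le> 8 ^ j" by (rule power_mono) auto
  also have "(8::nat) ^ j \<le> t - s" using k e8 by simp
  finally have jT: "Suc j \<le> T" "j \<le> T" using st by auto
  have "s div n \<le> s" for n by (rule div_le_dividend)
  then have bT: "b1 \<le> T" "b2 \<le> T" using st le_trans[of _ s] unfolding b1_def b2_def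
    by (metis Suc_eq_plus1 Suc_leI le_trans less_le_trans not_less_eq_eq linorder_not_less)+
  define A where "A = {U\<in>Omega T. X1 U t = c1 \<and> X2 U t = c2}"
  define B where "B = {..<(4::nat) ^ j} \<times> {..<(4::nat) ^ Suc j}"
  \<comment> \<open>Resampling the two block variables maps \<open>A \<times> B\<close> injectively
    into the sample space: the old values are recovered from the position at time t, since X1 reads
    only even and X2 only odd levels. As Y is unchanged, A carries at most the fraction 1 / card B
    of the total weight.\<close>
  define F where "F = (\<lambda>(U :: choices, u, v). U((j, b1) := u, (Suc j, b2) := v))"
  have inj: "inj_on F (A \<times> B)"
  proof (rule inj_onI)
    fix x x' assume x: "x \<in> A \<times> B" and x': "x' \<in> A \<times> B" and eq: "F x = F x'"
    obtain U u v where xe: "x = (U, u, v)" by (cases x) auto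
    obtain U' u' v' where xe': "x' = (U', u', v')" by (cases x') auto
    have U: "U \<in> Omega T" "U' \<in> Omega T" using x x' xe xe' by (auto simp: A_def)
    have Fe: "U((j, b1) := u, (Suc j, b2) := v) = U'((j, b1) := u', (Suc j, b2) := v')"
      using eq by (simp add: F_def xe xe')
    have uv: "u = u'" "v = v'"
      using fun_cong[OF Fe, of "(j, b1)"] fun_cong[OF Fe, of "(Suc j, b2)"] by auto
    have off: "U i = U' i" if "i \<noteq> (j, b1)" "i \<noteq> (Suc j, b2)" for i
      using fun_cong[OF Fe, of i] that by simp
    have X: "X1 U t = X1 U' t" "X2 U t = X2 U' t" using x x' xe xe' by (auto simp: A_def)
    have ej: "even j" by (simp add: j_def)
    have "U (j, b1) = U' (j, b1)"
    proof (rule X_determines)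
      show "blk j b1 \<subseteq> {1..t}" using in1 by auto
      show "U (j, b1) \<le> 4 ^ j" "U' (j, b1) \<le> 4 ^ j"
        using Omega_less[OF U(1) jT(2) bT(1)] Omega_less[OF U(2) jT(2) bT(1)] by auto
      show "U i = U' i" if "i \<noteq> (j, b1)" "even (fst i) \<longleftrightarrow> even j" for i
        by (rule off) (use that ej in auto)
    qed (use X(1) ej in \<open>simp add: X1_def\<close>)
    moreover have "U (Suc j, b2) = U' (Suc j, b2)"
    proof (rule X_determines)
      show "blk (Suc j) b2 \<subseteq> {1..t}" using in2 by auto
      show "U (Suc j, b2) \<le> 4 ^ Suc j" "U' (Suc j, b2) \<le> 4 ^ Suc j"
        using Omega_less[OF U(1) jT(1) bT(2)] Omega_less[OF U(2) jT(1) bT(2)] by auto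
      show "U i = U' i" if "i \<noteq> (Suc j, b2)" "even (fst i) \<longleftrightarrow> even (Suc j)" for i
        by (rule off) (use that ej in auto)
    qed (use X(2) ej in \<open>simp add: X2_def\<close>)
    ultimately have "U = U'" using off by (metis ext)
    then show "x = x'" by (simp add: xe xe' uv)
  qed
  have FO: "F ` (A \<times> B) \<subseteq> Omega T"
    using Omega_upd jT bT by (auto simp: F_def A_def B_def)
  have FY: "Y (F x) = Y (fst x)" for x
  proof -
    obtain U u v where xe: "x = (U, u, v)" by (cases x) auto
    have "up (F x) r = up U r" if "r \<in> {1..s}" for r
    proof -
      have "r \<notin> blk j b1" "r \<notin> blk (Suc j) b2" "0 < r" using in1 in2 that by auto
      then show ?thesis using blk_iff by (simp add: up_def F_def xe)
    qed
    then show ?thesis using dep[of "F x" U] by (simp add: xe)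
  qed
  have fA: "finite A" using finite_Omega by (simp add: A_def)
  have "real (card B) * (\<Sum>U\<in>A. Y U) = (\<Sum>U\<in>A. \<Sum>w\<in>B. Y U)" by (simp add: sum_distrib_left)
  also have "\<dots> = (\<Sum>x\<in>A \<times> B. Y (F x))" unfolding FY by (subst sum.cartesian_product') simp
  also have "\<dots> = (\<Sum>U\<in>F ` (A \<times> B). Y U)" by (simp add: sum.reindex[OF inj])
  also have "\<dots> \<le> (\<Sum>U\<in>Omega T. Y U)" by (rule sum_mono2[OF finite_Omega FO]) (rule Y0)
  finally have main: "real (card B) * (\<Sum>U\<in>A. Y U) \<le> (\<Sum>U\<in>Omega T. Y U)" .
  have cB: "real (card B) = 4 * 256 ^ q"
  proof -
    have "real (card B) = 4 * (4 ^ j * 4 ^ j)" by (simp add: B_def)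
    also have "(4::real) ^ j * 4 ^ j = 16 ^ j" by (simp add: power_mult_distrib[symmetric])
    also have "(16::real) ^ j = 256 ^ q" by (simp add: j_def power_mult)
    finally show ?thesis .
  qed
  have S0: "0 \<le> (\<Sum>U\<in>A. Y U)" by (intro sum_nonneg Y0)
  have "256 ^ q * (\<Sum>U\<in>A. Y U) \<le> (\<Sum>U\<in>Omega T. Y U)"
  proof -
    have "256 ^ q * (\<Sum>U\<in>A. Y U) \<le> 4 * 256 ^ q * (\<Sum>U\<in>A. Y U)"
      by (intro mult_right_mono S0) simp
    then show ?thesis using main unfolding cB by (rule order.trans)
  qed
  moreover have "(\<Sum>U\<in>Omega T. if X1 U t = c1 \<and> X2 U t = c2 then Y U else 0) = (\<Sum>U\<in>A. Y U)"
    unfolding A_def by (rule sum.mono_neutral_cong_right) (use finite_Omega in auto)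
  ultimately show ?thesis by (simp add: gap_prob_def q power_one_over field_simps)
qed

text \<open>The functions c1, c2 stand for one fixed path. Expand the product of the factors 1 +
  \<rho> according to the last hit and use \<open>hit_prob\<close> for the gap before it: the
  weighted number S of hits satisfies S <= 3000 N + 3000 \<rho> S with N =
  \<open>card (Omega T)\<close>. For \<rho> <= 1/6000 this gives S <= 6000 N, and the total N +
  \<rho> S is at most 2 N.\<close>

lemma expected_hits:
  fixes c1 c2 :: "nat \<Rightarrow> nat" and \<rho> :: real
  assumes \<rho>: "0 \<le> \<rho>" "\<rho> \<le> 1 / 6000"
  shows "(\<Sum>U\<in>Omega T. (1 + \<rho>) ^ card {t\<in>{1..T}. X1 U t = c1 t \<and> X2 U t = c2 t}) \<le> 2 * card (Omega T)"
proof -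
  define hit where "hit U t \<longleftrightarrow> X1 U t = c1 t \<and> X2 U t = c2 t" for U t
  define Q where "Q U n = (\<Prod>t\<in>{1..n}. if hit U t then 1 + \<rho> else 1)" for U n
  define Y where "Y U t = (if hit U t then Q U (t - 1) else 0)" for U t
  define e where "e t = (\<Sum>U\<in>Omega T. Y U t)" for t
  let ?N = "real (card (Omega T))"
  have Q0: "0 \<le> Q U n" for U n unfolding Q_def using \<rho> by (intro prod_nonneg) auto
  have Y0: "0 \<le> Y U t" for U t by (simp add: Y_def Q0)
  have Qex: "Q U n = 1 + \<rho> * (\<Sum>t\<in>{1..n}. Y U t)" for U n
  proof (induction n)
    case (Suc n)
    have "Q U (Suc n) = Q U n * (if hit U (Suc n) then 1 + \<rho> else 1)" by (simp add: Q_def)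
    also have "\<dots> = Q U n + \<rho> * Y U (Suc n)" by (simp add: Y_def algebra_simps)
    finally show ?case using Suc by (simp add: algebra_simps)
  qed (simp add: Q_def)
  have Xdep: "X1 U t = X1 U' t" "X2 U t = X2 U' t" if "\<And>r. r \<in> {1..s} \<Longrightarrow> up U r = up U' r" "t \<le> s" for U U' s t
  proof -
    have u: "up U r = up U' r" if "r \<in> {1..t}" for r
      using \<open>\<And>r. r \<in> {1..s} \<Longrightarrow> up U r = up U' r\<close>[of r] that \<open>t \<le> s\<close> by auto
    have "{r\<in>{1..t}. P r \<and> up U r} = {r\<in>{1..t}. P r \<and> up U' r}" for P
      using u by (intro Collect_cong) auto
    then show "X1 U t = X1 U' t" "X2 U t = X2 U' t" unfolding X1_def X2_def by simp_all
  qed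
  have Ydep: "Y U s = Y U' s" if u: "\<And>r. r \<in> {1..s} \<Longrightarrow> up U r = up U' r" for U U' s
  proof -
    have "hit U t = hit U' t" if "t \<le> s" for t
      using Xdep[OF u that] by (simp add: hit_def)
    then show ?thesis unfolding Y_def Q_def by (auto intro!: prod.cong)
  qed
  have rec: "e t \<le> gap_prob t * ?N + \<rho> * (\<Sum>s\<in>{1..<t}. gap_prob (t - s) * e s)" if t: "t \<in> {1..T}" for t
  proof -
    have "e t = (\<Sum>U\<in>Omega T. (if hit U t then 1 else 0) + \<rho> * (\<Sum>s\<in>{1..<t}. if hit U t then Y U s else 0))"
    proof -
      have "{1..t - 1} = {1..<t}" by auto
      then show ?thesis unfolding e_def Y_def[of _ t] Qex
        by (intro sum.cong refl) auto
    qed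
    also have "\<dots> = (\<Sum>U\<in>Omega T. if hit U t then 1 else 0) + \<rho> * (\<Sum>s\<in>{1..<t}. \<Sum>U\<in>Omega T. if hit U t then Y U s else 0)"
      by (subst sum.swap) (simp add: sum.distrib sum_distrib_left)
    also have "(\<Sum>U\<in>Omega T. if hit U t then 1 else 0) \<le> gap_prob t * ?N"
      using hit_prob[of 0 t T "\<lambda>_. 1" "c1 t" "c2 t"] t by (simp add: hit_def)
    also have "(\<Sum>s\<in>{1..<t}. \<Sum>U\<in>Omega T. if hit U t then Y U s else 0) \<le> (\<Sum>s\<in>{1..<t}. gap_prob (t - s) * e s)"
    proof (rule sum_mono)
      fix s assume s: "s \<in> {1..<t}"
      show "(\<Sum>U\<in>Omega T. if hit U t then Y U s else 0) \<le> gap_prob (t - s) * e s"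
        unfolding e_def hit_def
      proof (rule hit_prob)
        show "s < t" "t \<le> T" using s t by auto
        show "0 \<le> Y U s" for U by (rule Y0)
        show "Y U s = Y U' s" if "\<And>r. r \<in> {1..s} \<Longrightarrow> up U r = up U' r" for U U'
          by (rule Ydep) (rule that)
      qed
    qed
    finally show ?thesis using \<rho> by (simp add: mult_left_mono)
  qed
  define S where "S = (\<Sum>t\<in>{1..T}. e t)"
  have e0: "0 \<le> e t" for t unfolding e_def by (intro sum_nonneg Y0)
  have S0: "0 \<le> S" unfolding S_def by (intro sum_nonneg e0)
  have "S \<le> (\<Sum>t\<in>{1..T}. gap_prob t * ?N + \<rho> * (\<Sum>s\<in>{1..<t}. gap_prob (t - s) * e s))"
    unfolding S_def by (intro sum_mono rec)
  also have "\<dots> = (\<Sum>t\<in>{1..T}. gap_prob t) * ?N + \<rho> * (\<Sum>t\<in>{1..T}. \<Sum>s\<in>{1..<t}. gap_prob (t - s) * e s)"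
    by (simp add: sum.distrib sum_distrib_left sum_distrib_right)
  also have "(\<Sum>t\<in>{1..T}. \<Sum>s\<in>{1..<t}. gap_prob (t - s) * e s) = (\<Sum>s\<in>{1..T}. \<Sum>t\<in>{s<..T}. gap_prob (t - s) * e s)"
    by (subst sum.Sigma, simp, simp, subst sum.Sigma, simp, simp,
        rule sum.reindex_bij_witness[where i="\<lambda>(s, t). (t, s)" and j="\<lambda>(t, s). (s, t)"]) auto
  also have "\<dots> \<le> (\<Sum>s\<in>{1..T}. 3000 * e s)"
  proof (rule sum_mono)
    fix s
    have "(\<Sum>t\<in>{s<..T}. gap_prob (t - s)) = (\<Sum>k\<in>{1..T - s}. gap_prob k)"
      by (rule sum.reindex_bij_witness[where i="\<lambda>k. k + s" and j="\<lambda>t. t - s"]) auto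
    then have "(\<Sum>t\<in>{s<..T}. gap_prob (t - s)) \<le> 3000" using sum_gap_prob by simp
    from mult_right_mono[OF this e0[of s]]
    show "(\<Sum>t\<in>{s<..T}. gap_prob (t - s) * e s) \<le> 3000 * e s" by (simp add: sum_distrib_right)
  qed
  also have "(\<Sum>s\<in>{1..T}. 3000 * e s) = 3000 * S" by (simp add: S_def sum_distrib_left)
  finally have 1: "S \<le> (\<Sum>t\<in>{1..T}. gap_prob t) * ?N + \<rho> * (3000 * S)" using \<rho> by (simp add: mult_left_mono)
  have "\<rho> * (3000 * S) \<le> 1 / 6000 * (3000 * S)" using \<rho> S0 by (intro mult_right_mono) auto
  moreover have "(\<Sum>t\<in>{1..T}. gap_prob t) * ?N \<le> 3000 * ?N" by (intro mult_right_mono sum_gap_prob) auto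
  ultimately have S: "S \<le> 6000 * ?N" using 1 by simp
  have "(\<Sum>U\<in>Omega T. (1 + \<rho>) ^ card {t\<in>{1..T}. X1 U t = c1 t \<and> X2 U t = c2 t}) = (\<Sum>U\<in>Omega T. Q U T)"
    unfolding Q_def hit_def
    by (intro sum.cong refl) (simp add: prod.If_cases Int_def)
  also have "\<dots> = ?N + \<rho> * S"
  proof -
    have "S = (\<Sum>U\<in>Omega T. \<Sum>t\<in>{1..T}. Y U t)" unfolding S_def e_def by (rule sum.swap)
    then show ?thesis unfolding Qex by (simp add: sum.distrib sum_distrib_left)
  qed
  also have "\<rho> * S \<le> 1 / 6000 * (6000 * ?N)" using \<rho> S S0 by (intro mult_mono) auto
  finally show ?thesis by simp
qed

section \<open>Order in three dimensions\<close>

text \<open>The third coordinate absorbs all remaining steps, so the coordinate sum equals the time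
  and every step follows the orientation from \<open>src\<close> to \<open>tgt\<close>.\<close>

definition pos :: "choices \<Rightarrow> nat \<Rightarrow> site" where
  "pos U t = [int (X1 U t), int (X2 U t), int t - int (X1 U t) - int (X2 U t)]"

lemma X_Suc:
  "X1 U (Suc t) = X1 U t + (if even (lev (Suc t)) \<and> up U (Suc t) then 1 else 0)"
  "X2 U (Suc t) = X2 U t + (if odd (lev (Suc t)) \<and> up U (Suc t) then 1 else 0)"
proof -
  have c: "card {r\<in>{1..Suc t}. P r} = card {r\<in>{1..t}. P r} + (if P (Suc t) then 1 else 0)" for P
  proof -
    have "{r\<in>{1..Suc t}. P r} = (if P (Suc t) then insert (Suc t) {r\<in>{1..t}. P r} else {r\<in>{1..t}. P r})"
      by (auto simp: le_Suc_eq)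
    then show ?thesis by simp
  qed
  show "X1 U (Suc t) = X1 U t + (if even (lev (Suc t)) \<and> up U (Suc t) then 1 else 0)"
    "X2 U (Suc t) = X2 U t + (if odd (lev (Suc t)) \<and> up U (Suc t) then 1 else 0)"
    unfolding X1_def X2_def by (rule c)+
qed

lemma pos_0: "pos U 0 = origin 3"
  by (simp add: pos_def X1_def X2_def origin_def numeral_3_eq_3)

lemma nn_pos: "nn (pos U t) (pos U (Suc t))"
  by (auto simp: pos_def nn_def X_Suc lessThan_Suc numeral_3_eq_3)

lemma sum_list_pos: "sum_list (pos U t) = int t"
  by (simp add: pos_def)

lemma src_tgt_pos: "src {pos U t, pos U (Suc t)} = pos U t" "tgt {pos U t, pos U (Suc t)} = pos U (Suc t)"
  by (rule src_tgt; simp add: sum_list_pos)+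

definition exit_time :: "nat \<Rightarrow> choices \<Rightarrow> nat" where
  "exit_time L U = (LEAST t. pos U t \<notin> box 3 L)"

text \<open>Three coordinates with sum 3 L + 1 cannot all be at most L.\<close>

lemma pos_outside: "pos U (3 * L + 1) \<notin> box 3 L"
proof
  assume "pos U (3 * L + 1) \<in> box 3 L"
  then have "\<forall>i<3. \<bar>pos U (3 * L + 1) ! i\<bar> \<le> int L" by (simp add: box_def)
  then have "\<bar>pos U (3 * L + 1) ! 0\<bar> \<le> int L" "\<bar>pos U (3 * L + 1) ! 1\<bar> \<le> int L" "\<bar>pos U (3 * L + 1) ! 2\<bar> \<le> int L"
    by auto
  then show False by (simp add: pos_def)
qed

lemma exit_time: "pos U (exit_time L U) \<notin> box 3 L" "exit_time L U \<le> 3 * L + 1"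
  "t < exit_time L U \<Longrightarrow> pos U t \<in> box 3 L"
  unfolding exit_time_def
  by (rule LeastI[where P="\<lambda>t. pos U t \<notin> box 3 L", OF pos_outside],
      rule Least_le[where P="\<lambda>t. pos U t \<notin> box 3 L", OF pos_outside],
      use not_less_Least in blast)

definition path :: "nat \<Rightarrow> choices \<Rightarrow> edge set" where
  "path L U = (\<lambda>t. {pos U t, pos U (Suc t)}) ` {..<exit_time L U}"

lemma path_subset: "path L U \<subseteq> box_edges 3 L"
proof
  fix e assume "e \<in> path L U"
  then obtain t where "t < exit_time L U" "e = {pos U t, pos U (Suc t)}" by (auto simp: path_def)
  then show "e \<in> box_edges 3 L" unfolding box_edges_eq using exit_time(3) nn_pos by blast
qed

text \<open>Consecutive edge characters telescope because a unit spin cancels its conjugate; the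
  exit point carries the boundary spin 1.\<close>

lemma path_product:
  assumes z: "z \<in> space (spins (box 3 L))"
  shows "(\<Prod>e\<in>path L U. edge_char (box 3 L) e z) = spin (box 3 L) z (origin 3)"
proof -
  let ?s = "\<lambda>t. spin (box 3 L) z (pos U t)"
  have inj: "inj_on (\<lambda>t. {pos U t, pos U (Suc t)}) A" for A
    by (rule inj_on_inverseI[where g="\<lambda>e. nat (sum_list (src e))"]) (simp add: src_tgt_pos sum_list_pos)
  have u: "?s t * cnj (?s t) = 1" for t using z by (simp add: complex_norm_square[symmetric])
  have tele: "(\<Prod>t<n. ?s t * cnj (?s (Suc t))) = ?s 0 * cnj (?s n)" for n
  proof (induction n)
    case 0 then show ?case using u[of 0] by simp
  next
    case (Suc n)
    have "(\<Prod>t<Suc n. ?s t * cnj (?s (Suc t))) = ?s 0 * (?s n * cnj (?s n)) * cnj (?s (Suc n))"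
      unfolding prod.lessThan_Suc Suc.IH by (simp only: mult_ac)
    then show ?case by (simp only: u mult_1_right)
  qed
  have "(\<Prod>e\<in>path L U. edge_char (box 3 L) e z) = (\<Prod>t<exit_time L U. edge_char (box 3 L) {pos U t, pos U (Suc t)} z)"
    unfolding path_def by (simp add: prod.reindex[OF inj])
  also have "\<dots> = ?s 0 * cnj (?s (exit_time L U))"
    unfolding edge_char_def src_tgt_pos by (rule tele)
  also have "?s (exit_time L U) = 1" using exit_time(1) by (simp add: spin_def)
  finally show ?thesis by (simp add: pos_0)
qed

text \<open>Along a path the coordinate sum is the time, so common edges of two paths are visited simultaneously.\<close>

lemma card_path_inter:
  "card (path L U \<inter> path L U') \<le> card {t\<in>{1..3 * L + 1}. X1 U t = X1 U' t \<and> X2 U t = X2 U' t}"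
proof (rule card_inj_on_le)
  show "inj_on (\<lambda>e. nat (sum_list (tgt e))) (path L U \<inter> path L U')"
  proof (rule inj_onI)
    fix e e' assume "e \<in> path L U \<inter> path L U'" "e' \<in> path L U \<inter> path L U'"
      and eq: "nat (sum_list (tgt e)) = nat (sum_list (tgt e'))"
    then obtain t t' where t: "e = {pos U t, pos U (Suc t)}" "e' = {pos U t', pos U (Suc t')}"
      by (auto simp: path_def)
    have "Suc t = Suc t'" using eq unfolding t src_tgt_pos sum_list_pos by simp
    then show "e = e'" by (simp add: t)
  qed
  show "(\<lambda>e. nat (sum_list (tgt e))) ` (path L U \<inter> path L U') \<subseteq>
      {t\<in>{1..3 * L + 1}. X1 U t = X1 U' t \<and> X2 U t = X2 U' t}"
  proof
    fix n assume "n \<in> (\<lambda>e. nat (sum_list (tgt e))) ` (path L U \<inter> path L U')"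
    then obtain e where e: "e \<in> path L U" "e \<in> path L U'" "n = nat (sum_list (tgt e))" by auto
    then obtain t t' where t: "t < exit_time L U" "e = {pos U t, pos U (Suc t)}"
      and t': "e = {pos U' t', pos U' (Suc t')}" by (auto simp: path_def)
    have "tgt e = pos U (Suc t)" unfolding t(2) by (rule src_tgt_pos)
    moreover have "tgt e = pos U' (Suc t')" unfolding t' by (rule src_tgt_pos)
    ultimately have eq: "pos U (Suc t) = pos U' (Suc t')" and n: "n = Suc t" using e(3) by (auto simp: sum_list_pos)
    have "int (Suc t) = int (Suc t')" using arg_cong[OF eq, of sum_list] by (simp only: sum_list_pos)
    then have "t = t'" by simp
    then have "X1 U (Suc t) = X1 U' (Suc t)" "X2 U (Suc t) = X2 U' (Suc t)" using eq by (auto simp: pos_def)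
    then show "n \<in> {t\<in>{1..3 * L + 1}. X1 U t = X1 U' t \<and> X2 U t = X2 U' t}"
      using n t(1) exit_time(2)[of L U] by auto
  qed
qed simp

text \<open>\<open>vm_r_ge\<close> at 100000 gives 1 / r^2 <= 1 + 1/6000, within the range of
  \<open>expected_hits\<close>; its constant C = 2 yields (1 + C) / 2 = 3/2.\<close>

lemma box_mag_three_dim: "1 \<le> box_mag 3 100000 L * (3 / 2)"
proof -
  interpret wire_graph "box 3 L" "box_edges 3 L" "origin 3" by (rule wire_graph_box)
  define r where "r = vm_r 100000"
  define \<rho> where "\<rho> = (1 / 6000 :: real)"
  define T where "T = 3 * L + 1"
  have r: "1 - 2 / 100000 \<le> r" unfolding r_def by (rule vm_r_ge) simp
  have "(1 - 2 / 100000)\<^sup>2 \<le> r\<^sup>2" using r by (intro power_mono) auto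
  then have "6000 / 6001 \<le> r\<^sup>2" by (simp add: power2_eq_square)
  then have rr: "1 / r\<^sup>2 \<le> 1 + \<rho>" using r by (simp add: \<rho>_def divide_simps)
  have "1 \<le> xy_mag (box 3 L) (box_edges 3 L) (\<lambda>_. 100000) (origin 3) * ((1 + 2) / 2)"
  proof (rule xy_mag_path_bound[where \<Gamma>="Omega T" and P="path L"])
    show "0 < vm_r 100000" using r by (simp add: r_def)
    \<comment> \<open>With U' frozen, its path is the fixed target in \<open>expected_hits\<close>,
      whose bound does not depend on the target.\<close>
    have "(\<Sum>U'\<in>Omega T. \<Sum>U\<in>Omega T. (1 / r\<^sup>2) ^ card (path L U' \<inter> path L U)) \<le>
      (\<Sum>U'\<in>Omega T. 2 * real (card (Omega T)))"
    proof (rule sum_mono)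
      fix U'
      have "(\<Sum>U\<in>Omega T. (1 / r\<^sup>2) ^ card (path L U' \<inter> path L U)) \<le>
        (\<Sum>U\<in>Omega T. (1 + \<rho>) ^ card {t\<in>{1..T}. X1 U t = X1 U' t \<and> X2 U t = X2 U' t})"
      proof (rule sum_mono)
        fix U
        have "(1 / r\<^sup>2) ^ card (path L U' \<inter> path L U) \<le> (1 + \<rho>) ^ card (path L U \<inter> path L U')"
          unfolding Int_commute[of "path L U'"] using rr by (intro power_mono) auto
        also have "\<dots> \<le> (1 + \<rho>) ^ card {t\<in>{1..T}. X1 U t = X1 U' t \<and> X2 U t = X2 U' t}"
          unfolding T_def by (intro power_increasing card_path_inter) (simp add: \<rho>_def)
        finally show "(1 / r\<^sup>2) ^ card (path L U' \<inter> path L U) \<le>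
          (1 + \<rho>) ^ card {t\<in>{1..T}. X1 U t = X1 U' t \<and> X2 U t = X2 U' t}" .
      qed
      also have "\<dots> \<le> 2 * real (card (Omega T))"
        using expected_hits[of \<rho> T "X1 U'" "X2 U'"] by (simp add: \<rho>_def)
      finally show "(\<Sum>U\<in>Omega T. (1 / r\<^sup>2) ^ card (path L U' \<inter> path L U)) \<le> 2 * real (card (Omega T))" .
    qed
    then show "(\<Sum>U'\<in>Omega T. \<Sum>U\<in>Omega T. (1 / (vm_r 100000)\<^sup>2) ^ card (path L U' \<inter> path L U)) \<le> (2::real) * (card (Omega T))\<^sup>2"
      by (simp add: r_def power2_eq_square mult_ac)
  qed (use finite_Omega Omega_nonempty path_subset path_product in auto)
  then show ?thesis by (simp add: box_mag_def)
qed

lemma mag_three_dim: "0 < mag 3 100000"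
proof -
  have "2 / 3 \<le> mag 3 100000"
    by (rule LIMSEQ_le_const[OF box_mag_tendsto]) (use box_mag_three_dim in \<open>auto simp: field_simps\<close>)
  then show ?thesis by simp
qed

text \<open>The stated threshold lies inside the region of the percolation bound: 2^(-3/2) <= 1/2
  and ln (1 + x) <= x give J < 1 / (8 d^2) <= 1 / (8 d), while 1 - exp (- 4 J) <= 4 J.\<close>

lemma threshold_small:
  assumes d: "1 \<le> d" and J: "0 \<le> J" "J < 2 powr (-3/2) * ln (1 + 1 / (2 * real d)^2)"
  shows "2 * real d * (1 - exp (- 2 * (2 * J))) < 1"
proof -
  have p: "2 powr (-3/2) \<le> (1 / 2 :: real)"
  proof -
    have "2 powr (-3/2) \<le> (2 powr (-1) :: real)" by (rule powr_mono) auto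
    then show ?thesis by (simp add: powr_minus)
  qed
  have "ln (1 + 1 / (2 * real d)^2) \<le> 1 / (2 * real d)^2" by (rule ln_add_one_self_le_self) simp
  moreover have "0 \<le> ln (1 + 1 / (2 * real d)^2)" by (rule ln_ge_zero) simp
  ultimately have "2 powr (-3/2) * ln (1 + 1 / (2 * real d)^2) \<le> 1 / 2 * (1 / (2 * real d)^2)"
    using p by (intro mult_mono) auto
  then have "J < 1 / 2 * (1 / (2 * real d)^2)" using J by simp
  moreover have "1 / 2 * (1 / (2 * real d)^2) \<le> 1 / (8 * real d)"
  proof -
    have "8 * real d * 1 \<le> 8 * real d * real d" using d by (intro mult_left_mono) auto
    then have "1 / (8 * real d * real d) \<le> 1 / (8 * real d)" using d by (intro divide_left_mono) auto
    then show ?thesis by (simp add: power2_eq_square)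
  qed
  ultimately have "J < 1 / (8 * real d)" by linarith
  then have "8 * real d * J < 1" using d by (simp add: field_simps)
  moreover have "1 - exp (- 2 * (2 * J)) \<le> 4 * J" using exp_ge_add_one_self[of "- 2 * (2 * J)"] by simp
  then have "2 * real d * (1 - exp (- 2 * (2 * J))) \<le> 2 * real d * (4 * J)" by (intro mult_left_mono) auto
  moreover have "2 * real d * (4 * J) = 8 * real d * J" by simp
  ultimately show ?thesis by linarith
qed

text \<open>Monotonicity in J makes the zero set an interval starting at 0. Its supremum is finite
  because order at J = 50000 in dimension 3, that is at spin coupling 100000, passes to higher
  dimensions.\<close>

lemma mag_threshold:
  assumes d: "3 \<le> d"
  shows "\<exists>Jc::real. (\<forall>J. 0 \<le> J \<and> J > Jc \<longrightarrow> mag d (2 * J) > 0) \<and> (\<forall>J. 0 \<le> J \<and> J < Jc \<longrightarrow> mag d (2 * J) = 0)"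
proof -
  define S where "S = {J. 0 \<le> J \<and> mag d (2 * J) = 0}"
  have 0: "0 \<in> S" using mag_zero_high_temperature[of 0 d] by (simp add: S_def)
  have ub: "J \<le> 50000" if "J \<in> S" for J
  proof (rule ccontr)
    assume "\<not> J \<le> 50000"
    then have "mag d 100000 \<le> mag d (2 * J)" by (intro mag_mono) auto
    moreover have "mag 3 100000 \<le> mag d 100000" by (rule mag_mono_dim) (use d in auto)
    ultimately show False using that mag_three_dim by (simp add: S_def)
  qed
  have bdd: "bdd_above S" using ub by (rule bdd_aboveI)
  show ?thesis
  proof (intro exI[of _ "Sup S"] conjI allI impI)
    fix J assume J: "0 \<le> J \<and> J > Sup S"
    then have "J \<notin> S" using cSup_upper[OF _ bdd, of J] by auto
    then have "mag d (2 * J) \<noteq> 0" using J by (simp add: S_def)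
    then show "mag d (2 * J) > 0" using mag_nonneg[of "2 * J" d] J by simp
  next
    fix J assume J: "0 \<le> J \<and> J < Sup S"
    then obtain J' where J': "J' \<in> S" "J < J'" using less_cSup_iff[OF _ bdd] 0 by blast
    then have "mag d (2 * J) \<le> 0" using mag_mono[of "2 * J" "2 * J'" d] J by (simp add: S_def)
    then show "mag d (2 * J) = 0" using mag_nonneg[of "2 * J" d] J by simp
  qed
qed

theorem theorem5p1:
  shows "\<exists>mt :: nat \<Rightarrow> real \<Rightarrow> real.
    (\<forall>d\<ge>1. \<forall>J\<ge>0. (\<lambda>L. m_L d J L) \<longlonglongrightarrow> mt d J) \<and>
    (\<forall>d d' J. 1 \<le> d \<and> d \<le> d' \<and> 0 \<le> J \<longrightarrow> mt d J \<le> mt d' J) \<and>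
    (\<forall>d J J'. 1 \<le> d \<and> 0 \<le> J \<and> J \<le> J' \<longrightarrow> mt d J \<le> mt d J') \<and>
    (\<forall>d\<ge>1. \<forall>J\<ge>0. J < 2 powr (-3/2) * ln (1 + 1 / (2 * real d)^2) \<longrightarrow> mt d J = 0) \<and>
    (\<forall>d J. (d = 1 \<or> d = 2) \<and> 0 \<le> J \<longrightarrow> mt d J = 0) \<and>
    (\<forall>d\<ge>3. \<exists>Jc::real. (\<forall>J. 0 \<le> J \<and> J > Jc \<longrightarrow> mt d J > 0) \<and>
                       (\<forall>J. 0 \<le> J \<and> J < Jc \<longrightarrow> mt d J = 0))"
\<comment> \<open>The spin coupling is twice the wire coupling.\<close>
proof (rule exI[of _ "\<lambda>d J. mag d (2 * J)"], intro conjI allI impI)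
  fix d :: nat and J :: real assume J: "0 \<le> J"
  have "m_L d J = box_mag d (2 * J)" by (rule ext) (rule m_L_eq[OF J])
  then show "(\<lambda>L. m_L d J L) \<longlonglongrightarrow> mag d (2 * J)" using box_mag_tendsto[of "2 * J" d] J by simp
next
  fix d d' :: nat and J :: real assume "1 \<le> d \<and> d \<le> d' \<and> 0 \<le> J"
  then show "mag d (2 * J) \<le> mag d' (2 * J)" by (intro mag_mono_dim) auto
next
  fix d :: nat and J J' :: real assume "1 \<le> d \<and> 0 \<le> J \<and> J \<le> J'"
  then show "mag d (2 * J) \<le> mag d (2 * J')" by (intro mag_mono) auto
next
  fix d :: nat and J :: real
  assume "1 \<le> d" "0 \<le> J" "J < 2 powr (-3/2) * ln (1 + 1 / (2 * real d)^2)"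
  then show "mag d (2 * J) = 0" by (intro mag_zero_high_temperature threshold_small) auto
next
  \<comment> \<open>Monotonicity in the dimension reduces d = 1 to d = 2.\<close>
  fix d :: nat and J :: real assume "(d = 1 \<or> d = 2) \<and> 0 \<le> J"
  then have "0 \<le> mag d (2 * J)" "mag d (2 * J) \<le> mag 2 (2 * J)" "mag 2 (2 * J) = 0"
    by (auto intro!: mag_nonneg mag_mono_dim mag_two_dim)
  then show "mag d (2 * J) = 0" by simp
next
  fix d :: nat assume "3 \<le> d"
  then show "\<exists>Jc::real. (\<forall>J. 0 \<le> J \<and> J > Jc \<longrightarrow> mag d (2 * J) > 0) \<and> (\<forall>J. 0 \<le> J \<and> J < Jc \<longrightarrow> mag d (2 * J) = 0)"
    by (rule mag_threshold)
qed

end
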